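(* Let $M$ be an $n$-dimensional complex manifold, let $Z\subset\mathcal{O}(M)$ be a finite-dimensional complex vector subspace of the algebra of holomorphic functions on $M$, and let $b\in M_Z^{\mathrm{inv}}$. Then the space $Z_b$ of germs at $b$ of elements of $Z$ has the structure of an Artinian algebra, unique up to canonical isomorphism, in the following sense. (i) For every local parametrisation $\Phi=\Phi(s)$ of $M$ centred at $b$, the subspace $(Z_b^{s}{\downarrow})^{\bot}$ is an ideal of $\mathbb{C}\{s\}$, the quotient $\mathbb{C}\{s\}/(Z_b^{s}{\downarrow})^{\bot}$ is an Artinian algebra, and the composite $Z_b\cong Z_b^{s}\hookrightarrow\mathbb{C}\{s\}\to\mathbb{C}\{s\}/(Z_b^{s}{\downarrow})^{\bot}$ is an isomorphism of vector spaces (through which $Z_b$ receives its algebra structure). (ii) If $\Phi=\Phi(s)$ and $\Psi=\Psi(t)$ are two local parametrisations of $M$ centred at $b$ and $\Theta$ is the biholomorphic germ with $\Phi=\Psi\circ\Theta$, then the algebra isomorphism ${}^s\tilde{j}_\theta:\mathbb{C}\{s\}\to\mathbb{C}\{t\}$ maps $(Z_b^{s}{\downarrow})^{\bot}$ onto $(Z_b^{t}{\downarrow})^{\bot}$ and hence induces an isomorphism of algebras $\mathbb{C}\{s\}/(Z_b^{s}{\downarrow})^{\bot}\to\mathbb{C}\{t\}/(Z_b^{t}{\downarrow})^{\bot}$.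
   Context: A local parametrisation of $M$ centred at $b$ is a germ of a biholomorphic map $\Phi:(\mathbb{C}^n,0)\to(M,b)$; $s=(s_1,\dots,s_n)$ denotes the coordinates on its source, $\mathbb{C}\{s\}$ the ring of convergent power series, and $\sigma=(\sigma_1,\dots,\sigma_n)$ the dual variables (similarly $t$ and $\tau$ for another parametrisation $\Psi$). Put $Z_b^{s}=\{(f\circ\Phi)_0: f\in Z\}\subset\mathbb{C}\{s\}$ (germs at $0$). For nonzero $g=\sum_\nu c_\nu s^\nu\in\mathbb{C}\{s\}$ with $k$ the smallest $|\nu|$ such that $c_\nu\neq0$, the least part is $g{\downarrow}=\sum_{|\nu|=k}c_\nu\sigma^\nu\in\mathbb{C}[\sigma]$; $0{\downarrow}=0$. Put $Z_b^{s}{\downarrow}=\mathrm{Span}_{\mathbb{C}}\{g{\downarrow}: g\in Z_b^{s}\}\subset\mathbb{C}[\sigma]$. A subspace of $\mathbb{C}[\sigma]$ is $D$-invariant if it is closed under all $\partial/\partial\sigma_i$. $M_Z^{\mathrm{inv}}$ is the set of $b\in M$ such that $Z_b^{s}{\downarrow}$ is $D$-invariant for a local parametrisation $\Phi(s)$ of $M$ centred at $b$ (this does not depend on the choice of $\Phi$). Sesquilinear form: $S:\mathbb{C}[\sigma]\times\mathbb{C}\{s\}\to\mathbb{C}$, $S\langle\sum a_\nu\sigma^\nu\,|\,\sum b_\mu s^\mu\rangle=\sum_\nu\nu!\,a_\nu\overline{b_\nu}$ (with $\nu!=\nu_1!\cdots\nu_n!$), and the same formula in the variables $\tau,t$. For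 $L\subset\mathbb{C}[\sigma]$, $L^{\bot}=\{f\in\mathbb{C}\{s\}: S\langle p\,|\,f\rangle=0\ \forall p\in L\}$. For $\Phi=\Psi\circ\Theta$ let $J_\theta=\partial(t)/\partial(s)$ be the Jacobian matrix of $\Theta$ at $s=0$, and let $\tilde{j}_\theta:\mathbb{C}[\tau]\to\mathbb{C}[\sigma]$, $p(\tau)\mapsto p(J_\theta\sigma)$ ($\sigma,\tau$ column vectors). Its adjoint ${}^s\tilde{j}_\theta:\mathbb{C}\{s\}\to\mathbb{C}\{t\}$ is the linear map determined by $S\langle\tilde{j}_\theta(p)\,|\,f\rangle=S\langle p\,|\,{}^s\tilde{j}_\theta(f)\rangle$ for all $p\in\mathbb{C}[\tau]$, $f\in\mathbb{C}\{s\}$; it is the algebra isomorphism obtained by substituting $s=J_\theta^{*}t$, where $J_\theta^{*}$ is the conjugate transpose of $J_\theta$. *)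

theory Defs
  imports
    "HOL-Library.Poly_Mapping"
    "HOL-Library.Function_Algebras"
    "HOL-Analysis.Analysis"
    "HOL-Algebra.Module"
    "HOL-Algebra.QuotRing"
begin

section \<open>Holomorphic maps and complex manifolds\<close>

text \<open>Complex differentiability at every point: the real Frechet derivative exists and is
  complex linear. Only used on open sets.\<close>

definition holo_on :: "(complex^'n \<Rightarrow> complex) \<Rightarrow> (complex^'n) set \<Rightarrow> bool" where
  "holo_on f S \<longleftrightarrow>
     (\<forall>x\<in>S. \<exists>D. (f has_derivative D) (at x) \<and> (\<forall>c v. D (c *s v) = c * D v))"

definition holo_map_on :: "(complex^'n \<Rightarrow> complex^'k) \<Rightarrow> (complex^'n) set \<Rightarrow> bool" where
  "holo_map_on F S \<longleftrightarrow> (\<forall>i. holo_on (\<lambda>x. F x $ i) S)"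

text \<open>The manifold is the whole type \<open>'m\<close> (Hausdorff and second countable by its type classes);
  a chart is a pair of its domain and its coordinate map, and the complex structure is given
  by a not necessarily maximal atlas.\<close>

type_synonym ('m, 'n) atlas = "('m set \<times> ('m \<Rightarrow> complex^'n)) set"

definition complex_atlas ::
    "('m::{t2_space, second_countable_topology}, 'n::finite) atlas \<Rightarrow> bool" where
  "complex_atlas A \<longleftrightarrow>
     (\<forall>(U, \<phi>)\<in>A. open U \<and> open (\<phi> ` U) \<and> (\<exists>g. homeomorphism U (\<phi> ` U) \<phi> g)) \<and>
     (\<Union>(U, \<phi>)\<in>A. U) = UNIV \<and>
     (\<forall>(U, \<phi>)\<in>A. \<forall>(V, \<psi>)\<in>A. holo_map_on (\<psi> \<circ> inv_into U \<phi>) (\<phi> ` (U \<inter> V)))"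

definition holo_functions :: "('m, 'n::finite) atlas \<Rightarrow> ('m \<Rightarrow> complex) set" where
  "holo_functions A = {f. \<forall>(U, \<phi>)\<in>A. holo_on (f \<circ> inv_into U \<phi>) (\<phi> ` U)}"

text \<open>The germ is represented by a total function; only its values near the origin matter.\<close>

definition local_parametrisation ::
    "('m::topological_space, 'n::finite) atlas \<Rightarrow> 'm \<Rightarrow> (complex^'n \<Rightarrow> 'm) \<Rightarrow> bool" where
  "local_parametrisation A b \<Phi> \<longleftrightarrow> \<Phi> 0 = b \<and>
     (\<exists>U V. open U \<and> 0 \<in> U \<and> open V \<and> bij_betw \<Phi> U V \<and> continuous_on U \<Phi> \<and>
        (\<forall>(W, \<phi>)\<in>A. holo_map_on (\<phi> \<circ> \<Phi>) (U \<inter> \<Phi> -` W)) \<and>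
        (\<forall>(W, \<phi>)\<in>A. holo_map_on (inv_into U \<Phi> \<circ> inv_into W \<phi>) (\<phi> ` (V \<inter> W))))"

definition biholomorphic_germ :: "(complex^'n::finite \<Rightarrow> complex^'n) \<Rightarrow> bool" where
  "biholomorphic_germ \<Theta> \<longleftrightarrow> local_parametrisation {(UNIV, id)} 0 \<Theta>"


section \<open>Algebras over the complex numbers\<close>

definition complex_field :: "complex ring" where
  "complex_field = \<lparr>carrier = UNIV, mult = (*), one = 1, zero = 0, add = (+)\<rparr>"

definition artinian_algebra :: "(complex, 'a, 'x) module_scheme \<Rightarrow> bool" where
  "artinian_algebra B \<longleftrightarrow> Module.algebra complex_field B \<and>
     (\<forall>I. (\<forall>k::nat. ideal (I k) B \<and> I (Suc k) \<subseteq> I k) \<longrightarrow> (\<exists>N. \<forall>k\<ge>N. I k = I N))"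

definition linear_iso ::
    "(complex, 'a, 'x) module_scheme \<Rightarrow> (complex, 'b, 'y) module_scheme \<Rightarrow> ('a \<Rightarrow> 'b) set" where
  "linear_iso V W = {h. bij_betw h (carrier V) (carrier W) \<and>
     (\<forall>x\<in>carrier V. \<forall>y\<in>carrier V. h (x \<oplus>\<^bsub>V\<^esub> y) = h x \<oplus>\<^bsub>W\<^esub> h y) \<and>
     (\<forall>c. \<forall>x\<in>carrier V. h (c \<odot>\<^bsub>V\<^esub> x) = c \<odot>\<^bsub>W\<^esub> h x)}"

definition algebra_iso ::
    "(complex, 'a, 'x) module_scheme \<Rightarrow> (complex, 'b, 'y) module_scheme \<Rightarrow> ('a \<Rightarrow> 'b) set" where
  "algebra_iso A B = ring_iso A B \<inter> linear_iso A B"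

text \<open>The quotient ring, with the scalar multiplication that sends \<open>I + x\<close> to \<open>I + a x\<close>.\<close>

definition quot_algebra ::
    "(complex, 'a, 'x) module_scheme \<Rightarrow> 'a set \<Rightarrow> (complex, 'a set) module" where
  "quot_algebra A I = ring.extend (A Quot I)
     (module.fields (\<lambda>a X. \<Union>x\<in>X. I +>\<^bsub>A\<^esub> (a \<odot>\<^bsub>A\<^esub> x)))"

text \<open>The vector space \<open>V\<close> with the multiplication and unit pulled back along \<open>h : V \<rightarrow> B\<close>.\<close>

definition transport_algebra ::
    "(complex, 'a) module \<Rightarrow> (complex, 'b, 'y) module_scheme \<Rightarrow> ('a \<Rightarrow> 'b) \<Rightarrow> (complex, 'a) module"
  where
  "transport_algebra V B h =
     V\<lparr>mult := \<lambda>x y. inv_into (carrier V) h (h x \<otimes>\<^bsub>B\<^esub> h y),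
       one := inv_into (carrier V) h \<one>\<^bsub>B\<^esub>\<rparr>"


section \<open>Polynomials and convergent power series\<close>

text \<open>Multi-indices are vectors of natural numbers. Polynomials are finitely supported coefficient
  functions, with the convolution product of \<^theory>\<open>HOL-Library.Poly_Mapping\<close>; power series are
  arbitrary coefficient functions.\<close>

type_synonym 'n cpoly = "(nat^'n) \<Rightarrow>\<^sub>0 complex"
type_synonym 'n cseries = "nat^'n \<Rightarrow> complex"

definition mdeg :: "nat^'n \<Rightarrow> nat" where
  "mdeg \<nu> = (\<Sum>i\<in>UNIV. \<nu> $ i)"

definition mfact :: "nat^'n \<Rightarrow> nat" where
  "mfact \<nu> = (\<Prod>i\<in>UNIV. fact (\<nu> $ i))"

definition mpow :: "complex^'n \<Rightarrow> nat^'n \<Rightarrow> complex" where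
  "mpow s \<nu> = (\<Prod>i\<in>UNIV. (s $ i) ^ (\<nu> $ i))"

definition convergent_series :: "'n::finite cseries \<Rightarrow> bool" where
  "convergent_series c \<longleftrightarrow> (\<exists>r>0. (\<lambda>\<nu>. norm (c \<nu>) * r ^ mdeg \<nu>) summable_on UNIV)"

definition conv_series :: "(complex, 'n::finite cseries) module" where
  "conv_series =
     \<lparr>carrier = {c. convergent_series c},
      mult = (\<lambda>f g \<nu>. \<Sum>(\<alpha>, \<beta>)\<in>{(\<alpha>, \<beta>). \<alpha> + \<beta> = \<nu>}. f \<alpha> * g \<beta>),
      one = (\<lambda>\<nu>. if \<nu> = 0 then 1 else 0),
      zero = (\<lambda>\<nu>. 0),
      add = (\<lambda>f g \<nu>. f \<nu> + g \<nu>),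
      smult = (\<lambda>a f \<nu>. a * f \<nu>)\<rparr>"

text \<open>Germs at the origin of holomorphic functions are identified with their power series
  expansions.\<close>

definition germ_series :: "(complex^'n \<Rightarrow> complex) \<Rightarrow> 'n::finite cseries" where
  "germ_series g = (THE c. convergent_series c \<and>
     (\<forall>\<^sub>F s in nhds 0. ((\<lambda>\<nu>. c \<nu> * mpow s \<nu>) has_sum g s) UNIV))"

definition poly_scale :: "complex \<Rightarrow> 'n::finite cpoly \<Rightarrow> 'n cpoly" where
  "poly_scale a p = Poly_Mapping.map (\<lambda>z. a * z) p"

lemma finite_mdeg: "finite {\<nu>::nat^'n::finite. mdeg \<nu> = k}"
proof (rule finite_subset)
  show "{\<nu>::nat^'n. mdeg \<nu> = k} \<subseteq> vec_lambda ` (UNIV \<rightarrow>\<^sub>E {..k})"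
  proof
    fix \<nu> :: "nat^'n" assume "\<nu> \<in> {\<nu>. mdeg \<nu> = k}"
    then have "\<nu> $ i \<le> k" for i
      unfolding mdeg_def using member_le_sum[of i UNIV "\<lambda>i. \<nu> $ i"] by auto
    then have "vec_nth \<nu> \<in> UNIV \<rightarrow>\<^sub>E {..k}" by auto
    then show "\<nu> \<in> vec_lambda ` (UNIV \<rightarrow>\<^sub>E {..k})"
      by (metis image_eqI vec_nth_inverse)
  qed
  show "finite (vec_lambda ` ((UNIV::'n set) \<rightarrow>\<^sub>E {..k}))"
    by (intro finite_imageI finite_PiE) auto
qed

definition series_ord :: "'n::finite cseries \<Rightarrow> nat" where
  "series_ord c = (LEAST k. \<exists>\<nu>. mdeg \<nu> = k \<and> c \<nu> \<noteq> 0)"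

text \<open>For \<open>c = 0\<close> the order is a junk value, but the least part is then \<open>0\<close>, as required.\<close>

lift_definition least_part :: "'n::finite cseries \<Rightarrow> 'n cpoly"
  is "\<lambda>c \<nu>. if mdeg \<nu> = series_ord c then c \<nu> else 0"
  by (rule finite_subset[OF _ finite_mdeg]) auto

lift_definition poly_deriv :: "'n::finite \<Rightarrow> 'n cpoly \<Rightarrow> 'n cpoly"
  is "\<lambda>i p \<nu>. of_nat (\<nu> $ i + 1) * p (\<nu> + axis i 1)"
proof -
  fix i :: 'n and p :: "nat^'n \<Rightarrow> complex"
  assume fin: "finite {\<nu>. p \<nu> \<noteq> 0}"
  have "finite ((\<lambda>\<nu>. \<nu> + axis i 1) -` {\<nu>. p \<nu> \<noteq> 0})"
    by (rule finite_vimageI[OF fin]) (simp add: inj_def)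
  then show "finite {\<nu>. of_nat (\<nu> $ i + 1) * p (\<nu> + axis i 1) \<noteq> 0}"
    by (rule rev_finite_subset) auto
qed

definition D_invariant :: "'n::finite cpoly set \<Rightarrow> bool" where
  "D_invariant L \<longleftrightarrow> (\<forall>i. \<forall>p\<in>L. poly_deriv i p \<in> L)"

definition sesqui :: "'n::finite cpoly \<Rightarrow> 'n cseries \<Rightarrow> complex" where
  "sesqui p f = (\<Sum>\<nu>\<in>Poly_Mapping.keys p. of_nat (mfact \<nu>) * Poly_Mapping.lookup p \<nu> * cnj (f \<nu>))"

definition perp :: "'n::finite cpoly set \<Rightarrow> 'n cseries set" where
  "perp L = {f \<in> carrier conv_series. \<forall>p\<in>L. sesqui p f = 0}"

text \<open>\<open>lin_subst J p\<close> is \<open>p(J \<sigma>)\<close>: the \<open>i\<close>-th variable is replaced by the \<open>i\<close>-th entry of the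
  column vector \<open>J \<sigma>\<close>.\<close>

definition lin_subst :: "complex^'n^'n \<Rightarrow> 'n::finite cpoly \<Rightarrow> 'n cpoly" where
  "lin_subst J p = (\<Sum>\<nu>\<in>Poly_Mapping.keys p. Poly_Mapping.single 0 (Poly_Mapping.lookup p \<nu>) *
     (\<Prod>i\<in>UNIV. (\<Sum>j\<in>UNIV. Poly_Mapping.single (axis j 1) (J $ i $ j)) ^ (\<nu> $ i)))"

definition jacobian_at_0 :: "(complex^'n \<Rightarrow> complex^'n) \<Rightarrow> complex^'n^'n" where
  "jacobian_at_0 \<Theta> = matrix (frechet_derivative \<Theta> (at 0))"

text \<open>The adjoint of \<open>lin_subst J\<close> with respect to the sesquilinear form.\<close>

definition adj_subst :: "complex^'n^'n \<Rightarrow> 'n::finite cseries \<Rightarrow> 'n cseries" where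
  "adj_subst J f =
     (THE h. h \<in> carrier conv_series \<and> (\<forall>p. sesqui (lin_subst J p) f = sesqui p h))"


section \<open>Finite-dimensional spaces of holomorphic functions and their germs\<close>

definition fun_scale :: "complex \<Rightarrow> ('m \<Rightarrow> complex) \<Rightarrow> 'm \<Rightarrow> complex" where
  "fun_scale a f = (\<lambda>x. a * f x)"

definition fin_dim_subspace :: "('m \<Rightarrow> complex) set \<Rightarrow> bool" where
  "fin_dim_subspace Z \<longleftrightarrow> Modules.module.subspace fun_scale Z \<and>
     (\<exists>B. finite B \<and> B \<subseteq> Z \<and> Modules.module.span fun_scale B = Z)"

definition germ_at :: "'m::topological_space \<Rightarrow> ('m \<Rightarrow> complex) \<Rightarrow> ('m \<Rightarrow> complex) set" where
  "germ_at b f = {g. \<forall>\<^sub>F x in nhds b. g x = f x}"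

definition germ_algebra :: "'m::topological_space \<Rightarrow> (complex, ('m \<Rightarrow> complex) set) module" where
  "germ_algebra b =
     \<lparr>carrier = range (germ_at b),
      mult = (\<lambda>G H. {k. \<exists>g\<in>G. \<exists>h\<in>H. \<forall>\<^sub>F x in nhds b. k x = g x * h x}),
      one = germ_at b (\<lambda>x. 1),
      zero = germ_at b (\<lambda>x. 0),
      add = (\<lambda>G H. {k. \<exists>g\<in>G. \<exists>h\<in>H. \<forall>\<^sub>F x in nhds b. k x = g x + h x}),
      smult = (\<lambda>a G. {k. \<exists>g\<in>G. \<forall>\<^sub>F x in nhds b. k x = a * g x})\<rparr>"

text \<open>\<open>Z\<^sub>b\<close>. The inherited multiplication is that of all germs, for which the carrier need not be
  closed: only the vector space structure of this record is meaningful.\<close>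

definition germ_space ::
    "'m::topological_space \<Rightarrow> ('m \<Rightarrow> complex) set \<Rightarrow> (complex, ('m \<Rightarrow> complex) set) module" where
  "germ_space b Z = (germ_algebra b)\<lparr>carrier := germ_at b ` Z\<rparr>"

text \<open>\<open>Z\<^sub>b\<^sup>s\<close>, for the parametrisation \<open>\<Phi>(s)\<close>.\<close>

definition series_space ::
    "(complex^'n \<Rightarrow> 'm) \<Rightarrow> ('m \<Rightarrow> complex) set \<Rightarrow> 'n::finite cseries set" where
  "series_space \<Phi> Z = {germ_series (f \<circ> \<Phi>) | f. f \<in> Z}"

definition least_space ::
    "(complex^'n \<Rightarrow> 'm) \<Rightarrow> ('m \<Rightarrow> complex) set \<Rightarrow> 'n::finite cpoly set" where
  "least_space \<Phi> Z = Modules.module.span poly_scale (least_part ` series_space \<Phi> Z)"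

definition inv_points ::
    "('m::topological_space, 'n::finite) atlas \<Rightarrow> ('m \<Rightarrow> complex) set \<Rightarrow> 'm set" where
  "inv_points A Z = {b. \<exists>\<Phi>. local_parametrisation A b \<Phi> \<and> D_invariant (least_space \<Phi> Z)}"

text \<open>The map from germs at \<open>\<Phi> 0\<close> to series induced by \<open>f \<mapsto> f \<circ> \<Phi>\<close>, computed on any
  representative of the germ.\<close>

definition pull_germ ::
    "(complex^'n \<Rightarrow> 'm) \<Rightarrow> ('m \<Rightarrow> complex) set \<Rightarrow> 'n::finite cseries" where
  "pull_germ \<Phi> G = germ_series ((SOME f. f \<in> G) \<circ> \<Phi>)"

abbreviation perp_ideal ::
    "(complex^'n \<Rightarrow> 'm) \<Rightarrow> ('m \<Rightarrow> complex) set \<Rightarrow> 'n::finite cseries set" where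
  "perp_ideal \<Phi> Z \<equiv> perp (least_space \<Phi> Z)"

abbreviation perp_quotient ::
    "(complex^'n \<Rightarrow> 'm) \<Rightarrow> ('m \<Rightarrow> complex) set \<Rightarrow> (complex, 'n::finite cseries set) module" where
  "perp_quotient \<Phi> Z \<equiv> quot_algebra conv_series (perp_ideal \<Phi> Z)"

definition germ_to_quotient ::
    "(complex^'n \<Rightarrow> 'm) \<Rightarrow> ('m \<Rightarrow> complex) set \<Rightarrow> ('m \<Rightarrow> complex) set \<Rightarrow> 'n::finite cseries set" where
  "germ_to_quotient \<Phi> Z G = perp_ideal \<Phi> Z +>\<^bsub>conv_series\<^esub> pull_germ \<Phi> G"

end

theory Submission
  imports Defs "HOL-Complex_Analysis.Cauchy_Integral_Formula"
begin

text \<open>The heart of the matter is the pairing of the space \<open>V\<close> of power series of elements of \<open>Z\<close>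
  with its space \<open>L\<close> of least parts. Since \<open>S\<langle>g\<down>|g\<rangle> > 0\<close> for \<open>g \<noteq> 0\<close>, the map
  \<open>V \<rightarrow> \<complex>{s}/L\<^sup>\<bottom>\<close> is injective; it is surjective because a residue orthogonal to \<open>L\<close> can be
  produced degree by degree, correcting the part of degree \<open>m\<close> by an element of \<open>V\<close> of order at
  least \<open>m\<close>. Multiplication by \<open>s\<^sub>i\<close> is adjoint to \<open>\<partial>/\<partial>\<sigma>\<^sub>i\<close>, so \<open>L\<^sup>\<bottom>\<close> is an ideal when \<open>L\<close> is
  \<open>D\<close>-invariant, and by the chain rule the adjoint of a linear substitution is multiplicative.
  Finally the least part of a composite \<open>g \<circ> \<Theta>\<close> is the least part of \<open>g\<close> after the linear
  substitution by the Jacobian matrix, because only leading terms survive in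
  \<open>g (\<Theta> (r v)) / r^k\<close> as \<open>r\<close> tends to \<open>0\<close>; hence \<open>L\<close> is transformed by that substitution.\<close>

section \<open>Multi-indices and power series\<close>

text \<open>Orthogonality concerns coefficient families, whereas a change of coordinates acts on
  functions. Composite series are never expanded: least parts are compared through limits along
  curves, so only the derivative of the coordinate change at 0 enters. In return, every holomorphic
  function of several variables must be shown to have a convergent expansion; this iterates Cauchy
  estimates in one variable. Taking least parts is not linear, so the least parts of a basis of
  \<open>V\<close> need not span \<open>L\<close>. The subspaces of elements of order at least m
  replace the choice of a basis, with a semidefinite Hermitian form in each degree. Convergence of
  the adjoint is a separate issue: its coefficients carry quotients \<mu>!/\<nu>! of multi-indices
  of equal degree k. These are at most n^k, which affects only the radius of convergence. Products
  with arbitrary series reduce to finitely many monomials, since a polynomial pairs with finitely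
  many degrees. Finally, membership in \<open>inv_points\<close> gives \<open>D\<close>-invariance
  for one parametrisation only and has to be carried to all others.\<close>

lemma mdeg_zero [simp]: "mdeg 0 = 0"
  and mdeg_add [simp]: "mdeg (\<mu> + \<nu>) = mdeg \<mu> + mdeg \<nu>"
  by (simp_all add: mdeg_def sum.distrib)

lemma mdeg_axis [simp]: "mdeg (axis i k) = k"
  by (simp add: mdeg_def axis_def)

lemma mdeg_eq_0_iff [simp]: "mdeg \<nu> = 0 \<longleftrightarrow> \<nu> = 0"
  by (auto simp: mdeg_def vec_eq_iff)

lemma mindex_eq_add_axis:
  fixes \<nu> :: "nat^'n::finite"
  assumes "0 < \<nu> $ i"
  shows "\<nu> = (\<nu> - axis i 1) + axis i 1"
  using assms by (auto simp: vec_eq_iff axis_def)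

text \<open>Reduces claims about monomials to multiplication by one variable at a time.\<close>

lemma mindex_induct [case_names zero add]:
  fixes \<nu> :: "nat^'n::finite"
  assumes "P 0" and step: "\<And>\<nu> i. P \<nu> \<Longrightarrow> P (\<nu> + axis i 1)"
  shows "P \<nu>"
proof (induction "mdeg \<nu>" arbitrary: \<nu>)
  case 0
  then show ?case using assms(1) by simp
next
  case (Suc k)
  then have "\<nu> \<noteq> 0" by auto
  then obtain i where "0 < \<nu> $ i" by (auto simp: vec_eq_iff)
  from mindex_eq_add_axis[OF this] have eq: "\<nu> = (\<nu> - axis i 1) + axis i 1" .
  with Suc have "k = mdeg (\<nu> - axis i 1)"
    by (metis Suc_eq_plus1 add_right_cancel mdeg_add mdeg_axis)
  from Suc.hyps(1)[OF this] step eq show ?case by metis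
qed

lemma finite_mdeg_le: "finite {\<nu>::nat^'n::finite. mdeg \<nu> \<le> k}"
proof -
  have "{\<nu>::nat^'n. mdeg \<nu> \<le> k} = (\<Union>j\<le>k. {\<nu>. mdeg \<nu> = j})" by auto
  then show ?thesis using finite_mdeg by auto
qed

lemma finite_mindex_splits: "finite {(\<alpha>, \<beta>). \<alpha> + \<beta> = (\<nu>::nat^'n::finite)}"
proof (rule finite_subset)
  show "{(\<alpha>, \<beta>). \<alpha> + \<beta> = \<nu>} \<subseteq> {\<alpha>. mdeg \<alpha> \<le> mdeg \<nu>} \<times> {\<beta>. mdeg \<beta> \<le> mdeg \<nu>}" by auto
qed (intro finite_cartesian_product finite_mdeg_le)

lemma mfact_pos [simp]: "0 < mfact \<nu>"
  by (simp add: mfact_def prod_pos)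

lemma mfact_nonzero [simp]: "mfact \<nu> \<noteq> 0"
  using mfact_pos[of \<nu>] by linarith

lemma mfact_zero [simp]: "mfact 0 = 1"
  by (simp add: mfact_def)

lemma mfact_add_axis: "mfact (\<nu> + axis i 1) = (\<nu> $ i + 1) * mfact (\<nu>::nat^'n::finite)"
proof -
  have "mfact (\<nu> + axis i 1) = fact (\<nu> $ i + 1) * (\<Prod>j\<in>UNIV - {i}. fact (\<nu> $ j))"
    unfolding mfact_def by (subst prod.remove[of _ i]) (auto simp: axis_def intro!: prod.cong)
  moreover have "mfact \<nu> = fact (\<nu> $ i) * (\<Prod>j\<in>UNIV - {i}. fact (\<nu> $ j))"
    unfolding mfact_def by (subst prod.remove[of _ i]) auto
  ultimately show ?thesis by (simp add: algebra_simps)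
qed

text \<open>Bounds the multinomial coefficient k!/\<nu>! by n^k. Lowering a largest exponent, which
  is at least the average k/n, changes this quotient by the factor k divided by that exponent, hence
  by at most n.\<close>

lemma fact_mdeg_le: "fact (mdeg \<nu>) \<le> CARD('n) ^ mdeg \<nu> * mfact (\<nu>::nat^'n::finite)"
proof (induction "mdeg \<nu>" arbitrary: \<nu>)
  case 0
  then have "\<nu> = 0" by (metis mdeg_eq_0_iff)
  then show ?case by simp
next
  case (Suc k)
  obtain i where i: "\<And>j. \<nu> $ j \<le> \<nu> $ i"
    using Max_in[of "range (\<lambda>j. \<nu> $ j)"] Max_ge[of "range (\<lambda>j. \<nu> $ j)"] by fastforce
  have le: "mdeg \<nu> \<le> CARD('n) * \<nu> $ i"
    unfolding mdeg_def using sum_bounded_above[of UNIV "\<lambda>j. \<nu> $ j" "\<nu> $ i"] i by simp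
  with Suc.hyps(2) have "0 < \<nu> $ i" by (metis Suc_neq_Zero gr0I le_zero_eq mult_is_0)
  from mindex_eq_add_axis[OF this] obtain \<mu> where eq: "\<nu> = \<mu> + axis i 1" by blast
  have k: "mdeg \<mu> = k" using Suc.hyps(2) unfolding eq by simp
  have "fact (mdeg \<nu>) = mdeg \<nu> * fact k" using Suc.hyps(2) by (metis fact_Suc of_nat_id)
  also have "\<dots> \<le> (CARD('n) * \<nu> $ i) * (CARD('n) ^ k * mfact \<mu>)"
    using le Suc.hyps(1)[of \<mu>] k by (intro mult_mono) auto
  also have "\<dots> = CARD('n) ^ mdeg \<nu> * mfact \<nu>"
    unfolding eq mfact_add_axis mdeg_add mdeg_axis using k by (simp add: algebra_simps)
  finally show ?case .
qed

lemma mpow_zero [simp]: "mpow s 0 = 1"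
  by (simp add: mpow_def)

lemma mpow_add: "mpow s (\<mu> + \<nu>) = mpow s \<mu> * mpow s \<nu>"
  by (simp add: mpow_def power_add prod.distrib)

lemma mpow_axis [simp]: "mpow s (axis i k) = (s $ i) ^ k"
proof -
  have "mpow s (axis i k) = (\<Prod>j\<in>UNIV. if j = i then (s $ i) ^ k else 1)"
    unfolding mpow_def by (rule prod.cong) (auto simp: axis_def)
  then show ?thesis by simp
qed

lemma mpow_scale: "mpow (a *s s) \<nu> = a ^ mdeg \<nu> * mpow s \<nu>"
  by (simp add: mpow_def mdeg_def power_mult_distrib prod.distrib power_sum)

lemma scaleR_eq_vector_smult: "r *\<^sub>R s = complex_of_real r *s (s::complex^'n)"
  by (simp add: vec_eq_iff scaleR_conv_of_real[symmetric])

lemma norm_mpow_le: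
  assumes "\<And>i. norm (s $ i) \<le> r"
  shows "norm (mpow s \<nu>) \<le> r ^ mdeg \<nu>"
  unfolding mpow_def mdeg_def power_sum prod_norm[symmetric] norm_power
  using assms by (intro prod_mono conjI power_mono) (auto simp: norm_power)

lemma norm_mpow_le_norm: "norm (mpow s \<nu>) \<le> norm s ^ mdeg \<nu>"
  by (rule norm_mpow_le) (rule Finite_Cartesian_Product.norm_nth_le)

lemma tendsto_mpow [tendsto_intros]:
  "(f \<longlongrightarrow> l) F \<Longrightarrow> ((\<lambda>x. mpow (f x) \<nu>) \<longlongrightarrow> mpow l \<nu>) F"
  unfolding mpow_def by (intro tendsto_intros)

text \<open>Every finite set of multi-indices lies in a box, and over a box the sum factors into n
  partial sums of the geometric series.\<close>

lemma summable_geometric_mdeg: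
  assumes "0 \<le> q" "q < (1::real)"
  shows "(\<lambda>\<nu>::nat^'n::finite. q ^ mdeg \<nu>) summable_on UNIV"
proof (rule nonneg_bdd_above_summable_on)
  show "bdd_above (sum (\<lambda>\<nu>::nat^'n. q ^ mdeg \<nu>) ` {F. F \<subseteq> UNIV \<and> finite F})"
  proof (rule bdd_aboveI2)
    fix F :: "(nat^'n) set" assume "F \<in> {F. F \<subseteq> UNIV \<and> finite F}"
    then have F: "finite F" by simp
    \<comment> \<open>The inserted 0 covers the case of empty \<open>F\<close>.\<close>
    define N where "N = Max (insert 0 (mdeg ` F))"
    have "mdeg \<nu> \<le> N" if "\<nu> \<in> F" for \<nu> unfolding N_def using that F by auto
    moreover have "\<nu> $ i \<le> mdeg \<nu>" for \<nu> :: "nat^'n" and i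
      unfolding mdeg_def using member_le_sum[of i UNIV "\<lambda>i. \<nu> $ i"] by auto
    ultimately have "\<nu> $ i \<le> N" if "\<nu> \<in> F" for \<nu> i using that order_trans by blast
    then have "F \<subseteq> vec_lambda ` (UNIV \<rightarrow>\<^sub>E {..N})"
      by (auto intro!: image_eqI[where x="vec_nth _"])
    then have "(\<Sum>\<nu>\<in>F. q ^ mdeg \<nu>) \<le> (\<Sum>\<nu>\<in>vec_lambda ` ((UNIV::'n set) \<rightarrow>\<^sub>E {..N}). q ^ mdeg \<nu>)"
      by (intro sum_mono2) (use assms in \<open>auto intro!: finite_PiE\<close>)
    also have "\<dots> = (\<Sum>f\<in>(UNIV::'n set) \<rightarrow>\<^sub>E {..N}. \<Prod>i\<in>UNIV. q ^ f i)"
      by (subst sum.reindex) (auto simp: inj_on_def vec_lambda_inject mdeg_def power_sum)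
    also have "\<dots> = (\<Prod>i\<in>(UNIV::'n set). \<Sum>j\<in>{..N}. q ^ j)"
      by (rule prod_sum_PiE[symmetric]) auto
    also have "\<dots> \<le> (\<Prod>i\<in>(UNIV::'n set). 1 / (1 - q))"
    proof (intro prod_mono conjI sum_nonneg)
      have "(\<Sum>j\<le>N. q ^ j) \<le> suminf (\<lambda>j. q ^ j)"
        using assms by (intro sum_le_suminf summable_geometric) auto
      then show "(\<Sum>j\<le>N. q ^ j) \<le> 1 / (1 - q)"
        using assms suminf_geometric[of q] by simp
    qed (use assms in auto)
    finally show "(\<Sum>\<nu>\<in>F. q ^ mdeg \<nu>) \<le> (\<Prod>i\<in>(UNIV::'n set). 1 / (1 - q))" .
  qed
qed (use assms in auto)

text \<open>A single term is bounded by the whole sum, which gives the growth rate 1/r. Conversely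
  the radius 1/(2K) leaves a geometric series of ratio 1/2. Closure properties are proved in this
  form.\<close>

lemma convergent_series_iff_bound:
  "convergent_series (c::'n::finite cseries) \<longleftrightarrow> (\<exists>C K. 0 < K \<and> (\<forall>\<nu>. norm (c \<nu>) \<le> C * K ^ mdeg \<nu>))"
proof
  assume "convergent_series c"
  then obtain r where r: "r > 0" and s: "(\<lambda>\<nu>. norm (c \<nu>) * r ^ mdeg \<nu>) summable_on UNIV"
    unfolding convergent_series_def by blast
  define C where "C = infsum (\<lambda>\<nu>. norm (c \<nu>) * r ^ mdeg \<nu>) UNIV"
  have "norm (c \<nu>) * r ^ mdeg \<nu> \<le> C" for \<nu>
    unfolding C_def using finite_sum_le_infsum[OF s, of "{\<nu>}"] r by auto
  then have "norm (c \<nu>) \<le> C * (1 / r) ^ mdeg \<nu>" for \<nu>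
    using r by (simp add: power_divide field_simps)
  with r show "\<exists>C K. 0 < K \<and> (\<forall>\<nu>. norm (c \<nu>) \<le> C * K ^ mdeg \<nu>)"
    by (metis zero_less_divide_1_iff)
next
  assume "\<exists>C K. 0 < K \<and> (\<forall>\<nu>. norm (c \<nu>) \<le> C * K ^ mdeg \<nu>)"
  then obtain C K where K: "0 < K" and b: "\<And>\<nu>. norm (c \<nu>) \<le> C * K ^ mdeg \<nu>" by blast
  have "(\<lambda>\<nu>::nat^'n. C * (1/2) ^ mdeg \<nu>) summable_on UNIV"
    by (intro summable_on_cmult_right summable_geometric_mdeg) auto
  then have "(\<lambda>\<nu>. norm (c \<nu>) * (1 / (2 * K)) ^ mdeg \<nu>) summable_on UNIV"
  proof (rule summable_on_comparison_test)
    fix \<nu>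
    have "norm (c \<nu>) * (1 / (2 * K)) ^ mdeg \<nu> \<le> (C * K ^ mdeg \<nu>) * (1 / (2 * K)) ^ mdeg \<nu>"
      by (rule mult_right_mono[OF b]) (use K in auto)
    also have "\<dots> = C * (1/2) ^ mdeg \<nu>"
      using K by (simp add: power_divide power_mult_distrib field_simps)
    finally show "norm (c \<nu>) * (1 / (2 * K)) ^ mdeg \<nu> \<le> C * (1/2) ^ mdeg \<nu>" .
  qed (use K in auto)
  then show "convergent_series c" unfolding convergent_series_def
    using K by (intro exI[of _ "1 / (2 * K)"]) auto
qed

section \<open>Homogeneous parts and their recovery from limits\<close>

definition hpart :: "'n::finite cseries \<Rightarrow> nat \<Rightarrow> complex^'n \<Rightarrow> complex" where
  "hpart c k s = (\<Sum>\<nu> | mdeg \<nu> = k. c \<nu> * mpow s \<nu>)"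

lemma hpart_scale: "hpart c k (a *s s) = a ^ k * hpart c k s"
  unfolding hpart_def sum_distrib_left by (rule sum.cong) (auto simp: mpow_scale)

lemma tendsto_hpart [tendsto_intros]:
  "(f \<longlongrightarrow> l) F \<Longrightarrow> ((\<lambda>x. hpart c k (f x)) \<longlongrightarrow> hpart c k l) F"
  unfolding hpart_def by (intro tendsto_intros)

lemma mpow_mult: "mpow (\<chi> i. s $ i * t $ i) \<nu> = mpow s \<nu> * mpow t \<nu>"
  by (simp add: mpow_def power_mult_distrib prod.distrib)

text \<open>The monomials are distinct characters of the multiplicative monoid of \<open>complex^'n\<close>.\<close>

lemma mpow_independent:
  fixes c :: "'n::finite cseries"
  assumes "finite K" "\<And>v. (\<Sum>\<nu>\<in>K. c \<nu> * mpow v \<nu>) = 0" "\<nu> \<in> K"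
  shows "c \<nu> = 0"
  using assms
proof (induction "card K" arbitrary: K c \<nu>)
  case 0
  then show ?case by simp
next
  case (Suc n)
  have rest: "c \<mu> = 0" if mu: "\<mu> \<in> K" "\<mu> \<noteq> \<nu>" for \<mu>
  proof -
    obtain i where i: "\<mu> $ i \<noteq> \<nu> $ i" using mu by (auto simp: vec_eq_iff)
    \<comment> \<open>Multiplying the argument by \<open>t\<close> scales the monomial \<kappa> by 2
      to the power \<open>\<kappa> $ i\<close>. Subtracting the multiple belonging to \<nu> removes
      \<nu> from the relation but keeps \<mu>, whose exponent at \<open>i\<close> differs.\<close>
    define t :: "complex^'n" where "t = (\<chi> j. if j = i then 2 else 1)"
    have t: "mpow t \<kappa> = 2 ^ (\<kappa> $ i)" for \<kappa>
    proof -
      have "mpow t \<kappa> = (\<Prod>j\<in>UNIV. if j = i then 2 ^ (\<kappa> $ i) else 1)"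
        unfolding mpow_def t_def by (rule prod.cong) auto
      then show ?thesis by simp
    qed
    define d where "d = (\<lambda>\<kappa>. c \<kappa> * (mpow t \<kappa> - mpow t \<nu>))"
    have "(\<Sum>\<kappa>\<in>K - {\<nu>}. d \<kappa> * mpow v \<kappa>) = 0" for v
    proof -
      have "(\<Sum>\<kappa>\<in>K - {\<nu>}. d \<kappa> * mpow v \<kappa>) = (\<Sum>\<kappa>\<in>K. d \<kappa> * mpow v \<kappa>)"
        using Suc.prems by (intro sum.mono_neutral_left) (auto simp: d_def)
      also have "\<dots> = (\<Sum>\<kappa>\<in>K. c \<kappa> * mpow (\<chi> i. t $ i * v $ i) \<kappa>) - mpow t \<nu> * (\<Sum>\<kappa>\<in>K. c \<kappa> * mpow v \<kappa>)"
        unfolding mpow_mult d_def sum_distrib_left sum_subtractf[symmetric]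
        by (rule sum.cong) (auto simp: algebra_simps)
      finally show ?thesis using Suc.prems(2) by simp
    qed
    then have "d \<mu> = 0"
      using Suc.hyps(1)[of "K - {\<nu>}" d \<mu>] Suc.hyps(2) Suc.prems mu by simp
    moreover have "(2::complex) ^ (\<mu> $ i) \<noteq> 2 ^ (\<nu> $ i)"
    proof
      assume "(2::complex) ^ (\<mu> $ i) = 2 ^ (\<nu> $ i)"
      then have "norm ((2::complex) ^ (\<mu> $ i)) = norm ((2::complex) ^ (\<nu> $ i))" by simp
      then show False using i by (simp add: norm_power)
    qed
    ultimately show ?thesis by (simp add: d_def t)
  qed
  \<comment> \<open>Only \<nu> is left, and at the vector of ones its monomial has the value
    1.\<close>
  have "(\<Sum>\<kappa>\<in>K. c \<kappa> * mpow 1 \<kappa>) = c \<nu> * mpow 1 \<nu>"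
    using Suc.prems rest by (subst sum.remove[of _ \<nu>]) auto
  moreover have "mpow 1 \<nu> = (1::complex)" by (simp add: mpow_def)
  ultimately show ?case using Suc.prems(2)[of 1] by simp
qed

lemma hpart_eq_0D: "(\<And>v. hpart c k v = 0) \<Longrightarrow> mdeg \<nu> = k \<Longrightarrow> c \<nu> = 0"
  using mpow_independent[OF finite_mdeg[of k], of c \<nu>] unfolding hpart_def by auto

text \<open>The terms below degree k vanish, so those outside degree k have degree at least k + 1.
  With q = |s|/r at most 1, each of them carries a factor q^(k+1), and the rest is dominated by the
  absolute sum at radius r.\<close>

lemma tail_bound:
  assumes c: "convergent_series c" and low: "\<And>\<nu>. mdeg \<nu> < k \<Longrightarrow> c \<nu> = 0"
    and g: "\<forall>\<^sub>F s in nhds 0. ((\<lambda>\<nu>. c \<nu> * mpow s \<nu>) has_sum g s) UNIV"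
  obtains M where "\<forall>\<^sub>F s in nhds 0. norm (g s - hpart c k s) \<le> M * norm s ^ Suc k"
proof -
  obtain r where r: "r > 0" and s: "(\<lambda>\<nu>. norm (c \<nu>) * r ^ mdeg \<nu>) summable_on UNIV"
    using c unfolding convergent_series_def by blast
  define B where "B = infsum (\<lambda>\<nu>. norm (c \<nu>) * r ^ mdeg \<nu>) UNIV"
  have "\<forall>\<^sub>F s::complex^'a in nhds 0. norm s \<le> r"
    unfolding eventually_nhds_metric using r by (intro exI[of _ r]) (auto simp: dist_norm)
  with g have "\<forall>\<^sub>F s in nhds 0. norm (g s - hpart c k s) \<le> (B / r ^ Suc k) * norm s ^ Suc k"
  proof eventually_elim
    case (elim s)
    define q where "q = norm s / r"
    have q: "0 \<le> q" "q \<le> 1" using elim r by (auto simp: q_def)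
    define A where "A = UNIV - {\<nu>::nat^'a. mdeg \<nu> = k}"
    have hs: "((\<lambda>\<nu>. c \<nu> * mpow s \<nu>) has_sum (g s - hpart c k s)) A"
      unfolding A_def hpart_def
      by (rule has_sum_Diff[OF elim(1) has_sum_finite]) (auto simp: finite_mdeg)
    have bd: "norm (c \<nu> * mpow s \<nu>) \<le> q ^ Suc k * (norm (c \<nu>) * r ^ mdeg \<nu>)" if "\<nu> \<in> A" for \<nu>
    proof (cases "mdeg \<nu> < k")
      case True
      then show ?thesis using low by simp
    next
      case False
      with that have "Suc k \<le> mdeg \<nu>" by (auto simp: A_def)
      then have "q ^ mdeg \<nu> \<le> q ^ Suc k" using q by (intro power_decreasing)
      then have "norm (c \<nu>) * (r ^ mdeg \<nu> * q ^ mdeg \<nu>) \<le> norm (c \<nu>) * (r ^ mdeg \<nu> * q ^ Suc k)"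
        using r by (intro mult_left_mono) auto
      moreover have "r ^ mdeg \<nu> * q ^ mdeg \<nu> = norm s ^ mdeg \<nu>"
        unfolding q_def power_mult_distrib[symmetric] using r by simp
      moreover have "norm (c \<nu> * mpow s \<nu>) \<le> norm (c \<nu>) * norm s ^ mdeg \<nu>"
        unfolding norm_mult by (intro mult_left_mono norm_mpow_le_norm) auto
      ultimately show ?thesis by (simp add: mult_ac)
    qed
    have sA: "(\<lambda>\<nu>. norm (c \<nu>) * r ^ mdeg \<nu>) summable_on A"
      by (rule summable_on_subset_banach[OF s]) auto
    have abs: "(\<lambda>\<nu>. norm (c \<nu> * mpow s \<nu>)) summable_on A"
      by (rule summable_on_comparison_test[OF summable_on_cmult_right[OF sA, of "q ^ Suc k"]])
        (use bd in auto)
    have "norm (g s - hpart c k s) \<le> infsum (\<lambda>\<nu>. norm (c \<nu> * mpow s \<nu>)) A"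
      using norm_infsum_bound[OF abs] infsumI[OF hs] by simp
    also have "\<dots> \<le> infsum (\<lambda>\<nu>. q ^ Suc k * (norm (c \<nu>) * r ^ mdeg \<nu>)) A"
      by (rule infsum_mono[OF abs summable_on_cmult_right[OF sA] bd])
    also have "\<dots> = q ^ Suc k * infsum (\<lambda>\<nu>. norm (c \<nu>) * r ^ mdeg \<nu>) A"
      by (rule infsum_cmult_right) (use sA in simp)
    also have "\<dots> \<le> q ^ Suc k * B"
      unfolding B_def using q r by (intro mult_left_mono infsum_mono2 sA s) auto
    finally show ?case by (simp add: q_def power_divide mult_ac)
  qed
  then show ?thesis by (rule that)
qed

text \<open>By homogeneity the leading part is unaffected by the rescaling, while the remainder is
  of order r^(k+1) and vanishes after division by r^k. The direction \<open>w\<close> may vary with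
  r, so that curves with a tangent at 0 are covered besides straight rays.\<close>

lemma tendsto_hpart_along_curve:
  assumes c: "convergent_series c" and low: "\<And>\<nu>. mdeg \<nu> < k \<Longrightarrow> c \<nu> = 0"
    and g: "\<forall>\<^sub>F s in nhds 0. ((\<lambda>\<nu>. c \<nu> * mpow s \<nu>) has_sum g s) UNIV"
    and w: "(w \<longlongrightarrow> w0) (at_right 0)"
  shows "((\<lambda>r. g (r *\<^sub>R w r) / complex_of_real r ^ k) \<longlongrightarrow> hpart c k w0) (at_right 0)"
proof -
  obtain M where M: "\<forall>\<^sub>F s in nhds 0. norm (g s - hpart c k s) \<le> M * norm s ^ Suc k"
    using tail_bound[OF c low g] .
  have lim0: "((\<lambda>r. r *\<^sub>R w r) \<longlongrightarrow> 0) (at_right 0)"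
    using tendsto_scaleR[OF _ w, of "\<lambda>r. r" 0] by (simp add: tendsto_ident_at)
  have ev: "\<forall>\<^sub>F r in at_right 0. norm (g (r *\<^sub>R w r) - hpart c k (r *\<^sub>R w r)) \<le> M * norm (r *\<^sub>R w r) ^ Suc k"
    using filterlim_iff[THEN iffD1, OF lim0] M by blast
  have "\<forall>\<^sub>F r in at_right (0::real). r > 0" by (rule eventually_at_right_less)
  with ev have "\<forall>\<^sub>F r in at_right 0. norm (g (r *\<^sub>R w r) / complex_of_real r ^ k - hpart c k (w r))
      \<le> M * (r * norm (w r) ^ Suc k)"
  proof eventually_elim
    case (elim r)
    have "g (r *\<^sub>R w r) / complex_of_real r ^ k - hpart c k (w r)
        = (g (r *\<^sub>R w r) - hpart c k (r *\<^sub>R w r)) / complex_of_real r ^ k"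
      using elim(2) by (simp add: scaleR_eq_vector_smult hpart_scale diff_divide_distrib)
    also have "norm \<dots> \<le> (M * norm (r *\<^sub>R w r) ^ Suc k) / r ^ k"
      using elim by (auto simp: norm_divide norm_power intro!: divide_right_mono)
    also have "\<dots> = M * (r * norm (w r) ^ Suc k)"
      using elim(2) by (simp add: power_mult_distrib field_simps)
    finally show ?case .
  qed
  moreover have "((\<lambda>r. M * (r * norm (w r) ^ Suc k)) \<longlongrightarrow> 0) (at_right 0)"
    by (rule tendsto_eq_intros w refl | simp)+
  ultimately have "((\<lambda>r. g (r *\<^sub>R w r) / complex_of_real r ^ k - hpart c k (w r)) \<longlongrightarrow> 0) (at_right 0)"
    by (rule Lim_null_comparison)
  from tendsto_add[OF this tendsto_hpart[OF w, of c k]] show ?thesis by simp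
qed

section \<open>Uniqueness of the expansion\<close>

lemma convergent_lincomb:
  assumes "convergent_series (c::'n::finite cseries)" "convergent_series d"
  shows "convergent_series (\<lambda>\<nu>. a * c \<nu> + b * d \<nu>)"
proof -
  obtain C K D L where K: "0 < K" "0 < L" and b: "\<And>\<nu>. norm (c \<nu>) \<le> C * K ^ mdeg \<nu>" "\<And>\<nu>. norm (d \<nu>) \<le> D * L ^ mdeg \<nu>"
    using assms unfolding convergent_series_iff_bound by blast
  have "0 \<le> C" "0 \<le> D"
    using order_trans[OF norm_ge_zero b(1)[of 0]] order_trans[OF norm_ge_zero b(2)[of 0]] by simp_all
  then have "norm (a * c \<nu> + b * d \<nu>) \<le> (norm a * C + norm b * D) * (max K L) ^ mdeg \<nu>" for \<nu>
  proof -
    have "norm (a * c \<nu> + b * d \<nu>) \<le> norm a * norm (c \<nu>) + norm b * norm (d \<nu>)"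
      by (metis norm_mult norm_triangle_ineq)
    also have "\<dots> \<le> norm a * (C * (max K L) ^ mdeg \<nu>) + norm b * (D * (max K L) ^ mdeg \<nu>)"
      using K \<open>0 \<le> C\<close> \<open>0 \<le> D\<close>
      by (intro add_mono mult_left_mono order_trans[OF b(1)] order_trans[OF b(2)] power_mono) auto
    finally show ?thesis by (simp add: algebra_simps)
  qed
  with K show ?thesis unfolding convergent_series_iff_bound
    by (intro exI[of _ "norm a * C + norm b * D"] exI[of _ "max K L"]) (simp add: less_max_iff_disj)
qed

text \<open>Once the lower degrees are known to vanish, the limit along the ray through
  \<open>v\<close> identifies the next homogeneous part, which must then be the zero
  function.\<close>

lemma series_eq_0I:
  assumes c: "convergent_series (c::'n::finite cseries)"
    and g: "\<forall>\<^sub>F s in nhds 0. ((\<lambda>\<nu>. c \<nu> * mpow s \<nu>) has_sum 0) UNIV"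
  shows "c \<nu> = 0"
proof (induction "mdeg \<nu>" arbitrary: \<nu> rule: less_induct)
  case less
  have "hpart c (mdeg \<nu>) v = 0" for v
  proof (rule tendsto_unique)
    show "((\<lambda>r. 0 / complex_of_real r ^ mdeg \<nu>) \<longlongrightarrow> hpart c (mdeg \<nu>) v) (at_right 0)"
      using tendsto_hpart_along_curve[OF c less g tendsto_const, of "mdeg \<nu>" v] by simp
  qed auto
  then show ?case by (rule hpart_eq_0D) simp
qed

lemma series_unique:
  assumes c: "convergent_series (c::'n::finite cseries)" and d: "convergent_series d"
    and gc: "\<forall>\<^sub>F s in nhds 0. ((\<lambda>\<nu>. c \<nu> * mpow s \<nu>) has_sum g s) UNIV"
    and gd: "\<forall>\<^sub>F s in nhds 0. ((\<lambda>\<nu>. d \<nu> * mpow s \<nu>) has_sum g s) UNIV"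
  shows "c = d"
proof
  fix \<nu>
  have "convergent_series (\<lambda>\<nu>. 1 * c \<nu> + (-1) * d \<nu>)" by (rule convergent_lincomb[OF c d])
  moreover from gc gd have "\<forall>\<^sub>F s in nhds 0. ((\<lambda>\<nu>. (1 * c \<nu> + (-1) * d \<nu>) * mpow s \<nu>) has_sum 0) UNIV"
  proof eventually_elim
    case (elim s)
    from has_sum_add[OF elim(1) has_sum_cmult_right[OF elim(2), of "-1"]]
    show ?case by (simp add: left_diff_distrib)
  qed
  ultimately have "1 * c \<nu> + (-1) * d \<nu> = 0" by (rule series_eq_0I)
  then show "c \<nu> = d \<nu>" by simp
qed

lemma germ_series_eqI:
  assumes "convergent_series c" "\<forall>\<^sub>F s in nhds 0. ((\<lambda>\<nu>. c \<nu> * mpow s \<nu>) has_sum g s) UNIV"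
  shows "germ_series g = c"
  unfolding germ_series_def
proof (rule the_equality)
  show "d = c" if "convergent_series d \<and> (\<forall>\<^sub>F s in nhds 0. ((\<lambda>\<nu>. d \<nu> * mpow s \<nu>) has_sum g s) UNIV)" for d
    using that assms series_unique by blast
qed (use assms in simp)

section \<open>Power series of holomorphic functions of several variables\<close>

definition upd :: "'a^'n \<Rightarrow> 'n \<Rightarrow> 'a \<Rightarrow> 'a^'n" where
  "upd s i w = (\<chi> j. if j = i then w else s $ j)"

definition polydisc :: "real \<Rightarrow> (complex^'n) set" where
  "polydisc R = {s. \<forall>i. norm (s $ i) < R}"

text \<open>This property, together with a bound on the polydisc, is what survives passing to a
  Taylor coefficient in one variable; it therefore serves as the induction invariant.\<close>

definition sep_holo :: "real \<Rightarrow> (complex^'n \<Rightarrow> complex) \<Rightarrow> bool" where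
  "sep_holo R g \<longleftrightarrow> (\<forall>s\<in>polydisc R. \<forall>i. (\<lambda>w. g (upd s i w)) holomorphic_on ball 0 R)"

text \<open>Kept as a function on the full space, although its value does not depend on
  \<open>s $ i\<close>; the dimension then stays fixed while variables are eliminated.\<close>

definition taylor_coeff :: "'n \<Rightarrow> nat \<Rightarrow> (complex^'n \<Rightarrow> complex) \<Rightarrow> complex^'n \<Rightarrow> complex" where
  "taylor_coeff i k g s = (deriv ^^ k) (\<lambda>w. g (upd s i w)) 0 / fact k"

lemma upd_nth [simp]: "upd s i w $ j = (if j = i then w else s $ j)"
  by (simp add: upd_def)

lemma upd_upd [simp]: "upd (upd s i v) i w = upd s i w"
  by (simp add: vec_eq_iff)

lemma upd_commute: "i \<noteq> j \<Longrightarrow> upd (upd s i v) j w = upd (upd s j w) i v"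
  by (simp add: vec_eq_iff)

lemma upd_same [simp]: "upd s i (s $ i) = s"
  by (simp add: vec_eq_iff)

lemma upd_polydisc: "s \<in> polydisc R \<Longrightarrow> norm w < R \<Longrightarrow> upd s i w \<in> polydisc R"
  by (simp add: polydisc_def)

text \<open>The Cauchy inequality needs a closed disc, so it is applied for r < R and r is then sent
  to R. Neither the radius nor the bound deteriorates, which allows one use per variable.\<close>

lemma taylor_coeff_bound:
  assumes hol: "f holomorphic_on ball 0 R" and B: "\<And>w. w \<in> ball 0 R \<Longrightarrow> norm (f w) \<le> B" and "0 < R"
  shows "norm ((deriv ^^ k) f 0 / fact k) * R ^ k \<le> B"
proof -
  have "norm ((deriv ^^ k) f 0 / fact k) * r ^ k \<le> B" if r: "0 < r" "r < R" for r
  proof -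
    have "norm ((deriv ^^ k) f 0) \<le> fact k * B / r ^ k"
    proof (rule Cauchy_inequality)
      show "f holomorphic_on ball 0 r" using hol by (rule holomorphic_on_subset) (use r in auto)
      show "continuous_on (cball 0 r) f"
        using holomorphic_on_imp_continuous_on[OF hol] by (rule continuous_on_subset) (use r in auto)
    qed (use r B in auto)
    then show ?thesis using r by (simp add: norm_divide field_simps)
  qed
  then have "\<forall>\<^sub>F r in at_left R. norm ((deriv ^^ k) f 0 / fact k) * r ^ k \<le> B"
    using eventually_at_left_field[of _ R] \<open>0 < R\<close> by blast
  moreover have "((\<lambda>r. norm ((deriv ^^ k) f 0 / fact k) * r ^ k) \<longlongrightarrow> norm ((deriv ^^ k) f 0 / fact k) * R ^ k) (at_left R)"
    by (intro tendsto_intros)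
  ultimately show ?thesis by (intro tendsto_upperbound) auto
qed

text \<open>The divided remainder is a_k plus a tail dominated by a geometric series; |w| at most
  R/2 gives the ratio 1/2 and hence the factor 2. The error depends on \<open>f\<close> only through
  \<open>B\<close>, so the estimate is uniform over families with a common bound.\<close>

lemma taylor_remainder_bound:
  assumes hol: "f holomorphic_on ball 0 R" and B: "\<And>w. w \<in> ball 0 R \<Longrightarrow> norm (f w) \<le> B"
    and w: "w \<noteq> 0" "norm w \<le> R / 2"
  defines "a \<equiv> \<lambda>k. (deriv ^^ k) f 0 / fact k"
  shows "norm ((f w - (\<Sum>j<k. a j * w ^ j)) / w ^ k - a k) \<le> 2 * B / R ^ Suc k * norm w"
proof -
  have "0 < norm w" using w by simp
  with w have R: "0 < R" by linarith
  have B0: "0 \<le> B" using B[of 0] R norm_ge_zero order_trans by (metis centre_in_ball)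
  define x where "x = norm w / R"
  have x: "0 \<le> x" "x \<le> 1/2" using w R by (auto simp: x_def field_simps)
  have "(\<lambda>n. a n * (w - 0) ^ n) sums f w"
    unfolding a_def by (rule holomorphic_power_series[OF hol]) (use w R in auto)
  from sums_split_initial_segment[OF this, of "Suc k"]
  have "(\<lambda>n. a (n + Suc k) * w ^ (n + Suc k)) sums (f w - (\<Sum>j<Suc k. a j * w ^ j))" by simp
  from sums_divide[OF this, of "w ^ k"]
  have "(\<lambda>n. a (n + Suc k) * w ^ Suc n) sums ((f w - (\<Sum>j<Suc k. a j * w ^ j)) / w ^ k)"
    using w by (simp add: power_add mult_ac)
  moreover have "(f w - (\<Sum>j<Suc k. a j * w ^ j)) / w ^ k = (f w - (\<Sum>j<k. a j * w ^ j)) / w ^ k - a k"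
    using w by (simp add: field_simps)
  ultimately have s: "(\<lambda>n. a (n + Suc k) * w ^ Suc n) sums ((f w - (\<Sum>j<k. a j * w ^ j)) / w ^ k - a k)"
    by simp
  have g: "(\<lambda>n. B / R ^ k * (x * (1/2) ^ n)) sums (B / R ^ k * (x * (1 / (1 - 1/2))))"
    by (intro sums_mult geometric_sums) auto
  have bd: "norm (a (n + Suc k) * w ^ Suc n) \<le> B / R ^ k * (x * (1/2) ^ n)" for n
  proof -
    have "norm (a (n + Suc k)) \<le> B / R ^ (n + Suc k)"
      using taylor_coeff_bound[OF hol B R, of "n + Suc k"] R unfolding a_def
      by (simp add: pos_le_divide_eq)
    then have "norm (a (n + Suc k) * w ^ Suc n) \<le> B / R ^ (n + Suc k) * norm w ^ Suc n"
      unfolding norm_mult norm_power by (intro mult_right_mono) auto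
    also have "\<dots> = B / R ^ k * x ^ Suc n"
      using R by (simp add: x_def power_divide power_add field_simps)
    also have "\<dots> \<le> B / R ^ k * (x * (1/2) ^ n)"
      unfolding power_Suc using x B0 R by (intro mult_left_mono power_mono) auto
    finally show ?thesis .
  qed
  have "norm ((f w - (\<Sum>j<k. a j * w ^ j)) / w ^ k - a k) \<le> B / R ^ k * (x * (1 / (1 - 1/2)))"
    using sums_unique[OF s] sums_unique[OF g] norm_suminf_le[OF bd sums_summable[OF g]]
    by simp
  also have "\<dots> = 2 * B / R ^ Suc k * norm w" by (simp add: x_def mult_ac)
  finally show ?thesis .
qed

text \<open>The issue is holomorphy in a variable \<open>l\<close> other than \<open>i\<close>. The
  coefficient is a uniform limit of divided remainders taken at small values of variable
  \<open>i\<close>; these are holomorphic in variable \<open>l\<close> because the lower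
  coefficients they contain are, by induction on \<open>k\<close>.\<close>

lemma sep_holo_taylor_coeff:
  fixes g :: "complex^'n \<Rightarrow> complex"
  assumes g: "sep_holo R g" and B: "\<And>s. s \<in> polydisc R \<Longrightarrow> norm (g s) \<le> B" and R: "0 < R"
  shows "sep_holo R (taylor_coeff i k g)"
proof (induction k rule: less_induct)
  case (less k)
  show ?case unfolding sep_holo_def
  proof (intro ballI allI)
    fix s :: "complex^'n" and l assume s: "s \<in> polydisc R"
    show "(\<lambda>z. taylor_coeff i k g (upd s l z)) holomorphic_on ball 0 R"
    proof (cases "l = i")
      case True
      then show ?thesis by (simp add: taylor_coeff_def)
    next
      case False
      \<comment> \<open>A null sequence of nonzero points; the shift by 2 keeps it within R/2, where
        the remainder estimate applies.\<close>
      define v where "v = (\<lambda>m. complex_of_real (R / real (m + 2)))"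
      have v: "v m \<noteq> 0" "norm (v m) = R / real (m + 2)" "norm (v m) \<le> R / 2" "norm (v m) < R" for m
      proof -
        have pos: "0 < R / real (m + 2)" using R by simp
        then show "v m \<noteq> 0" unfolding v_def of_real_eq_0_iff by linarith
        show eq: "norm (v m) = R / real (m + 2)" unfolding v_def norm_of_real using pos by linarith
        show "norm (v m) \<le> R / 2" unfolding eq using R by (intro divide_left_mono) auto
        with R show "norm (v m) < R" by linarith
      qed
      define f where "f = (\<lambda>m z. (g (upd (upd s l z) i (v m)) -
        (\<Sum>j<k. taylor_coeff i j g (upd s l z) * v m ^ j)) / v m ^ k)"
      have bound: "norm (f m z - taylor_coeff i k g (upd s l z)) \<le> 2 * B / R ^ Suc k * (R / real (m + 2))"
        if z: "z \<in> ball 0 R" for m z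
      proof -
        let ?h = "\<lambda>w. g (upd (upd s l z) i w)"
        have u: "upd s l z \<in> polydisc R" using s z by (auto intro: upd_polydisc)
        then have "?h holomorphic_on ball 0 R" using g unfolding sep_holo_def by blast
        moreover have "norm (?h w) \<le> B" if "w \<in> ball 0 R" for w
          using that by (intro B upd_polydisc[OF u]) auto
        ultimately show ?thesis
          using taylor_remainder_bound[of ?h R B "v m" k] v unfolding f_def taylor_coeff_def by simp
      qed
      show ?thesis
      proof (rule holomorphic_uniform_sequence)
        show "f m holomorphic_on ball 0 R" for m
        proof -
          have "(\<lambda>z. g (upd (upd s i (v m)) l z)) holomorphic_on ball 0 R"
            using g upd_polydisc[OF s v(4)] unfolding sep_holo_def by blast
          moreover have "(\<lambda>z. taylor_coeff i j g (upd s l z)) holomorphic_on ball 0 R" if "j < k" for j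
            using less[OF that] s unfolding sep_holo_def by blast
          ultimately show ?thesis
            unfolding f_def upd_commute[OF False] using v by (intro holomorphic_intros) auto
        qed
        fix x assume x: "x \<in> ball (0::complex) R"
        then obtain d where d: "0 < d" "cball x d \<subseteq> ball 0 R"
          using open_contains_cball open_ball by blast
        have "uniform_limit (cball x d) f (\<lambda>z. taylor_coeff i k g (upd s l z)) sequentially"
        proof (rule uniform_limitI)
          fix e :: real assume "0 < e"
          have "(\<lambda>m. 2 * B / R ^ Suc k * (R / real (m + 2))) \<longlonglongrightarrow> 0"
            by (rule tendsto_mult_right_zero[OF LIMSEQ_ignore_initial_segment[OF lim_const_over_n]])
          from order_tendstoD(2)[OF this \<open>0 < e\<close>]
          show "\<forall>\<^sub>F m in sequentially. \<forall>z\<in>cball x d. dist (f m z) (taylor_coeff i k g (upd s l z)) < e"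
          proof eventually_elim
            case (elim m)
            show ?case
            proof
              fix z assume "z \<in> cball x d"
              with d have "z \<in> ball 0 R" by blast
              from bound[OF this, of m] elim
              show "dist (f m z) (taylor_coeff i k g (upd s l z)) < e"
                unfolding dist_norm by linarith
            qed
          qed
        qed
        with d show "\<exists>d. 0 < d \<and> cball x d \<subseteq> ball 0 R \<and>
            uniform_limit (cball x d) f (\<lambda>z. taylor_coeff i k g (upd s l z)) sequentially" by blast
      qed auto
    qed
  qed
qed

lemma mdeg_upd: "mdeg \<mu> = mdeg (upd \<mu> i 0) + \<mu> $ (i::'n::finite)"
  unfolding mdeg_def by (subst (1 2) sum.remove[of _ i]) (auto intro!: sum.cong)

lemma mpow_upd: "mpow s (\<mu>::nat^'n::finite) = mpow s (upd \<mu> i 0) * (s $ i) ^ (\<mu> $ i)"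
  unfolding mpow_def by (subst (1 2) prod.remove[of _ i]) (auto intro!: prod.cong)

text \<open>Induction on the set of variables on which \<open>g\<close> depends. The Taylor
  coefficients in a new variable \<open>i\<close> depend on the old ones only and are bounded by
  B/R^k, so their expansions combine into one with the same \<open>B\<close> and
  \<open>R\<close>.\<close>

lemma power_series_aux:
  fixes I :: "'n::finite set"
  assumes R: "0 < R" and "finite I" and "sep_holo R g" and "\<And>s. s \<in> polydisc R \<Longrightarrow> norm (g s) \<le> B"
    and "\<And>s t. (\<And>j. j \<in> I \<Longrightarrow> s $ j = t $ j) \<Longrightarrow> g s = g t"
  shows "\<exists>c. (\<forall>\<nu>. norm (c \<nu>) * R ^ mdeg \<nu> \<le> B) \<and>
    (\<forall>s\<in>polydisc R. ((\<lambda>\<nu>. c \<nu> * mpow s \<nu>) has_sum g s) {\<nu>. \<forall>j. j \<notin> I \<longrightarrow> \<nu> $ j = 0})"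
  using assms(2-)
proof (induction I arbitrary: g B)
  case empty
  have 0: "(0::complex^'n) \<in> polydisc R" using R by (simp add: polydisc_def)
  have B0: "0 \<le> B" using empty(2)[OF 0] norm_ge_zero order_trans by blast
  have T: "{\<nu>::nat^'n. \<forall>j. \<nu> $ j = 0} = {0}" by (auto simp: vec_eq_iff)
  have "((\<lambda>\<nu>. (if \<nu> = 0 then g 0 else 0) * mpow s \<nu>) has_sum g s) {0}" for s
    using has_sum_finite[of "{0}" "\<lambda>\<nu>. (if \<nu> = 0 then g 0 else 0) * mpow s \<nu>"] empty(3)[of s 0] by simp
  then show ?case using empty(2)[OF 0] B0
    by (intro exI[of _ "\<lambda>\<nu>. if \<nu> = 0 then g 0 else 0"]) (auto simp: T)
next
  case (insert i I)
  define T where "T = (\<lambda>I. {\<nu>::nat^'n. \<forall>j. j \<notin> I \<longrightarrow> \<nu> $ j = 0})"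
  have hol: "(\<lambda>w. g (upd s i w)) holomorphic_on ball 0 R" if "s \<in> polydisc R" for s
    using insert(4) that unfolding sep_holo_def by blast
  have bd: "norm (taylor_coeff i k g s) \<le> B / R ^ k" if "s \<in> polydisc R" for s k
    using taylor_coeff_bound[OF hol[OF that] _ R, of B k] upd_polydisc[OF that] insert(5) R
    by (simp add: taylor_coeff_def field_simps)
  have dep: "taylor_coeff i k g s = taylor_coeff i k g t" if "\<And>j. j \<in> I \<Longrightarrow> s $ j = t $ j" for s t k
  proof -
    have "(\<lambda>w. g (upd s i w)) = (\<lambda>w. g (upd t i w))"
      by (rule ext, rule insert(6)) (use that in auto)
    then show ?thesis by (simp add: taylor_coeff_def)
  qed
  have "\<exists>c. (\<forall>\<nu>. norm (c \<nu>) * R ^ mdeg \<nu> \<le> B / R ^ k) \<and>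
      (\<forall>s\<in>polydisc R. ((\<lambda>\<nu>. c \<nu> * mpow s \<nu>) has_sum taylor_coeff i k g s) (T I))" for k
    unfolding T_def
    by (rule insert(3)[OF sep_holo_taylor_coeff[OF insert(4,5) R] bd dep]) auto
  then obtain C where C: "\<And>k \<nu>. norm (C k \<nu>) * R ^ mdeg \<nu> \<le> B / R ^ k"
      "\<And>k s. s \<in> polydisc R \<Longrightarrow> ((\<lambda>\<nu>. C k \<nu> * mpow s \<nu>) has_sum taylor_coeff i k g s) (T I)"
    by metis
  \<comment> \<open>The exponent of variable \<open>i\<close> selects the Taylor coefficient, the
    remaining exponents a coefficient of its expansion.\<close>
  define c where "c = (\<lambda>\<nu>. C (\<nu> $ i) (upd \<nu> i 0))"
  have c: "norm (c \<nu>) * R ^ mdeg \<nu> \<le> B" for \<nu>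
    using C(1)[of "\<nu> $ i" "upd \<nu> i 0"] R unfolding c_def mdeg_upd[of \<nu> i] power_add
    by (simp add: field_simps)
  have "((\<lambda>\<nu>. c \<nu> * mpow s \<nu>) has_sum g s) (T (insert i I))" if s: "s \<in> polydisc R" for s
  proof -
    \<comment> \<open>A single radius below \<open>R\<close> bounding all entries of
      \<open>s\<close>; absolute convergence then follows from the geometric series in q/R.\<close>
    define q where "q = Max (range (\<lambda>j. norm (s $ j)))"
    have q: "norm (s $ j) \<le> q" for j unfolding q_def by (intro Max_ge) auto
    have "q < R" unfolding q_def using s by (subst Max_less_iff) (auto simp: polydisc_def)
    have "0 \<le> q" using q order_trans norm_ge_zero by blast
    have "(\<lambda>\<nu>. norm (c \<nu> * mpow s \<nu>)) summable_on T (insert i I)"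
    proof (rule summable_on_comparison_test)
      show "(\<lambda>\<nu>. B * (q / R) ^ mdeg \<nu>) summable_on T (insert i I)"
        by (intro summable_on_cmult_right summable_on_subset_banach[OF summable_geometric_mdeg])
          (use \<open>q < R\<close> \<open>0 \<le> q\<close> R in auto)
      show "norm (c \<nu> * mpow s \<nu>) \<le> B * (q / R) ^ mdeg \<nu>" for \<nu>
      proof -
        have "norm (c \<nu> * mpow s \<nu>) \<le> (B / R ^ mdeg \<nu>) * q ^ mdeg \<nu>"
          unfolding norm_mult using c[of \<nu>] norm_mpow_le[of s q \<nu>] q R \<open>0 \<le> q\<close>
          by (intro mult_mono) (auto simp: pos_le_divide_eq intro: order_trans[OF _ c[of \<nu>]])
        then show ?thesis by (simp add: power_divide)
      qed
    qed auto
    then have "(\<lambda>\<nu>. c \<nu> * mpow s \<nu>) summable_on T (insert i I)" by (rule abs_summable_summable)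
    then obtain x where x: "((\<lambda>\<nu>. c \<nu> * mpow s \<nu>) has_sum x) (T (insert i I))"
      unfolding summable_on_def by blast
    define \<phi> where "\<phi> = (\<lambda>(k, \<mu>::nat^'n). upd \<mu> i k)"
    have inj: "inj_on \<phi> (UNIV \<times> T I)"
    proof (rule inj_onI, clarify)
      fix k \<mu> k' \<mu>' assume *: "\<mu> \<in> T I" "\<mu>' \<in> T I" "\<phi> (k, \<mu>) = \<phi> (k', \<mu>')"
      then have "\<mu> $ i = 0" "\<mu>' $ i = 0" using insert(2) by (auto simp: T_def)
      moreover have "k = k'" using arg_cong[OF *(3), of "\<lambda>\<nu>. \<nu> $ i"] by (simp add: \<phi>_def)
      moreover have "upd \<mu> i 0 = upd \<mu>' i 0"
        using arg_cong[OF *(3), of "\<lambda>\<nu>. upd \<nu> i 0"] by (simp add: \<phi>_def)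
      ultimately show "k = k' \<and> \<mu> = \<mu>'" by (metis upd_same)
    qed
    have im: "\<phi> ` (UNIV \<times> T I) = T (insert i I)"
    proof (intro equalityI subsetI)
      fix \<nu> assume "\<nu> \<in> T (insert i I)"
      then have "upd \<nu> i 0 \<in> T I" "\<nu> = \<phi> (\<nu> $ i, upd \<nu> i 0)"
        by (auto simp: T_def \<phi>_def)
      then show "\<nu> \<in> \<phi> ` (UNIV \<times> T I)" by blast
    qed (auto simp: T_def \<phi>_def)
    have "(((\<lambda>\<nu>. c \<nu> * mpow s \<nu>) \<circ> \<phi>) has_sum x) (UNIV \<times> T I)"
      using x unfolding im[symmetric] has_sum_reindex[OF inj] .
    \<comment> \<open>The sum x of the unordered series is evaluated by summing over the old
      variables within each power of \<open>s $ i\<close>; the outcome is the one-variable Taylor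
      series of \<open>g\<close>, which forces x = g s.\<close>
    then have "((\<lambda>k. taylor_coeff i k g s * (s $ i) ^ k) has_sum x) UNIV"
    proof (rule has_sum_SigmaD)
      fix k
      have "((\<lambda>\<mu>. C k \<mu> * mpow s \<mu> * (s $ i) ^ k) has_sum taylor_coeff i k g s * (s $ i) ^ k) (T I)"
        by (intro has_sum_cmult_left C(2) s)
      also have "?this \<longleftrightarrow> ((\<lambda>\<mu>. ((\<lambda>\<nu>. c \<nu> * mpow s \<nu>) \<circ> \<phi>) (k, \<mu>)) has_sum taylor_coeff i k g s * (s $ i) ^ k) (T I)"
      proof (rule has_sum_cong)
        fix \<mu> assume "\<mu> \<in> T I"
        then have "\<mu> $ i = 0" using insert(2) by (auto simp: T_def)
        then have "upd (upd \<mu> i k) i 0 = \<mu>" by (metis upd_upd upd_same)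
        then show "C k \<mu> * mpow s \<mu> * (s $ i) ^ k = ((\<lambda>\<nu>. c \<nu> * mpow s \<nu>) \<circ> \<phi>) (k, \<mu>)"
          using mpow_upd[of s "upd \<mu> i k" i] by (simp add: \<phi>_def c_def)
      qed
      finally show "((\<lambda>\<mu>. ((\<lambda>\<nu>. c \<nu> * mpow s \<nu>) \<circ> \<phi>) (k, \<mu>)) has_sum taylor_coeff i k g s * (s $ i) ^ k) (T I)" .
    qed
    then have "(\<lambda>k. taylor_coeff i k g s * (s $ i) ^ k) sums x" by (rule has_sum_imp_sums)
    moreover have "(\<lambda>k. taylor_coeff i k g s * (s $ i) ^ k) sums g s"
      using holomorphic_power_series[OF hol[OF s], of "s $ i"] s
      unfolding taylor_coeff_def by (simp add: polydisc_def)
    ultimately have "x = g s" by (rule sums_unique2)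
    with x show ?thesis by simp
  qed
  with c show ?case unfolding T_def by blast
qed

lemma norm_le_sum_components: "norm (s::complex^'n) \<le> (\<Sum>i\<in>UNIV. norm (s $ i))"
  unfolding norm_vec_def by (rule L2_set_le_sum) simp

text \<open>Differentiability gives continuity at 0, hence a bound on a small polydisc, and complex
  linearity of the derivative along each axis gives holomorphy in each variable.\<close>

theorem holo_on_has_series:
  fixes g :: "complex^'n::finite \<Rightarrow> complex"
  assumes hol: "holo_on g S" and S: "open S" "0 \<in> S"
  obtains c where "convergent_series c" "\<forall>\<^sub>F s in nhds 0. ((\<lambda>\<nu>. c \<nu> * mpow s \<nu>) has_sum g s) UNIV"
proof -
  obtain D0 where "(g has_derivative D0) (at 0)" using hol S unfolding holo_on_def by blast
  then have "isCont g 0" by (rule has_derivative_continuous)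
  then have "(g \<longlongrightarrow> g 0) (nhds 0)" by (simp add: continuous_at tendsto_at_iff_tendsto_nhds)
  from tendstoD[OF this, of 1] have "\<forall>\<^sub>F s in nhds 0. dist (g s) (g 0) < 1" by simp
  moreover have "\<forall>\<^sub>F s in nhds 0. s \<in> S" using S by (rule eventually_nhds_in_open)
  ultimately have "\<forall>\<^sub>F s in nhds 0. dist (g s) (g 0) < 1 \<and> s \<in> S" by (rule eventually_conj)
  then obtain e where e: "0 < e" and ball: "\<And>s. dist s 0 < e \<Longrightarrow> dist (g s) (g 0) < 1 \<and> s \<in> S"
    unfolding eventually_nhds_metric by blast
  \<comment> \<open>The norm is at most the sum of n moduli, so this polydisc fits into the ball of
    radius \<open>e\<close>.\<close>
  define R where "R = e / CARD('n)"
  have R: "0 < R" using e by (simp add: R_def)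
  have poly: "dist s 0 < e" if "s \<in> polydisc R" for s :: "complex^'n"
  proof -
    have "norm s \<le> (\<Sum>i\<in>UNIV. norm (s $ i))" by (rule norm_le_sum_components)
    also have "\<dots> < (\<Sum>i\<in>(UNIV::'n set). R)"
      using that by (intro sum_strict_mono) (auto simp: polydisc_def)
    finally show ?thesis by (simp add: R_def)
  qed
  define B where "B = norm (g 0) + 1"
  have B: "norm (g s) \<le> B" if "s \<in> polydisc R" for s
    using ball[OF poly[OF that]] norm_triangle_sub[of "g s" "g 0"] unfolding B_def dist_norm by linarith
  have "sep_holo R g" unfolding sep_holo_def
  proof (intro ballI allI)
    fix s :: "complex^'n" and i assume s: "s \<in> polydisc R"
    have "(\<lambda>w. g (upd s i w)) field_differentiable (at w)" if "w \<in> ball 0 R" for w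
    proof -
      have "upd s i w \<in> S" using ball poly upd_polydisc[OF s] that by auto
      then obtain D where D: "(g has_derivative D) (at (upd s i w))" and lin: "\<And>c v. D (c *s v) = c * D v"
        using hol unfolding holo_on_def by blast
      have "(upd s i has_derivative axis i) (at w)"
      proof -
        have "linear (axis i :: complex \<Rightarrow> complex^'n)"
          by (rule linearI) (auto simp: vec_eq_iff axis_def)
        then have "bounded_linear (axis i :: complex \<Rightarrow> complex^'n)"
          by (simp add: linear_conv_bounded_linear)
        then have "((\<lambda>w. upd s i 0 + axis i w) has_derivative (\<lambda>h. 0 + axis i h)) (at w)"
          by (intro has_derivative_add has_derivative_const bounded_linear_imp_has_derivative)
        moreover have "(\<lambda>w. upd s i 0 + axis i w) = upd s i"
          by (auto simp: fun_eq_iff vec_eq_iff axis_def)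
        ultimately show ?thesis by simp
      qed
      from has_derivative_compose[OF this D]
      have "((\<lambda>w. g (upd s i w)) has_derivative (\<lambda>h. D (axis i h))) (at w)" .
      moreover have "D (axis i h) = D (axis i 1) * h" for h
      proof -
        have "axis i h = h *s (axis i 1 :: complex^'n)" by (simp add: vec_eq_iff axis_def)
        then show ?thesis by (simp add: lin mult.commute)
      qed
      then have "(\<lambda>h. D (axis i h)) = (*) (D (axis i 1))" by (rule ext)
      ultimately have "((\<lambda>w. g (upd s i w)) has_field_derivative D (axis i 1)) (at w)"
        unfolding has_field_derivative_def by (simp only:)
      then show ?thesis unfolding field_differentiable_def by blast
    qed
    then show "(\<lambda>w. g (upd s i w)) holomorphic_on ball 0 R"
      by (simp add: holomorphic_on_def field_differentiable_at_within)
  qed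
  have "\<exists>c. (\<forall>\<nu>. norm (c \<nu>) * R ^ mdeg \<nu> \<le> B) \<and>
    (\<forall>s\<in>polydisc R. ((\<lambda>\<nu>. c \<nu> * mpow s \<nu>) has_sum g s) {\<nu>. \<forall>j. j \<notin> UNIV \<longrightarrow> \<nu> $ j = 0})"
  proof (rule power_series_aux[OF R _ \<open>sep_holo R g\<close> B])
    show "g s = g t" if "\<And>j. j \<in> UNIV \<Longrightarrow> s $ j = t $ j" for s t
      using that by (metis UNIV_I vec_eq_iff)
  qed auto
  then obtain c where c: "\<And>\<nu>. norm (c \<nu>) * R ^ mdeg \<nu> \<le> B"
    and sums: "\<And>s. s \<in> polydisc R \<Longrightarrow> ((\<lambda>\<nu>. c \<nu> * mpow s \<nu>) has_sum g s) UNIV"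
    by auto
  show ?thesis
  proof (rule that)
    show "convergent_series c" unfolding convergent_series_iff_bound
      using c R by (intro exI[of _ B] exI[of _ "1 / R"]) (auto simp: power_divide field_simps)
    have "\<forall>\<^sub>F s::complex^'n in nhds 0. s \<in> polydisc R"
      unfolding eventually_nhds_metric
    proof (intro exI[of _ R] conjI allI impI R)
      fix s :: "complex^'n" assume "dist s 0 < R"
      then show "s \<in> polydisc R"
        using Finite_Cartesian_Product.norm_nth_le[of s] by (auto simp: polydisc_def intro: le_less_trans)
    qed
    then show "\<forall>\<^sub>F s in nhds 0. ((\<lambda>\<nu>. c \<nu> * mpow s \<nu>) has_sum g s) UNIV"
      by eventually_elim (rule sums)
  qed
qed

declare One_nat_def [simp del]

section \<open>Polynomials and linear substitution\<close>

abbreviation keys where "keys \<equiv> Poly_Mapping.keys"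
abbreviation lookup where "lookup \<equiv> Poly_Mapping.lookup"
abbreviation single where "single \<equiv> Poly_Mapping.single"

definition peval :: "'n::finite cpoly \<Rightarrow> complex^'n \<Rightarrow> complex" where
  "peval p s = (\<Sum>\<nu>\<in>keys p. lookup p \<nu> * mpow s \<nu>)"

lemma peval_superset:
  "finite K \<Longrightarrow> keys p \<subseteq> K \<Longrightarrow> peval p s = (\<Sum>\<nu>\<in>K. lookup p \<nu> * mpow s \<nu>)"
  unfolding peval_def by (rule sum.mono_neutral_left) (auto simp: in_keys_iff)

lemma sum_single_keys:
  fixes p :: "'a \<Rightarrow>\<^sub>0 'b::comm_monoid_add"
  shows "(\<Sum>\<nu>\<in>keys p. single \<nu> (lookup p \<nu>)) = p"
proof (rule poly_mapping_eqI)
  fix \<mu>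
  have "lookup (\<Sum>\<nu>\<in>keys p. single \<nu> (lookup p \<nu>)) \<mu> = (\<Sum>\<nu>\<in>keys p. if \<nu> = \<mu> then lookup p \<nu> else 0)"
    by (simp add: lookup_sum lookup_single when_def)
  then show "lookup (\<Sum>\<nu>\<in>keys p. single \<nu> (lookup p \<nu>)) \<mu> = lookup p \<mu>"
    by (simp add: in_keys_iff)
qed

lemma poly_additive_induct:
  fixes p :: "'a \<Rightarrow>\<^sub>0 'b::comm_monoid_add"
  assumes "\<And>\<nu> a. P (single \<nu> a)" "\<And>p q. P p \<Longrightarrow> P q \<Longrightarrow> P (p + q)"
  shows "P p"
proof -
  have "P (\<Sum>\<nu>\<in>K. single \<nu> (lookup p \<nu>))" if "finite K" for K
    using that
  proof induction
    case empty
    then show ?case using assms(1)[of undefined 0] by simp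
  qed (use assms in auto)
  from this[of "keys p"] show ?thesis by (simp add: sum_single_keys)
qed

lemma peval_single [simp]: "peval (single \<nu> a) s = a * mpow s \<nu>"
  by (simp add: peval_def)

lemma peval_zero [simp]: "peval 0 s = 0"
  by (simp add: peval_def)

lemma peval_add [simp]: "peval (p + q) s = peval p s + peval q s"
proof -
  have "peval r s = (\<Sum>\<nu>\<in>keys p \<union> keys q \<union> keys (p + q). lookup r \<nu> * mpow s \<nu>)"
    if "r \<in> {p, q, p + q}" for r
    by (rule peval_superset) (use that in auto)
  then show ?thesis by (simp add: lookup_add sum.distrib distrib_right)
qed

lemma peval_sum [simp]: "peval (\<Sum>x\<in>A. f x) s = (\<Sum>x\<in>A. peval (f x) s)"
  by (induction A rule: infinite_finite_induct) auto

lemma peval_mult [simp]: "peval (p * q) s = peval p s * peval q s"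
proof (induction p rule: poly_additive_induct)
  case (1 \<mu> a)
  show ?case
  proof (induction q rule: poly_additive_induct)
    case (1 \<nu> b)
    show ?case by (simp add: mult_single mpow_add)
  next
    case (2 q q')
    then show ?case by (simp add: algebra_simps)
  qed
next
  case (2 p p')
  then show ?case by (simp add: algebra_simps)
qed

lemma peval_one [simp]: "peval 1 s = 1"
  unfolding single_one[symmetric] peval_single by simp

lemma peval_power [simp]: "peval (p ^ k) s = peval p s ^ k"
  by (induction k) auto

lemma peval_prod [simp]: "peval (\<Prod>x\<in>A. f x) s = (\<Prod>x\<in>A. peval (f x) s)"
  by (induction A rule: infinite_finite_induct) auto

text \<open>Independence of the monomials turns identities of polynomials into identities of
  functions, which are easier to check for substitutions than identities of coefficients.\<close>

lemma peval_eqI: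
  assumes "\<And>s. peval p s = peval q s"
  shows "p = q"
proof (rule poly_mapping_eqI)
  fix \<nu>
  let ?K = "insert \<nu> (keys p \<union> keys q)"
  have "lookup p \<nu> - lookup q \<nu> = 0"
  proof (rule mpow_independent[where K="?K"])
    fix v
    show "(\<Sum>\<mu>\<in>?K. (lookup p \<mu> - lookup q \<mu>) * mpow v \<mu>) = 0"
    proof -
      have "peval p v = (\<Sum>\<mu>\<in>?K. lookup p \<mu> * mpow v \<mu>)" by (rule peval_superset) auto
      moreover have "peval q v = (\<Sum>\<mu>\<in>?K. lookup q \<mu> * mpow v \<mu>)" by (rule peval_superset) auto
      ultimately show ?thesis unfolding left_diff_distrib sum_subtractf using assms[of v] by simp
    qed
  qed auto
  then show "lookup p \<nu> = lookup q \<nu>" by simp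
qed

lemma peval_lin_subst [simp]: "peval (lin_subst J p) s = peval p (J *v s)"
  by (simp add: lin_subst_def peval_def[of p] mpow_def[of "\<chi> i. _ i"] matrix_vector_mult_def)

lemma poly_scale_eq: "poly_scale a p = single 0 a * p"
  unfolding poly_scale_def by (rule mult_map_scale_conv_mult)

lemma lookup_poly_scale [simp]: "lookup (poly_scale a p) \<nu> = a * lookup p \<nu>"
  by (simp add: poly_scale_def Poly_Mapping.map.rep_eq when_def)

lemma peval_poly_scale [simp]: "peval (poly_scale a p) s = a * peval p s"
  by (simp add: poly_scale_eq)

text \<open>All are read off from evaluation, where \<open>lin_subst J p\<close> takes the value of
  p at J s. Substitution is contravariant, which explains the order in
  \<open>K ** J\<close>.\<close>

lemma lin_subst_add: "lin_subst J (p + q) = lin_subst J p + lin_subst J q"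
  and lin_subst_scale: "lin_subst J (poly_scale a p) = poly_scale a (lin_subst J p)"
  and lin_subst_zero [simp]: "lin_subst J 0 = 0"
  and lin_subst_poly_one [simp]: "lin_subst J 1 = 1"
  and lin_subst_lin_subst: "lin_subst J (lin_subst K p) = lin_subst (K ** J) p"
  and lin_subst_one: "lin_subst (mat 1) p = p"
  by (rule peval_eqI; simp add: matrix_vector_mul_assoc)+

lemma lin_subst_single_add_axis:
  "lin_subst J (single (\<nu> + axis i 1) 1) =
    (\<Sum>j\<in>UNIV. single (axis j 1) (J $ i $ j)) * lin_subst J (single \<nu> 1)"
  by (rule peval_eqI) (simp add: mpow_add matrix_vector_mult_def mult.commute)

text \<open>Each variable is replaced by a linear form, so the degree is preserved. Consequently the
  adjoint acts within each degree and series can be truncated safely.\<close>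

lemma keys_lin_subst_single: "\<mu> \<in> keys (lin_subst J (single \<nu> 1)) \<Longrightarrow> mdeg \<mu> = mdeg \<nu>"
proof (induction \<nu> arbitrary: \<mu> rule: mindex_induct)
  case zero
  then show ?case by simp
next
  case (add \<nu> i)
  let ?L = "\<Sum>j\<in>UNIV. single (axis j 1) (J $ i $ j)" and ?q = "lin_subst J (single \<nu> 1)"
  have "\<mu> \<in> {a + b |a b. a \<in> keys ?L \<and> b \<in> keys ?q}"
    using add.prems unfolding lin_subst_single_add_axis by (rule subsetD[OF keys_mult])
  then obtain \<alpha> \<beta> where ab: "\<alpha> \<in> keys ?L" "\<beta> \<in> keys ?q" "\<mu> = \<alpha> + \<beta>"
    by auto
  from subsetD[OF Poly_Mapping.keys_sum ab(1)]
  obtain j where "\<alpha> \<in> keys (single (axis j 1) (J $ i $ j))" by blast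
  then have "\<alpha> = axis j 1" by (auto split: if_splits)
  with ab add.IH[of \<beta>] show ?case by simp
qed

lemma lookup_poly_deriv: "lookup (poly_deriv i p) \<nu> = of_nat (\<nu> $ i + 1) * lookup p (\<nu> + axis i 1)"
  by transfer simp

lemma poly_deriv_add: "poly_deriv i (p + q) = poly_deriv i p + poly_deriv i q"
  by (rule poly_mapping_eqI) (simp add: lookup_poly_deriv lookup_add algebra_simps)

text \<open>If \<open>\<nu> $ i\<close> is 0, subtraction of natural numbers leaves \<nu> unchanged,
  but the factor 0 makes the right side vanish as it should.\<close>

lemma poly_deriv_single: "poly_deriv i (single \<nu> a) = single (\<nu> - axis i 1) (of_nat (\<nu> $ i) * a)"
proof (rule poly_mapping_eqI)
  fix \<mu>
  show "lookup (poly_deriv i (single \<nu> a)) \<mu> = lookup (single (\<nu> - axis i 1) (of_nat (\<nu> $ i) * a)) \<mu>"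
  proof (cases "0 < \<nu> $ i")
    case True
    then obtain \<kappa> where eq: "\<nu> = \<kappa> + axis i 1" using mindex_eq_add_axis by blast
    then have "\<nu> - axis i 1 = \<kappa>" "\<nu> $ i = \<kappa> $ i + 1" by auto
    then show ?thesis unfolding eq by (auto simp: lookup_poly_deriv lookup_single when_def)
  next
    case False
    then have "\<nu> \<noteq> \<mu> + axis i 1" by (auto simp: vec_eq_iff intro!: exI[of _ i])
    then show ?thesis using False by (auto simp: lookup_poly_deriv lookup_single when_def)
  qed
qed

section \<open>Formal and analytic derivatives; the chain rule\<close>

lemma mpow_has_derivative:
  "((\<lambda>t. mpow t \<nu>) has_derivative (\<lambda>h. \<Sum>l\<in>UNIV. of_nat (\<nu> $ l) * mpow t (\<nu> - axis l 1) * h $ l)) (at t)"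
proof -
  have "((\<lambda>t. \<Prod>l\<in>UNIV. (t $ l) ^ (\<nu> $ l)) has_derivative
      (\<lambda>h. \<Sum>l\<in>UNIV. (of_nat (\<nu> $ l) * h $ l * (t $ l) ^ (\<nu> $ l - 1)) * (\<Prod>j\<in>UNIV - {l}. (t $ j) ^ (\<nu> $ j)))) (at t)"
    by (intro has_derivative_prod has_derivative_power bounded_linear.has_derivative[OF bounded_linear_vec_nth] has_derivative_ident)
  moreover have "(t $ l) ^ (\<nu> $ l - 1) * (\<Prod>j\<in>UNIV - {l}. (t $ j) ^ (\<nu> $ j)) = mpow t (\<nu> - axis l 1)" for l
    unfolding mpow_def by (subst (2) prod.remove[of _ l]) (auto simp: axis_def intro!: prod.cong)
  ultimately show ?thesis unfolding mpow_def[of _ \<nu>, abs_def] by (simp add: mult_ac)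
qed

lemma peval_has_derivative:
  "(peval p has_derivative (\<lambda>h. \<Sum>l\<in>UNIV. peval (poly_deriv l p) t * h $ l)) (at t)"
proof (induction p rule: poly_additive_induct)
  case (1 \<nu> a)
  have "(\<lambda>t. a * mpow t \<nu>) = peval (single \<nu> a)" by auto
  with has_derivative_mult_right[OF mpow_has_derivative, of a \<nu> t] show ?case
    by (simp add: poly_deriv_single sum_distrib_left mult_ac)
next
  case (2 p q)
  have "(\<lambda>t. peval p t + peval q t) = peval (p + q)" by auto
  with has_derivative_add[OF 2] show ?case
    by (simp add: poly_deriv_add sum.distrib distrib_right)
qed

text \<open>The formal chain rule is inherited from the analytic one: the function p(J s) has a
  unique derivative at s, and its value in the direction of the i-th basis vector is computed in two
  ways.\<close>

lemma poly_deriv_lin_subst: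
  "poly_deriv i (lin_subst J p) = (\<Sum>l\<in>UNIV. poly_scale (J $ l $ i) (lin_subst J (poly_deriv l p)))"
proof (rule peval_eqI)
  fix s
  have "linear ((*v) J)"
    by (rule linearI) (auto simp: matrix_vector_mult_def vec_eq_iff algebra_simps sum.distrib scaleR_sum_right)
  then have "bounded_linear ((*v) J)" by (simp add: linear_conv_bounded_linear)
  then have "((*v) J has_derivative (*v) J) (at s)" by (rule bounded_linear_imp_has_derivative)
  from has_derivative_compose[OF this peval_has_derivative[of p]]
  have "(peval (lin_subst J p) has_derivative (\<lambda>h. \<Sum>l\<in>UNIV. peval (poly_deriv l p) (J *v s) * (J *v h) $ l)) (at s)"
    by (simp add: peval_lin_subst[abs_def])
  from has_derivative_unique[OF this peval_has_derivative]
  have "(\<Sum>l\<in>UNIV. peval (poly_deriv l p) (J *v s) * (J *v axis i 1) $ l)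
      = (\<Sum>l\<in>UNIV. peval (poly_deriv l (lin_subst J p)) s * axis i 1 $ l)"
    by (rule fun_cong)
  moreover have "(J *v axis i 1) $ l = J $ l $ i" for l
    by (simp add: matrix_vector_mult_def axis_def if_distrib cong: if_cong)
  ultimately show "peval (poly_deriv i (lin_subst J p)) s =
      peval (\<Sum>l\<in>UNIV. poly_scale (J $ l $ i) (lin_subst J (poly_deriv l p))) s"
    by (simp add: axis_def if_distrib mult.commute cong: if_cong)
qed

section \<open>Convolution of power series\<close>

text \<open>The product of \<open>conv_series\<close>, on arbitrary coefficient families, so that
  its algebraic laws carry no convergence conditions.\<close>

definition cmul :: "'n::finite cseries \<Rightarrow> 'n cseries \<Rightarrow> 'n cseries" where
  "cmul f g = (\<lambda>\<nu>. \<Sum>(\<alpha>, \<beta>)\<in>{(\<alpha>, \<beta>). \<alpha> + \<beta> = \<nu>}. f \<alpha> * g \<beta>)"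

definition monomial_series :: "nat^'n::finite \<Rightarrow> 'n cseries" where
  "monomial_series \<mu> = (\<lambda>\<nu>. if \<nu> = \<mu> then 1 else 0)"

lemma cmul_commute: "cmul f g = cmul g f"
  unfolding cmul_def
  by (rule ext, rule sum.reindex_bij_witness[of _ prod.swap prod.swap]) (auto simp: add.commute)

text \<open>Both sides run over the decompositions of \<nu> into three summands; the bijection
  regroups (a + b, c) as (a, b + c).\<close>

lemma cmul_assoc: "cmul (cmul f g) h = cmul f (cmul g h)"
proof
  fix \<nu> :: "nat^'a"
  define S where "S = (\<lambda>\<nu>::nat^'a. {(\<alpha>, \<beta>). \<alpha> + \<beta> = \<nu>})"
  have fin: "finite (S \<nu>)" for \<nu> unfolding S_def by (rule finite_mindex_splits)
  have "cmul (cmul f g) h \<nu> = (\<Sum>x\<in>S \<nu>. \<Sum>y\<in>S (fst x). f (fst y) * g (snd y) * h (snd x))"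
    unfolding cmul_def S_def by (simp add: sum_distrib_right case_prod_unfold)
  also have "\<dots> = (\<Sum>(x, y)\<in>Sigma (S \<nu>) (\<lambda>x. S (fst x)). f (fst y) * g (snd y) * h (snd x))"
    by (rule sum.Sigma) (auto simp: fin)
  also have "\<dots> = (\<Sum>(x, y)\<in>Sigma (S \<nu>) (\<lambda>x. S (snd x)). f (fst x) * (g (fst y) * h (snd y)))"
    by (rule sum.reindex_bij_witness[of _ "\<lambda>((a, d), (b, c)). ((a + b, c), (a, b))"
          "\<lambda>((d, c), (a, b)). ((a, b + c), (b, c))"])
      (auto simp: S_def add.assoc mult.assoc)
  also have "\<dots> = (\<Sum>x\<in>S \<nu>. \<Sum>y\<in>S (snd x). f (fst x) * (g (fst y) * h (snd y)))"
    by (rule sum.Sigma[symmetric]) (auto simp: fin)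
  also have "\<dots> = cmul f (cmul g h) \<nu>"
    unfolding cmul_def S_def by (simp add: sum_distrib_left case_prod_unfold)
  finally show "cmul (cmul f g) h \<nu> = cmul f (cmul g h) \<nu>" .
qed

lemma cmul_add_left: "cmul (\<lambda>\<nu>. f \<nu> + g \<nu>) h = (\<lambda>\<nu>. cmul f h \<nu> + cmul g h \<nu>)"
  by (simp add: cmul_def case_prod_unfold distrib_right sum.distrib)

lemma cmul_scale_left: "cmul (\<lambda>\<nu>. a * f \<nu>) h = (\<lambda>\<nu>. a * cmul f h \<nu>)"
  by (simp add: cmul_def case_prod_unfold mult.assoc sum_distrib_left)

lemma cmul_zero_left: "cmul (\<lambda>\<nu>. 0) h = (\<lambda>\<nu>. 0)"
  by (simp add: cmul_def)

lemma cmul_sum_left: "cmul (\<lambda>\<nu>. \<Sum>x\<in>A. f x \<nu>) h = (\<lambda>\<nu>. \<Sum>x\<in>A. cmul (f x) h \<nu>)"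
  by (induction A rule: infinite_finite_induct) (auto simp: cmul_zero_left cmul_add_left)

lemma cmul_mono_add: "cmul (monomial_series \<mu>) f (\<mu> + \<beta>) = f \<beta>"
proof -
  have "cmul (monomial_series \<mu>) f (\<mu> + \<beta>) = (\<Sum>x\<in>{(\<mu>, \<beta>)}. f (snd x))"
    unfolding cmul_def monomial_series_def
    by (rule sum.mono_neutral_cong_right) (auto simp: finite_mindex_splits split: if_splits)
  then show ?thesis by simp
qed

lemma cmul_mono_eq_0: "(\<And>\<beta>. \<nu> \<noteq> \<mu> + \<beta>) \<Longrightarrow> cmul (monomial_series \<mu>) f \<nu> = 0"
  unfolding cmul_def monomial_series_def by (rule sum.neutral) auto

lemma cmul_one: "cmul (monomial_series 0) f = f"
  using cmul_mono_add[of 0 f] by auto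

lemma cmul_mono_mono: "cmul (monomial_series \<mu>) (monomial_series \<nu>) = monomial_series (\<mu> + \<nu>)"
proof
  fix \<kappa>
  show "cmul (monomial_series \<mu>) (monomial_series \<nu>) \<kappa> = monomial_series (\<mu> + \<nu>) \<kappa>"
  proof (cases "\<exists>\<beta>. \<kappa> = \<mu> + \<beta>")
    case True
    then obtain \<beta> where "\<kappa> = \<mu> + \<beta>" by blast
    then show ?thesis by (simp add: cmul_mono_add) (simp add: monomial_series_def)
  next
    case False
    then show ?thesis using cmul_mono_eq_0[of \<kappa> \<mu>] by (auto simp: monomial_series_def)
  qed
qed

text \<open>A coefficient of the product sees only coefficients of \<open>g\<close> of no larger
  degree, so \<open>g\<close> acts as a finite combination of monomials.\<close>

lemma cmul_expand:
  assumes "finite M" "\<And>\<mu>. mdeg \<mu> \<le> mdeg \<nu> \<Longrightarrow> \<mu> \<in> M"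
  shows "cmul g f \<nu> = (\<Sum>\<mu>\<in>M. g \<mu> * cmul (monomial_series \<mu>) f \<nu>)"
proof -
  have "(\<Sum>\<mu>\<in>M. g \<mu> * cmul (monomial_series \<mu>) f \<nu>)
      = (\<Sum>x\<in>{(\<alpha>, \<beta>). \<alpha> + \<beta> = \<nu>}. \<Sum>\<mu>\<in>M. g \<mu> * (monomial_series \<mu> (fst x) * f (snd x)))"
    unfolding cmul_def case_prod_unfold sum_distrib_left by (rule sum.swap)
  also have "\<dots> = (\<Sum>x\<in>{(\<alpha>, \<beta>). \<alpha> + \<beta> = \<nu>}. g (fst x) * f (snd x))"
  proof (rule sum.cong[OF refl])
    fix x assume "x \<in> {(\<alpha>, \<beta>). \<alpha> + \<beta> = \<nu>}"
    then have "fst x \<in> M" by (intro assms(2)) auto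
    have "(\<Sum>\<mu>\<in>M. g \<mu> * (monomial_series \<mu> (fst x) * f (snd x))) = (\<Sum>\<mu>\<in>M. if \<mu> = fst x then g \<mu> * f (snd x) else 0)"
      by (rule sum.cong) (auto simp: monomial_series_def)
    also have "\<dots> = g (fst x) * f (snd x)" using \<open>fst x \<in> M\<close> assms(1) by simp
    finally show "(\<Sum>\<mu>\<in>M. g \<mu> * (monomial_series \<mu> (fst x) * f (snd x))) = g (fst x) * f (snd x)" .
  qed
  finally show ?thesis unfolding cmul_def case_prod_unfold by simp
qed

section \<open>The sesquilinear form and the adjoint substitution\<close>

lemma sesqui_superset:
  "finite K \<Longrightarrow> keys p \<subseteq> K \<Longrightarrow>
    sesqui p f = (\<Sum>\<nu>\<in>K. of_nat (mfact \<nu>) * lookup p \<nu> * cnj (f \<nu>))"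
  unfolding sesqui_def by (rule sum.mono_neutral_left) (auto simp: in_keys_iff)

lemma sesqui_add_left: "sesqui (p + q) f = sesqui p f + sesqui q f"
proof -
  have "sesqui r f = (\<Sum>\<nu>\<in>keys p \<union> keys q \<union> keys (p + q). of_nat (mfact \<nu>) * lookup r \<nu> * cnj (f \<nu>))"
    if "r \<in> {p, q, p + q}" for r
    by (rule sesqui_superset) (use that in auto)
  then show ?thesis by (simp add: lookup_add sum.distrib algebra_simps)
qed

lemma sesqui_single [simp]: "sesqui (single \<nu> a) f = of_nat (mfact \<nu>) * a * cnj (f \<nu>)"
  by (simp add: sesqui_def)

lemma sesqui_zero_left [simp]: "sesqui 0 f = 0"
  by (simp add: sesqui_def)

lemma sesqui_scale_left: "sesqui (poly_scale a p) f = a * sesqui p f"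
  by (subst (1 2) sesqui_superset[of "keys p"]) (auto simp: in_keys_iff sum_distrib_left mult_ac)

lemma sesqui_sum_left: "sesqui (\<Sum>x\<in>A. p x) f = (\<Sum>x\<in>A. sesqui (p x) f)"
  by (induction A rule: infinite_finite_induct) (auto simp: sesqui_add_left)

lemma sesqui_add_right: "sesqui p (\<lambda>\<nu>. f \<nu> + g \<nu>) = sesqui p f + sesqui p g"
  by (simp add: sesqui_def algebra_simps sum.distrib)

lemma sesqui_scale_right: "sesqui p (\<lambda>\<nu>. a * f \<nu>) = cnj a * sesqui p f"
  by (simp add: sesqui_def sum_distrib_left mult_ac)

lemma sesqui_sum_right: "sesqui p (\<lambda>\<nu>. \<Sum>x\<in>A. f x \<nu>) = (\<Sum>x\<in>A. sesqui p (f x))"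
  unfolding sesqui_def cnj_sum sum_distrib_left by (rule sum.swap)

lemma sesqui_cong: "(\<And>\<nu>. \<nu> \<in> keys p \<Longrightarrow> f \<nu> = g \<nu>) \<Longrightarrow> sesqui p f = sesqui p g"
  by (simp add: sesqui_def)

lemma sesqui_eqI:
  assumes "\<And>p. sesqui p f = sesqui p g"
  shows "f = g"
proof
  fix \<nu>
  show "f \<nu> = g \<nu>" using assms[of "single \<nu> 1"] by simp
qed

text \<open>On monomials this is the identity (\<mu> + e)! = (\<mu>_i + 1) \<mu>! for the i-th unit
  multi-index e, which is the purpose of the factorial weights. If \<nu> does not involve variable
  \<open>i\<close>, both sides are 0.\<close>

lemma sesqui_deriv: "sesqui (poly_deriv i p) f = sesqui p (cmul (monomial_series (axis i 1)) f)"
proof (induction p rule: poly_additive_induct)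
  case (1 \<nu> a)
  show ?case
  proof (cases "0 < \<nu> $ i")
    case True
    then obtain \<mu> where eq: "\<nu> = \<mu> + axis i 1" using mindex_eq_add_axis by blast
    have "cmul (monomial_series (axis i 1)) f \<nu> = f \<mu>" unfolding eq by (subst add.commute) (rule cmul_mono_add)
    moreover have "\<nu> - axis i 1 = \<mu>" "\<nu> $ i = \<mu> $ i + 1" by (auto simp: eq)
    ultimately show ?thesis using mfact_add_axis[of \<mu> i] by (simp add: poly_deriv_single eq algebra_simps)
  next
    case False
    then have "\<nu> \<noteq> axis i 1 + \<beta>" for \<beta> by (auto simp: vec_eq_iff intro!: exI[of _ i])
    then show ?thesis using False by (simp add: poly_deriv_single cmul_mono_eq_0)
  qed
next
  case (2 p q)
  then show ?case by (simp add: poly_deriv_add sesqui_add_left)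
qed

lemma sesqui_cmul_expand:
  assumes "finite M" "\<And>\<mu> \<nu>. \<nu> \<in> keys p \<Longrightarrow> mdeg \<mu> \<le> mdeg \<nu> \<Longrightarrow> \<mu> \<in> M"
  shows "sesqui p (cmul g f) = (\<Sum>\<mu>\<in>M. cnj (g \<mu>) * sesqui p (cmul (monomial_series \<mu>) f))"
proof -
  have "sesqui p (cmul g f) = sesqui p (\<lambda>\<nu>. \<Sum>\<mu>\<in>M. g \<mu> * cmul (monomial_series \<mu>) f \<nu>)"
    by (rule sesqui_cong, rule cmul_expand) (use assms in auto)
  then show ?thesis by (simp add: sesqui_sum_right sesqui_scale_right)
qed

text \<open>Pairing \<sigma>^\<nu> with h yields \<nu>! times the conjugate of the coefficient of h
  at \<nu>; solving for that coefficient gives the only candidate for the adjoint. No convergence is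
  presupposed.\<close>

definition adj_series :: "complex^'n^'n \<Rightarrow> 'n::finite cseries \<Rightarrow> 'n cseries" where
  "adj_series J f = (\<lambda>\<nu>. cnj (sesqui (lin_subst J (single \<nu> 1)) f) / of_nat (mfact \<nu>))"

lemma sesqui_adj_series: "sesqui p (adj_series J f) = sesqui (lin_subst J p) f"
proof (induction p rule: poly_additive_induct)
  case (1 \<nu> a)
  have "lin_subst J (single \<nu> a) = poly_scale a (lin_subst J (single \<nu> 1))"
    by (rule peval_eqI) simp
  then show ?case by (simp add: adj_series_def sesqui_scale_left)
next
  case (2 p q)
  then show ?case by (simp add: lin_subst_add sesqui_add_left)
qed

lemma adj_series_add: "adj_series J (\<lambda>\<nu>. f \<nu> + g \<nu>) = (\<lambda>\<nu>. adj_series J f \<nu> + adj_series J g \<nu>)"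
  by (rule sesqui_eqI) (simp add: sesqui_add_right sesqui_adj_series)

lemma adj_series_scale: "adj_series J (\<lambda>\<nu>. a * f \<nu>) = (\<lambda>\<nu>. a * adj_series J f \<nu>)"
  by (rule sesqui_eqI) (simp add: sesqui_scale_right sesqui_adj_series)

lemma adj_series_adj_series: "adj_series K (adj_series J f) = adj_series (K ** J) f"
  by (rule sesqui_eqI) (simp add: sesqui_adj_series lin_subst_lin_subst)

lemma adj_series_mat_one: "adj_series (mat 1) f = f"
  by (rule sesqui_eqI) (simp add: sesqui_adj_series lin_subst_one)

text \<open>Pairing with the constant series 1 is evaluation at the origin, a point fixed by linear
  maps; hence the adjoint preserves the unit.\<close>

lemma sesqui_mono_zero: "sesqui p (monomial_series 0) = peval p 0"
proof (induction p rule: poly_additive_induct)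
  case (1 \<nu> a)
  have "mpow 0 \<nu> = 0" if nz: "\<nu> \<noteq> 0"
  proof -
    obtain i where "\<nu> $ i \<noteq> 0" using nz by (auto simp: vec_eq_iff)
    then show ?thesis unfolding mpow_def by (intro prod_zero) (auto intro!: bexI[of _ i])
  qed
  then show ?case by (cases "\<nu> = 0") (auto simp: monomial_series_def)
qed (simp add: sesqui_add_left)

lemma adj_series_one: "adj_series J (monomial_series 0) = monomial_series 0"
  by (rule sesqui_eqI) (simp add: sesqui_adj_series sesqui_mono_zero)

text \<open>The dual of the chain rule. The first factor on the right is the i-th entry of J* t for
  the conjugate transpose J*, so this is where the substitution s = J* t appears.\<close>

lemma adj_series_var_mult:
  "adj_series J (cmul (monomial_series (axis i 1)) f) =
    cmul (\<lambda>\<nu>. \<Sum>l\<in>UNIV. cnj (J $ l $ i) * monomial_series (axis l 1) \<nu>) (adj_series J f)"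
  by (rule sesqui_eqI, unfold sesqui_adj_series cmul_sum_left cmul_scale_left)
    (simp add: sesqui_adj_series sesqui_deriv[symmetric] poly_deriv_lin_subst sesqui_sum_left
      sesqui_scale_left sesqui_sum_right sesqui_scale_right)

lemma adj_series_mono_mult:
  "adj_series J (cmul (monomial_series \<mu>) f) = cmul (adj_series J (monomial_series \<mu>)) (adj_series J f)"
proof (induction \<mu> rule: mindex_induct)
  case zero
  then show ?case by (simp add: adj_series_one cmul_one)
next
  case (add \<mu> i)
  have "monomial_series (\<mu> + axis i 1) = cmul (monomial_series (axis i 1)) (monomial_series \<mu>)" by (simp add: cmul_mono_mono add.commute)
  then show ?case by (simp only: cmul_assoc adj_series_var_mult add)
qed

text \<open>The coefficient at \<nu> involves \<open>g\<close> only up to the degree of \<nu>, on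
  both sides, because the adjoint preserves degrees. Replacing \<open>g\<close> by its truncation
  reduces the claim to monomials.\<close>

lemma adj_series_mult:
  fixes f g :: "'n::finite cseries"
  shows "adj_series J (cmul g f) = cmul (adj_series J g) (adj_series J f)"
proof
  fix \<nu> :: "nat^'n"
  define M where "M = {\<mu>::nat^'n. mdeg \<mu> \<le> mdeg \<nu>}"
  have M: "finite M" unfolding M_def by (rule finite_mdeg_le)
  have trunc: "adj_series J g \<alpha> = (\<Sum>\<mu>\<in>M. g \<mu> * adj_series J (monomial_series \<mu>) \<alpha>)" if "\<alpha> \<in> M" for \<alpha>
  proof -
    have "sesqui (lin_subst J (single \<alpha> 1)) g
        = sesqui (lin_subst J (single \<alpha> 1)) (\<lambda>\<kappa>. \<Sum>\<mu>\<in>M. g \<mu> * monomial_series \<mu> \<kappa>)"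
    proof (rule sesqui_cong)
      fix \<kappa> assume "\<kappa> \<in> keys (lin_subst J (single \<alpha> 1))"
      then have "mdeg \<kappa> = mdeg \<alpha>" by (rule keys_lin_subst_single)
      then have "\<kappa> \<in> M" using that by (auto simp: M_def)
      then show "g \<kappa> = (\<Sum>\<mu>\<in>M. g \<mu> * monomial_series \<mu> \<kappa>)"
        using M by (simp add: monomial_series_def if_distrib cong: if_cong)
    qed
    then show ?thesis
      by (simp add: adj_series_def sesqui_sum_right sesqui_scale_right sum_divide_distrib)
  qed
  let ?h = "adj_series J f"
  have "sesqui (single \<nu> 1) (adj_series J (cmul g f)) = (\<Sum>\<mu>\<in>M. cnj (g \<mu>) * sesqui (lin_subst J (single \<nu> 1)) (cmul (monomial_series \<mu>) f))"
    unfolding sesqui_adj_series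
    by (rule sesqui_cmul_expand[OF M]) (auto simp: M_def dest: keys_lin_subst_single)
  also have "\<dots> = (\<Sum>\<mu>\<in>M. cnj (g \<mu>) * sesqui (single \<nu> 1) (cmul (adj_series J (monomial_series \<mu>)) ?h))"
    by (simp only: sesqui_adj_series[symmetric] adj_series_mono_mult)
  also have "\<dots> = sesqui (single \<nu> 1) (cmul (\<lambda>\<alpha>. \<Sum>\<mu>\<in>M. g \<mu> * adj_series J (monomial_series \<mu>) \<alpha>) ?h)"
    by (simp only: cmul_sum_left cmul_scale_left sesqui_sum_right sesqui_scale_right)
  finally have "adj_series J (cmul g f) \<nu> = cmul (\<lambda>\<alpha>. \<Sum>\<mu>\<in>M. g \<mu> * adj_series J (monomial_series \<mu>) \<alpha>) ?h \<nu>"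
    by simp
  also have "\<dots> = cmul (adj_series J g) ?h \<nu>"
    unfolding cmul_def by (rule sum.cong) (auto simp: trunc M_def)
  finally show "adj_series J (cmul g f) \<nu> = cmul (adj_series J g) ?h \<nu>" .
qed

section \<open>Convergence of the adjoint series\<close>

definition coeff_norm :: "'n::finite cpoly \<Rightarrow> real" where
  "coeff_norm p = (\<Sum>\<nu>\<in>keys p. norm (lookup p \<nu>))"

lemma coeff_norm_single [simp]: "coeff_norm (single \<nu> a) = norm a"
  by (simp add: coeff_norm_def)

lemma coeff_norm_zero [simp]: "coeff_norm 0 = 0"
  by (simp add: coeff_norm_def)

lemma coeff_norm_add: "coeff_norm (p + q) \<le> coeff_norm p + coeff_norm q"
proof -
  have "coeff_norm r = (\<Sum>\<nu>\<in>keys p \<union> keys q \<union> keys (p + q). norm (lookup r \<nu>))"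
    if "r \<in> {p, q, p + q}" for r
    unfolding coeff_norm_def by (rule sum.mono_neutral_left) (use that in \<open>auto simp: in_keys_iff\<close>)
  then show ?thesis by (simp add: lookup_add sum.distrib[symmetric] sum_mono norm_triangle_ineq)
qed

lemma coeff_norm_sum: "coeff_norm (\<Sum>x\<in>A. p x) \<le> (\<Sum>x\<in>A. coeff_norm (p x))"
proof (induction A rule: infinite_finite_induct)
  case (insert x A)
  then show ?case using coeff_norm_add[of "p x" "sum p A"] by simp
qed auto

lemma coeff_norm_single_mult: "coeff_norm (single \<mu> a * q) \<le> norm a * coeff_norm q"
proof -
  have "single \<mu> a * q = (\<Sum>\<nu>\<in>keys q. single (\<mu> + \<nu>) (a * lookup q \<nu>))"
    by (subst sum_single_keys[of q, symmetric]) (simp add: sum_distrib_left mult_single)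
  also have "coeff_norm \<dots> \<le> (\<Sum>\<nu>\<in>keys q. norm a * norm (lookup q \<nu>))"
    using coeff_norm_sum[of "\<lambda>\<nu>. single (\<mu> + \<nu>) (a * lookup q \<nu>)" "keys q"] by (simp add: norm_mult)
  finally show ?thesis by (simp add: coeff_norm_def sum_distrib_left)
qed

text \<open>Each of the \<open>mdeg \<nu>\<close> linear factors contributes at most the sum of the
  moduli of all entries of \<open>J\<close>.\<close>

lemma coeff_norm_lin_subst_single:
  "coeff_norm (lin_subst J (single \<nu> 1)) \<le> (\<Sum>i\<in>UNIV. \<Sum>j\<in>UNIV. norm (J $ i $ j)) ^ mdeg \<nu>"
proof (induction \<nu> rule: mindex_induct)
  case (add \<nu> i)
  let ?q = "lin_subst J (single \<nu> 1)" and ?T = "\<Sum>i\<in>UNIV. \<Sum>j\<in>UNIV. norm (J $ i $ j)"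
  have "coeff_norm (lin_subst J (single (\<nu> + axis i 1) 1)) \<le> (\<Sum>j\<in>UNIV. norm (J $ i $ j) * coeff_norm ?q)"
    unfolding lin_subst_single_add_axis sum_distrib_right
    by (rule order_trans[OF coeff_norm_sum]) (intro sum_mono coeff_norm_single_mult)
  also have "\<dots> = (\<Sum>j\<in>UNIV. norm (J $ i $ j)) * coeff_norm ?q" by (simp add: sum_distrib_right)
  also have "\<dots> \<le> ?T * ?T ^ mdeg \<nu>"
    by (intro mult_mono add member_le_sum[of i UNIV "\<lambda>i. \<Sum>j\<in>UNIV. norm (J $ i $ j)"] sum_nonneg)
      (auto simp: coeff_norm_def intro: sum_nonneg)
  finally show ?case by (simp add: power_add mult.commute)
qed (simp add: coeff_norm_def)

lemma mfact_le_fact_mdeg: "mfact \<nu> \<le> fact (mdeg (\<nu>::nat^'n::finite))"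
proof (induction \<nu> rule: mindex_induct)
  case (add \<nu> i)
  have "\<nu> $ i \<le> mdeg \<nu>" unfolding mdeg_def by (rule member_le_sum) auto
  then have "(\<nu> $ i + 1) * mfact \<nu> \<le> (mdeg \<nu> + 1) * fact (mdeg \<nu>)"
    using add by (intro mult_mono) auto
  then show ?case unfolding mfact_add_axis mdeg_add mdeg_axis Suc_eq_plus1[symmetric] fact_Suc by simp
qed simp

text \<open>In degree k the adjoint mixes coefficients at \<mu> into the one at \<nu> with weight
  \<mu>!/\<nu>!. Since \<mu>! is at most k! and k! is at most n^k \<nu>!, the factorials contribute
  only a geometric factor.\<close>

lemma convergent_adj_series:
  assumes "convergent_series (f::'n::finite cseries)"
  shows "convergent_series (adj_series J f)"
proof -
  obtain C K where K: "0 < K" and f: "\<And>\<nu>. norm (f \<nu>) \<le> C * K ^ mdeg \<nu>"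
    using assms unfolding convergent_series_iff_bound by blast
  have C: "0 \<le> C" using order_trans[OF norm_ge_zero f[of 0]] by simp
  \<comment> \<open>The summand 1 keeps the growth rate positive even if \<open>J\<close> is
    0.\<close>
  define T where "T = 1 + (\<Sum>i\<in>UNIV. \<Sum>j\<in>UNIV. norm (J $ i $ j))"
  have T0: "0 \<le> (\<Sum>i\<in>UNIV. \<Sum>j\<in>UNIV. norm (J $ i $ j))" by (intro sum_nonneg) auto
  then have T: "0 < T" unfolding T_def by linarith
  have "norm (adj_series J f \<nu>) \<le> C * (CARD('n) * K * T) ^ mdeg \<nu>" for \<nu>
  proof -
    let ?q = "lin_subst J (single \<nu> 1)" and ?k = "mdeg \<nu>"
    have "norm (sesqui ?q f) \<le> (\<Sum>\<mu>\<in>keys ?q. (fact ?k * (C * K ^ ?k)) * norm (lookup ?q \<mu>))"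
      unfolding sesqui_def
    proof (rule sum_norm_le)
      fix \<mu> assume "\<mu> \<in> keys ?q"
      then have k: "mdeg \<mu> = ?k" by (rule keys_lin_subst_single)
      have "real (mfact \<mu>) \<le> fact ?k"
        using mfact_le_fact_mdeg[of \<mu>] unfolding k by (metis of_nat_fact of_nat_le_iff)
      then have "real (mfact \<mu>) * norm (f \<mu>) \<le> fact ?k * (C * K ^ ?k)"
        using f[of \<mu>] unfolding k by (intro mult_mono) auto
      then have "(real (mfact \<mu>) * norm (f \<mu>)) * norm (lookup ?q \<mu>) \<le> (fact ?k * (C * K ^ ?k)) * norm (lookup ?q \<mu>)"
        by (rule mult_right_mono) simp
      then show "norm (of_nat (mfact \<mu>) * lookup ?q \<mu> * cnj (f \<mu>)) \<le> (fact ?k * (C * K ^ ?k)) * norm (lookup ?q \<mu>)"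
        by (simp add: norm_mult mult_ac)
    qed
    also have "\<dots> = (fact ?k * (C * K ^ ?k)) * coeff_norm ?q"
      by (simp add: coeff_norm_def sum_distrib_left)
    also have "\<dots> \<le> (fact ?k * (C * K ^ ?k)) * T ^ ?k"
    proof (rule mult_left_mono)
      show "coeff_norm ?q \<le> T ^ ?k"
        using coeff_norm_lin_subst_single[of J \<nu>] power_mono[OF _ T0, of T ?k] unfolding T_def
        by linarith
    qed (use C K in auto)
    also have "\<dots> \<le> (real (CARD('n) ^ ?k * mfact \<nu>) * (C * K ^ ?k)) * T ^ ?k"
    proof (intro mult_right_mono)
      show "(fact ?k :: real) \<le> real (CARD('n) ^ ?k * mfact \<nu>)"
        using fact_mdeg_le[of \<nu>] by (metis of_nat_fact of_nat_le_iff)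
    qed (use C K T in auto)
    finally have "norm (sesqui ?q f) \<le> real (mfact \<nu>) * (C * (CARD('n) * K * T) ^ ?k)"
      by (simp add: power_mult_distrib mult_ac)
    then show ?thesis unfolding adj_series_def
      by (simp add: norm_divide pos_divide_le_eq mult.commute)
  qed
  moreover have "0 < CARD('n) * K * T" using K T by simp
  ultimately show ?thesis unfolding convergent_series_iff_bound by blast
qed

section \<open>Algebras over the complex numbers\<close>

lemma complex_field_simps [simp]:
  "carrier complex_field = UNIV" "x \<otimes>\<^bsub>complex_field\<^esub> y = x * y" "\<one>\<^bsub>complex_field\<^esub> = 1"
  "x \<oplus>\<^bsub>complex_field\<^esub> y = x + y" "\<zero>\<^bsub>complex_field\<^esub> = 0"
  by (simp_all add: complex_field_def)

lemma cring_complex_field: "cring complex_field"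
proof (rule cringI)
  show "abelian_group complex_field"
    by (rule abelian_groupI) (auto simp: algebra_simps intro: exI[of _ "- _"])
  show "comm_monoid complex_field"
    by (rule comm_monoidI) auto
qed (simp add: algebra_simps)

text \<open>Every axiom is an identity or the existence of an element, and both pass along a
  surjection that respects the operations. It serves quotients as well as transported
  structures.\<close>

lemma algebra_surj_image:
  fixes B :: "(complex, 'b, 'y) module_scheme"
  assumes A: "Module.algebra complex_field A" and surj: "T ` carrier A = carrier B"
    and mult: "\<And>x y. x \<in> carrier A \<Longrightarrow> y \<in> carrier A \<Longrightarrow> T (x \<otimes>\<^bsub>A\<^esub> y) = T x \<otimes>\<^bsub>B\<^esub> T y"
    and add: "\<And>x y. x \<in> carrier A \<Longrightarrow> y \<in> carrier A \<Longrightarrow> T (x \<oplus>\<^bsub>A\<^esub> y) = T x \<oplus>\<^bsub>B\<^esub> T y"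
    and one: "T \<one>\<^bsub>A\<^esub> = \<one>\<^bsub>B\<^esub>" and zero: "T \<zero>\<^bsub>A\<^esub> = \<zero>\<^bsub>B\<^esub>"
    and smult: "\<And>a x. x \<in> carrier A \<Longrightarrow> T (a \<odot>\<^bsub>A\<^esub> x) = a \<odot>\<^bsub>B\<^esub> T x"
  shows "Module.algebra complex_field B"
proof -
  interpret A: Module.algebra complex_field A by fact
  note ops = mult[symmetric] add[symmetric] smult[symmetric] one[symmetric] zero[symmetric]
  have ex: "\<exists>x\<in>carrier A. y = T x" if "y \<in> carrier B" for y using that surj by blast
  have T: "T x \<in> carrier B" if "x \<in> carrier A" for x using that surj by blast
  have cl: "a \<odot>\<^bsub>A\<^esub> x \<in> carrier A" if "x \<in> carrier A" for a x using that A.smult_closed by simp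
  have "abelian_group B"
  proof (rule abelian_groupI, goal_cases)
    case (1 x y)
    then show ?case by (auto dest!: ex simp: ops T)
  next
    case 2
    then show ?case by (auto simp: ops T)
  next
    case (3 x y z)
    then show ?case by (auto dest!: ex simp: ops T A.M.a_assoc)
  next
    case (4 x y)
    then show ?case by (auto dest!: ex simp: ops T A.M.a_comm)
  next
    case (5 x)
    then show ?case by (auto dest!: ex simp: ops T)
  next
    case (6 x)
    then obtain u where u: "u \<in> carrier A" "x = T u" using ex by blast
    then have "T (\<ominus>\<^bsub>A\<^esub> u) \<oplus>\<^bsub>B\<^esub> x = \<zero>\<^bsub>B\<^esub>" by (simp add: ops A.M.l_neg)
    then show ?case using T[of "\<ominus>\<^bsub>A\<^esub> u"] u by auto
  qed
  moreover have "comm_monoid B"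
  proof (rule comm_monoidI, goal_cases)
    case (5 x y)
    then show ?case by (auto dest!: ex simp: ops A.m_comm)
  qed (auto dest!: ex simp: ops T A.m_assoc)
  ultimately have "cring B"
    by (rule cringI) (auto dest!: ex simp: ops T A.l_distr)
  then show ?thesis
  proof (rule algebraI[OF cring_complex_field], goal_cases)
    case (1 a x)
    then show ?case by (auto dest!: ex simp: ops T cl)
  next
    case (2 a b x)
    then show ?case using A.smult_l_distr[of a b] by (auto dest!: ex simp: ops T cl)
  next
    case (3 a x y)
    then show ?case using A.smult_r_distr[of a] by (auto dest!: ex simp: ops T cl)
  next
    case (4 a b x)
    then show ?case using A.smult_assoc1[of a b] by (auto dest!: ex simp: ops T cl)
  next
    case (5 x)
    then show ?case using A.smult_one by (auto dest!: ex simp: ops T cl)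
  next
    case (6 a x y)
    then show ?case using A.smult_assoc2[of a] by (auto dest!: ex simp: ops T cl)
  qed
qed

context
  fixes A :: "(complex, 'a, 'x) module_scheme" and I
  assumes A: "Module.algebra complex_field A" and I: "ideal I A"
begin

interpretation A: Module.algebra complex_field A by (rule A)
interpretation I: ideal I A by (rule I)

text \<open>The scalar a acts as multiplication by the ring element a1, so ideals of the ring are
  subspaces.\<close>

lemma ideal_smult_closed: "x \<in> I \<Longrightarrow> a \<odot>\<^bsub>A\<^esub> x \<in> I"
proof -
  assume x: "x \<in> I"
  then have "x \<in> carrier A" by (rule I.a_Hcarr)
  then have "(a \<odot>\<^bsub>A\<^esub> \<one>\<^bsub>A\<^esub>) \<otimes>\<^bsub>A\<^esub> x = a \<odot>\<^bsub>A\<^esub> x"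
    using A.smult_assoc2[of a "\<one>\<^bsub>A\<^esub>" x] by simp
  moreover have "(a \<odot>\<^bsub>A\<^esub> \<one>\<^bsub>A\<^esub>) \<otimes>\<^bsub>A\<^esub> x \<in> I"
    using x A.smult_closed[of a "\<one>\<^bsub>A\<^esub>"] by (intro I.I_l_closed) auto
  ultimately show ?thesis by simp
qed

lemma carrier_quot_algebra: "carrier (quot_algebra A I) = (\<lambda>x. I +>\<^bsub>A\<^esub> x) ` carrier A"
  by (auto simp: quot_algebra_def ring.defs FactRing_def A_RCOSETS_def')

lemma quot_algebra_mult:
  "x \<in> carrier A \<Longrightarrow> y \<in> carrier A \<Longrightarrow>
    (I +>\<^bsub>A\<^esub> x) \<otimes>\<^bsub>quot_algebra A I\<^esub> (I +>\<^bsub>A\<^esub> y) = I +>\<^bsub>A\<^esub> (x \<otimes>\<^bsub>A\<^esub> y)"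
  by (simp add: quot_algebra_def ring.defs FactRing_def I.rcoset_mult_add)

lemma quot_algebra_add:
  "x \<in> carrier A \<Longrightarrow> y \<in> carrier A \<Longrightarrow>
    (I +>\<^bsub>A\<^esub> x) \<oplus>\<^bsub>quot_algebra A I\<^esub> (I +>\<^bsub>A\<^esub> y) = I +>\<^bsub>A\<^esub> (x \<oplus>\<^bsub>A\<^esub> y)"
  by (simp add: quot_algebra_def ring.defs FactRing_def I.a_rcos_sum)

lemma quot_algebra_one: "\<one>\<^bsub>quot_algebra A I\<^esub> = I +>\<^bsub>A\<^esub> \<one>\<^bsub>A\<^esub>"
  by (simp add: quot_algebra_def ring.defs FactRing_def)

lemma quot_algebra_zero: "\<zero>\<^bsub>quot_algebra A I\<^esub> = I +>\<^bsub>A\<^esub> \<zero>\<^bsub>A\<^esub>"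
  by (simp add: quot_algebra_def ring.defs FactRing_def I.a_subset)

lemma coset_eq_iff:
  "x \<in> carrier A \<Longrightarrow> y \<in> carrier A \<Longrightarrow> I +>\<^bsub>A\<^esub> x = I +>\<^bsub>A\<^esub> y \<longleftrightarrow> x \<ominus>\<^bsub>A\<^esub> y \<in> I"
  using I.a_rcos_module_minus[OF A.ring_axioms, of y x] I.a_rcos_self[of x]
    I.a_repr_independence'[of x y] by auto

text \<open>The union defining the scalar multiple runs over all representatives; they all give the
  same coset, and there is at least one.\<close>

lemma quot_algebra_smult:
  assumes "x \<in> carrier A"
  shows "a \<odot>\<^bsub>quot_algebra A I\<^esub> (I +>\<^bsub>A\<^esub> x) = I +>\<^bsub>A\<^esub> (a \<odot>\<^bsub>A\<^esub> x)"
proof -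
  have "I +>\<^bsub>A\<^esub> (a \<odot>\<^bsub>A\<^esub> y) = I +>\<^bsub>A\<^esub> (a \<odot>\<^bsub>A\<^esub> x)" if y: "y \<in> I +>\<^bsub>A\<^esub> x" for y
  proof -
    obtain h where h: "h \<in> I" "y = h \<oplus>\<^bsub>A\<^esub> x" using y unfolding a_r_coset_def' by blast
    have hc: "h \<in> carrier A" using h(1) by (rule I.a_Hcarr)
    have ax: "a \<odot>\<^bsub>A\<^esub> x \<in> carrier A" using A.smult_closed[of a x] assms by simp
    have "a \<odot>\<^bsub>A\<^esub> y = (a \<odot>\<^bsub>A\<^esub> h) \<oplus>\<^bsub>A\<^esub> (a \<odot>\<^bsub>A\<^esub> x)" using h hc assms A.smult_r_distr[of a h x] by simp
    then have "a \<odot>\<^bsub>A\<^esub> y \<in> I +>\<^bsub>A\<^esub> (a \<odot>\<^bsub>A\<^esub> x)"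
      using ideal_smult_closed[OF h(1), of a] unfolding a_r_coset_def' by blast
    from I.a_repr_independence'[OF this ax] show ?thesis by simp
  qed
  moreover have "x \<in> I +>\<^bsub>A\<^esub> x" using assms by (rule I.a_rcos_self)
  ultimately have "(\<Union>y\<in>I +>\<^bsub>A\<^esub> x. I +>\<^bsub>A\<^esub> (a \<odot>\<^bsub>A\<^esub> y)) = I +>\<^bsub>A\<^esub> (a \<odot>\<^bsub>A\<^esub> x)"
    by blast
  then show ?thesis by (simp add: quot_algebra_def ring.defs FactRing_def module.defs)
qed

lemma algebra_quot_algebra: "Module.algebra complex_field (quot_algebra A I)"
  by (rule algebra_surj_image[OF A, of "\<lambda>x. I +>\<^bsub>A\<^esub> x"])
    (simp_all add: carrier_quot_algebra quot_algebra_mult quot_algebra_add quot_algebra_one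
      quot_algebra_zero quot_algebra_smult)

end

text \<open>Take an index whose basis has least cardinality. If a later subspace were strictly
  smaller, its basis could be enlarged by a vector of the earlier one, giving an independent set
  that is too large. Applied to ideals and to the filtration of a space of series by order.\<close>

lemma (in vector_space) descending_subspaces_stabilize:
  assumes fin: "finite B" and sp: "\<And>k. S k \<subseteq> span B"
    and sub: "\<And>k. subspace (S k)" and dec: "\<And>k::nat. S (Suc k) \<subseteq> S k"
  shows "\<exists>N. \<forall>k\<ge>N. S k = S N"
proof -
  have "\<exists>b. b \<subseteq> S k \<and> independent b \<and> S k \<subseteq> span b" for k
    by (meson maximal_independent_subset)
  then obtain b where b: "\<And>k. b k \<subseteq> S k" "\<And>k. independent (b k)" "\<And>k. S k \<subseteq> span (b k)"
    by metis
  have finb: "finite (b k)" for k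
    using independent_span_bound[OF fin b(2)] b(1) sp by blast
  obtain N where N: "\<And>k. card (b N) \<le> card (b k)"
    using ex_has_least_nat[of "\<lambda>_. True" 0 "\<lambda>k. card (b k)"] by auto
  have anti: "S k \<subseteq> S N" if "N \<le> k" for k
    using lift_Suc_antimono_le[of S, OF dec that] .
  have "S k = S N" if "N \<le> k" for k
  proof (rule ccontr)
    assume "S k \<noteq> S N"
    with anti[OF that] obtain x where x: "x \<in> S N" "x \<notin> S k" by blast
    have "span (b k) \<subseteq> S k" by (rule span_minimal[OF b(1) sub])
    with x have "x \<notin> span (b k)" by blast
    then have ind: "independent (insert x (b k))" and "x \<notin> b k"
      using b(2) independent_insertI span_base by blast+
    have "insert x (b k) \<subseteq> span (b N)"
      using x(1) b(1)[of k] anti[OF that] b(3)[of N] by auto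
    from independent_span_bound[OF finb ind this] have "card (insert x (b k)) \<le> card (b N)" by blast
    with N[of k] \<open>x \<notin> b k\<close> finb[of k] show False by simp
  qed
  then show ?thesis by blast
qed

section \<open>Finite dimension, isomorphisms and transport of structure\<close>

lemma fun_scale_apply [simp]: "fun_scale a f x = a * f x"
  by (simp add: fun_scale_def)

lemma vector_space_fun_scale: "vector_space fun_scale"
  by (rule vector_space.intro)
    (simp_all add: fun_scale_def fun_eq_iff distrib_left distrib_right mult.assoc)

lemma vector_space_poly_scale: "vector_space poly_scale"
  by (rule vector_space.intro)
    (simp_all add: poly_mapping_eq_iff fun_eq_iff lookup_add distrib_left distrib_right mult.assoc)

interpretation fs: vector_space "fun_scale :: complex \<Rightarrow> ('z \<Rightarrow> complex) \<Rightarrow> 'z \<Rightarrow> complex"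
  by (rule vector_space_fun_scale)

interpretation ps: vector_space "poly_scale :: complex \<Rightarrow> 'n::finite cpoly \<Rightarrow> 'n cpoly"
  by (rule vector_space_poly_scale)

text \<open>A chain of ideals pulls back to a chain of subspaces of a finite-dimensional space,
  which stabilizes; by surjectivity the ideals are the images of their preimages. The linear algebra
  takes place in the source, so \<open>A\<close> may be a mere record.\<close>

lemma artinian_algebra_linear_image:
  fixes T :: "('z \<Rightarrow> complex) \<Rightarrow> 'a" and A :: "(complex, 'a, 'x) module_scheme"
  assumes A: "Module.algebra complex_field A" and fin: "finite B" and surj: "T ` fs.span B = carrier A"
    and add: "\<And>x y. x \<in> fs.span B \<Longrightarrow> y \<in> fs.span B \<Longrightarrow> T (x + y) = T x \<oplus>\<^bsub>A\<^esub> T y"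
    and scale: "\<And>a x. x \<in> fs.span B \<Longrightarrow> T (fun_scale a x) = a \<odot>\<^bsub>A\<^esub> T x"
  shows "artinian_algebra A"
  unfolding artinian_algebra_def
proof (intro conjI A allI impI)
  interpret A: Module.algebra complex_field A by (rule A)
  fix I assume I: "\<forall>k::nat. ideal (I k) A \<and> I (Suc k) \<subseteq> I k"
  define S where "S = (\<lambda>k. {v \<in> fs.span B. T v \<in> I k})"
  have img: "I k = T ` S k" for k
  proof -
    interpret Ik: ideal "I k" A using I by blast
    show ?thesis
    proof (intro equalityI subsetI)
      fix x assume x: "x \<in> I k"
      then have "x \<in> T ` fs.span B" unfolding surj by (rule Ik.a_Hcarr)
      with x show "x \<in> T ` S k" unfolding S_def by auto
    qed (auto simp: S_def)
  qed
  have "\<exists>N. \<forall>k\<ge>N. S k = S N"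
  proof (rule fs.descending_subspaces_stabilize[OF fin])
    fix k
    show "S k \<subseteq> fs.span B" unfolding S_def by blast
    show "S (Suc k) \<subseteq> S k" using I unfolding S_def by blast
    interpret Ik: ideal "I k" A using I by blast
    have z: "T 0 = \<zero>\<^bsub>A\<^esub>"
    proof -
      have "T (fun_scale 0 0) = 0 \<odot>\<^bsub>A\<^esub> T 0" by (rule scale[OF fs.span_zero])
      moreover have "T 0 \<in> carrier A" using surj fs.span_zero by blast
      ultimately show ?thesis using A.smult_l_null[of "T 0"] by (simp add: fun_scale_def zero_fun_def)
    qed
    show "fs.subspace (S k)"
    proof (rule fs.subspaceI)
      show "0 \<in> S k" unfolding S_def using z Ik.zero_closed fs.span_zero by simp
      show "x + y \<in> S k" if "x \<in> S k" "y \<in> S k" for x y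
        using that add Ik.a_closed unfolding S_def by (auto intro: fs.span_add)
      show "fun_scale c x \<in> S k" if "x \<in> S k" for c x
        using that scale ideal_smult_closed[OF A Ik.ideal_axioms] unfolding S_def
        by (auto intro: fs.span_scale)
    qed
  qed
  then show "\<exists>N. \<forall>k\<ge>N. I k = I N" using img by metis
qed

lemma linear_isoD:
  assumes "h \<in> linear_iso V W"
  shows "bij_betw h (carrier V) (carrier W)"
    and "\<And>x y. x \<in> carrier V \<Longrightarrow> y \<in> carrier V \<Longrightarrow> h (x \<oplus>\<^bsub>V\<^esub> y) = h x \<oplus>\<^bsub>W\<^esub> h y"
    and "\<And>c x. x \<in> carrier V \<Longrightarrow> h (c \<odot>\<^bsub>V\<^esub> x) = c \<odot>\<^bsub>W\<^esub> h x"
  using assms unfolding linear_iso_def by blast+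

lemma algebra_isoI:
  assumes "h \<in> linear_iso A B"
    and "\<And>x y. x \<in> carrier A \<Longrightarrow> y \<in> carrier A \<Longrightarrow> h (x \<otimes>\<^bsub>A\<^esub> y) = h x \<otimes>\<^bsub>B\<^esub> h y"
    and "h \<one>\<^bsub>A\<^esub> = \<one>\<^bsub>B\<^esub>"
  shows "h \<in> algebra_iso A B"
  using assms linear_isoD[OF assms(1)] unfolding algebra_iso_def
  by (auto intro!: ring_iso_memI simp: bij_betw_def)

lemma algebra_isoD:
  assumes "h \<in> algebra_iso A B"
  shows "h \<in> linear_iso A B"
    and "\<And>x y. x \<in> carrier A \<Longrightarrow> y \<in> carrier A \<Longrightarrow> h (x \<otimes>\<^bsub>A\<^esub> y) = h x \<otimes>\<^bsub>B\<^esub> h y"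
    and "h \<one>\<^bsub>A\<^esub> = \<one>\<^bsub>B\<^esub>"
  using assms unfolding algebra_iso_def by (auto dest: ring_iso_memE)

text \<open>The inverse of \<open>h\<close> maps \<open>B\<close> onto \<open>V\<close> and respects
  the transported operations by their very definition, so the axioms are inherited from
  \<open>B\<close>.\<close>

lemma transport_algebra_iso:
  fixes V :: "(complex, 'a) module" and B :: "(complex, 'b, 'y) module_scheme"
  assumes B: "Module.algebra complex_field B" and h: "h \<in> linear_iso V B"
    and add_closed: "\<And>x y. x \<in> carrier V \<Longrightarrow> y \<in> carrier V \<Longrightarrow> x \<oplus>\<^bsub>V\<^esub> y \<in> carrier V"
    and smult_closed: "\<And>a x. x \<in> carrier V \<Longrightarrow> a \<odot>\<^bsub>V\<^esub> x \<in> carrier V"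
    and zero: "\<zero>\<^bsub>V\<^esub> \<in> carrier V" "h \<zero>\<^bsub>V\<^esub> = \<zero>\<^bsub>B\<^esub>"
  shows "Module.algebra complex_field (transport_algebra V B h)"
    and "h \<in> algebra_iso (transport_algebra V B h) B"
proof -
  interpret B: Module.algebra complex_field B by (rule B)
  let ?W = "transport_algebra V B h" and ?T = "inv_into (carrier V) h"
  note lin = linear_isoD[OF h]
  have W: "carrier ?W = carrier V" "\<And>x y. x \<oplus>\<^bsub>?W\<^esub> y = x \<oplus>\<^bsub>V\<^esub> y" "\<And>a x. a \<odot>\<^bsub>?W\<^esub> x = a \<odot>\<^bsub>V\<^esub> x"
    "\<zero>\<^bsub>?W\<^esub> = \<zero>\<^bsub>V\<^esub>" "\<And>x y. x \<otimes>\<^bsub>?W\<^esub> y = ?T (h x \<otimes>\<^bsub>B\<^esub> h y)" "\<one>\<^bsub>?W\<^esub> = ?T \<one>\<^bsub>B\<^esub>"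
    by (simp_all add: transport_algebra_def)
  have inj: "inj_on h (carrier V)" and im: "h ` carrier V = carrier B"
    using lin(1) by (auto simp: bij_betw_def)
  have hT: "h (?T y) = y" "?T y \<in> carrier V" if "y \<in> carrier B" for y
    using that im by (metis f_inv_into_f) (metis that im inv_into_into)
  have Th: "?T (h x) = x" if "x \<in> carrier V" for x using inj that by simp
  have hc: "h x \<in> carrier B" if "x \<in> carrier V" for x using im that by blast
  have Teq: "?T y = x" if "x \<in> carrier V" "h x = y" for x y using Th that by blast
  show "Module.algebra complex_field ?W"
  proof (rule algebra_surj_image[OF B, of ?T], unfold W)
    show "?T ` carrier B = carrier V"
      using lin(1) by (metis bij_betw_def bij_betw_inv_into)
    show "?T (x \<oplus>\<^bsub>B\<^esub> y) = ?T x \<oplus>\<^bsub>V\<^esub> ?T y" if "x \<in> carrier B" "y \<in> carrier B" for x y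
      using that by (intro Teq) (simp_all add: hT lin add_closed)
    show "?T (x \<otimes>\<^bsub>B\<^esub> y) = ?T (h (?T x) \<otimes>\<^bsub>B\<^esub> h (?T y))" if "x \<in> carrier B" "y \<in> carrier B" for x y
      using that by (simp add: hT)
    show "?T (a \<odot>\<^bsub>B\<^esub> x) = a \<odot>\<^bsub>V\<^esub> ?T x" if "x \<in> carrier B" for a x
      using that by (intro Teq) (simp_all add: hT lin smult_closed)
    show "?T \<zero>\<^bsub>B\<^esub> = \<zero>\<^bsub>V\<^esub>" using zero by (rule Teq)
  qed simp
  show "h \<in> algebra_iso ?W B"
  proof (rule algebra_isoI)
    show "h \<in> linear_iso ?W B" using lin unfolding linear_iso_def W by blast
  qed (simp_all add: W hT hc)
qed

text \<open>The induced map is taking the image of a coset as a set. It is well defined without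
  choosing representatives, and it is injective because \<open>h\<close> is.\<close>

lemma algebra_iso_quotient:
  assumes A: "Module.algebra complex_field A" and B: "Module.algebra complex_field B"
    and I: "ideal I A" and J: "ideal J B" and h: "h \<in> algebra_iso A B" and img: "h ` I = J"
  shows "\<exists>F \<in> algebra_iso (quot_algebra A I) (quot_algebra B J).
    \<forall>f \<in> carrier A. F (I +>\<^bsub>A\<^esub> f) = J +>\<^bsub>B\<^esub> h f"
proof -
  interpret A: Module.algebra complex_field A by (rule A)
  interpret B: Module.algebra complex_field B by (rule B)
  interpret I: ideal I A by (rule I)
  note iso = algebra_isoD[OF h] and lin = linear_isoD[OF algebra_isoD(1)[OF h]]
  have inj: "inj_on h (carrier A)" and im: "h ` carrier A = carrier B"
    using lin(1) by (auto simp: bij_betw_def)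
  have hc: "h x \<in> carrier B" if "x \<in> carrier A" for x using im that by blast
  have F: "h ` (I +>\<^bsub>A\<^esub> f) = J +>\<^bsub>B\<^esub> h f" if f: "f \<in> carrier A" for f
  proof -
    have "h ` (I +>\<^bsub>A\<^esub> f) = (\<Union>i\<in>I. {h (i \<oplus>\<^bsub>A\<^esub> f)})" unfolding a_r_coset_def' by blast
    also have "\<dots> = (\<Union>i\<in>I. {h i \<oplus>\<^bsub>B\<^esub> h f})" using lin(2)[OF I.a_Hcarr f] by auto
    also have "\<dots> = J +>\<^bsub>B\<^esub> h f" unfolding a_r_coset_def' img[symmetric] by blast
    finally show ?thesis .
  qed
  have sub: "I +>\<^bsub>A\<^esub> f \<subseteq> carrier A" if "f \<in> carrier A" for f
    using that I.a_Hcarr unfolding a_r_coset_def' by auto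
  have sm: "a \<odot>\<^bsub>A\<^esub> f \<in> carrier A" if "f \<in> carrier A" for a f using that A.smult_closed by simp
  have "(`) h \<in> algebra_iso (quot_algebra A I) (quot_algebra B J)"
  proof (rule algebra_isoI)
    show "(`) h \<in> linear_iso (quot_algebra A I) (quot_algebra B J)"
      unfolding linear_iso_def
    proof (intro CollectI conjI ballI allI)
      show "bij_betw ((`) h) (carrier (quot_algebra A I)) (carrier (quot_algebra B J))"
        unfolding bij_betw_def
      proof
        show "inj_on ((`) h) (carrier (quot_algebra A I))"
          unfolding carrier_quot_algebra[OF A I] using sub
          by (intro inj_on_subset[OF inj_on_image_Pow[OF inj]]) blast
        have "(`) h ` carrier (quot_algebra A I) = (\<lambda>f. J +>\<^bsub>B\<^esub> h f) ` carrier A"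
          unfolding carrier_quot_algebra[OF A I] image_image by (rule image_cong[OF refl F])
        also have "\<dots> = carrier (quot_algebra B J)"
          unfolding carrier_quot_algebra[OF B J] im[symmetric] image_image ..
        finally show "(`) h ` carrier (quot_algebra A I) = carrier (quot_algebra B J)" .
      qed
    next
      fix X Y c assume "X \<in> carrier (quot_algebra A I)"
      then obtain x where x: "x \<in> carrier A" "X = I +>\<^bsub>A\<^esub> x" unfolding carrier_quot_algebra[OF A I] by blast
      then show "h ` (c \<odot>\<^bsub>quot_algebra A I\<^esub> X) = c \<odot>\<^bsub>quot_algebra B J\<^esub> h ` X"
        by (simp add: quot_algebra_smult[OF A I] quot_algebra_smult[OF B J] F lin sm hc)
      assume "Y \<in> carrier (quot_algebra A I)"
      then obtain y where "y \<in> carrier A" "Y = I +>\<^bsub>A\<^esub> y" unfolding carrier_quot_algebra[OF A I] by blast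
      with x show "h ` (X \<oplus>\<^bsub>quot_algebra A I\<^esub> Y) = h ` X \<oplus>\<^bsub>quot_algebra B J\<^esub> h ` Y"
        by (simp add: quot_algebra_add[OF A I] quot_algebra_add[OF B J] F lin hc)
    qed
  next
    fix X Y assume "X \<in> carrier (quot_algebra A I)" "Y \<in> carrier (quot_algebra A I)"
    then obtain x y where xy: "x \<in> carrier A" "X = I +>\<^bsub>A\<^esub> x" "y \<in> carrier A" "Y = I +>\<^bsub>A\<^esub> y"
      unfolding carrier_quot_algebra[OF A I] by blast
    then show "h ` (X \<otimes>\<^bsub>quot_algebra A I\<^esub> Y) = h ` X \<otimes>\<^bsub>quot_algebra B J\<^esub> h ` Y"
      using F[OF A.m_closed[OF xy(1,3)]] iso(2)[OF xy(1,3)]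
      by (simp add: quot_algebra_mult[OF A I] quot_algebra_mult[OF B J] F hc)
  next
    show "h ` \<one>\<^bsub>quot_algebra A I\<^esub> = \<one>\<^bsub>quot_algebra B J\<^esub>"
      by (simp add: quot_algebra_one[OF A I] quot_algebra_one[OF B J] F iso)
  qed
  with F show ?thesis by blast
qed

section \<open>The algebra of convergent power series\<close>

lemma conv_series_simps [simp]:
  "carrier conv_series = Collect convergent_series" "f \<otimes>\<^bsub>conv_series\<^esub> g = cmul f g"
  "f \<oplus>\<^bsub>conv_series\<^esub> g = (\<lambda>\<nu>. f \<nu> + g \<nu>)" "a \<odot>\<^bsub>conv_series\<^esub> f = (\<lambda>\<nu>. a * f \<nu>)"
  "\<zero>\<^bsub>conv_series\<^esub> = (\<lambda>\<nu>. 0)" "\<one>\<^bsub>conv_series\<^esub> = monomial_series 0"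
  by (simp_all add: conv_series_def cmul_def monomial_series_def)

lemma convergent_add: "convergent_series f \<Longrightarrow> convergent_series g \<Longrightarrow> convergent_series (\<lambda>\<nu>. f \<nu> + g \<nu>)"
  using convergent_lincomb[of f g 1 1] by simp

lemma convergent_scale: "convergent_series f \<Longrightarrow> convergent_series (\<lambda>\<nu>. a * f \<nu>)"
  using convergent_lincomb[of f f a 0] by simp

lemma convergent_uminus: "convergent_series f \<Longrightarrow> convergent_series (\<lambda>\<nu>. - f \<nu>)"
  using convergent_scale[of f "-1"] by simp

lemma convergent_zero: "convergent_series (\<lambda>\<nu>. 0)"
  unfolding convergent_series_iff_bound by (intro exI[of _ 0] exI[of _ 1]) auto

lemma convergent_monomial_series: "convergent_series (monomial_series (0::nat^'n::finite))"
  unfolding convergent_series_iff_bound monomial_series_def by (intro exI[of _ 1]) auto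

text \<open>Doubling the growth rate leaves a factor (1/2)^|\<alpha>| in each term; the sum over all
  splittings of \<nu> is then bounded by a geometric sum independent of \<nu>.\<close>

lemma convergent_cmul:
  assumes "convergent_series f" "convergent_series g"
  shows "convergent_series (cmul f g)"
proof -
  obtain C K D L where K: "0 < K" "0 < L"
    and f: "\<And>\<nu>. norm (f \<nu>) \<le> C * K ^ mdeg \<nu>" and g: "\<And>\<nu>. norm (g \<nu>) \<le> D * L ^ mdeg \<nu>"
    using assms unfolding convergent_series_iff_bound by metis
  have CD: "0 \<le> C" "0 \<le> D"
    using order_trans[OF norm_ge_zero f[of 0]] order_trans[OF norm_ge_zero g[of 0]] by simp_all
  define R where "R = 2 * max K L"
  have R: "0 < R" using K by (simp add: R_def less_max_iff_disj)
  define s where "s = infsum (\<lambda>\<nu>::nat^'a. (1/2::real) ^ mdeg \<nu>) UNIV"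
  have sm: "(\<lambda>\<nu>::nat^'a. (1/2::real) ^ mdeg \<nu>) summable_on UNIV" by (rule summable_geometric_mdeg) auto
  have le: "norm (h \<nu>) \<le> E * (1/2) ^ mdeg \<nu> * R ^ mdeg \<nu>"
    if h: "\<And>\<nu>. norm (h \<nu>) \<le> E * T ^ mdeg \<nu>" and T: "0 < T" "T \<le> max K L" and E: "0 \<le> E"
    for h :: "'a cseries" and E T \<nu>
  proof -
    have "norm (h \<nu>) \<le> E * T ^ mdeg \<nu>" by (rule h)
    also have "\<dots> \<le> E * (max K L) ^ mdeg \<nu>" using T E by (intro mult_left_mono power_mono) auto
    also have "(max K L) ^ mdeg \<nu> = (1/2) ^ mdeg \<nu> * R ^ mdeg \<nu>"
      unfolding R_def power_mult_distrib[symmetric] by simp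
    finally show ?thesis by (simp only: mult.assoc)
  qed
  have "norm (cmul f g \<nu>) \<le> (C * D * s) * R ^ mdeg \<nu>" for \<nu>
  proof -
    let ?S = "{(\<alpha>, \<beta>). \<alpha> + \<beta> = \<nu>}"
    have "norm (cmul f g \<nu>) \<le> (\<Sum>x\<in>?S. C * D * R ^ mdeg \<nu> * (1/2) ^ mdeg (fst x))"
      unfolding cmul_def case_prod_unfold
    proof (rule sum_norm_le)
      fix x assume x: "x \<in> {x. fst x + snd x = \<nu>}"
      have "norm (f (fst x) * g (snd x)) \<le>
          (C * (1/2) ^ mdeg (fst x) * R ^ mdeg (fst x)) * (D * R ^ mdeg (snd x))"
        unfolding norm_mult
      proof (rule mult_mono)
        show "norm (f (fst x)) \<le> C * (1/2) ^ mdeg (fst x) * R ^ mdeg (fst x)"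
          by (rule le[OF f]) (use K CD in auto)
        have "norm (g (snd x)) \<le> D * (1/2) ^ mdeg (snd x) * R ^ mdeg (snd x)"
          by (rule le[OF g]) (use K CD in auto)
        also have "\<dots> \<le> D * 1 * R ^ mdeg (snd x)"
          using CD R by (intro mult_right_mono mult_left_mono power_le_one) auto
        finally show "norm (g (snd x)) \<le> D * R ^ mdeg (snd x)" by simp
      qed (use CD R in auto)
      also have "\<dots> = C * D * R ^ mdeg \<nu> * (1/2) ^ mdeg (fst x)"
        using x by (auto simp: power_add)
      finally show "norm (f (fst x) * g (snd x)) \<le> C * D * R ^ mdeg \<nu> * (1/2) ^ mdeg (fst x)" .
    qed
    also have "\<dots> = C * D * R ^ mdeg \<nu> * (\<Sum>x\<in>?S. (1/2) ^ mdeg (fst x))" by (simp add: sum_distrib_left)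
    also have "\<dots> \<le> C * D * R ^ mdeg \<nu> * s"
    proof (rule mult_left_mono)
      have "(\<Sum>x\<in>?S. (1/2::real) ^ mdeg (fst x)) = (\<Sum>\<alpha>\<in>fst ` ?S. (1/2) ^ mdeg \<alpha>)"
        by (subst sum.reindex) (auto simp: inj_on_def)
      also have "\<dots> \<le> s" unfolding s_def
        by (rule finite_sum_le_infsum[OF sm]) (auto simp: finite_mindex_splits)
      finally show "(\<Sum>x\<in>?S. (1/2::real) ^ mdeg (fst x)) \<le> s" .
    qed (use CD R in auto)
    finally show ?thesis by (simp add: mult_ac)
  qed
  with R show ?thesis unfolding convergent_series_iff_bound by blast
qed

lemma algebra_conv_series: "Module.algebra complex_field (conv_series :: (complex, 'n::finite cseries) module)"
proof -
  have "abelian_group (conv_series :: (complex, 'n cseries) module)"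
  proof (rule abelian_groupI, goal_cases)
    case (6 x)
    then show ?case
      by (intro bexI[of _ "\<lambda>\<nu>. - x \<nu>"]) (auto intro: convergent_uminus)
  qed (auto simp: convergent_add convergent_zero add_ac)
  moreover have "comm_monoid (conv_series :: (complex, 'n cseries) module)"
    by (rule comm_monoidI)
      (auto simp: convergent_cmul convergent_monomial_series cmul_assoc cmul_one intro: cmul_commute)
  ultimately have "cring (conv_series :: (complex, 'n cseries) module)"
    by (rule cringI) (simp add: cmul_add_left)
  then show ?thesis
    by (rule algebraI[OF cring_complex_field])
      (auto simp: convergent_scale cmul_scale_left algebra_simps)
qed

lemma conv_series_minus:
  assumes "convergent_series f" "convergent_series g"
  shows "f \<ominus>\<^bsub>conv_series\<^esub> g = f - g"
proof -
  interpret Module.algebra complex_field "conv_series :: (complex, 'a cseries) module"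
    by (rule algebra_conv_series)
  have "\<ominus>\<^bsub>conv_series\<^esub> g = (\<lambda>\<nu>. - g \<nu>)"
    by (rule minus_equality) (use assms convergent_uminus in auto)
  then show ?thesis by (auto simp: a_minus_def)
qed

text \<open>Monomials are moved over to the polynomial as derivatives. The induction quantifies over
  all of \<open>L\<close>, since each step replaces the polynomial by one of its
  derivatives.\<close>

lemma sesqui_cmul_D_invariant:
  fixes f g :: "'n::finite cseries"
  assumes L: "D_invariant L" and f: "\<And>q. q \<in> L \<Longrightarrow> sesqui q f = 0" and p: "p \<in> L"
  shows "sesqui p (cmul g f) = 0"
proof -
  have mono_eq_0: "sesqui q (cmul (monomial_series \<mu>) f) = 0" if "q \<in> L" for \<mu> :: "nat^'n" and q
    using that
  proof (induction \<mu> arbitrary: q rule: mindex_induct)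
    case zero
    then show ?case using f by (simp add: cmul_one)
  next
    case (add \<mu> i)
    have "poly_deriv i q \<in> L" using L add.prems unfolding D_invariant_def by blast
    from add.IH[OF this] show ?case
      unfolding sesqui_deriv by (simp add: cmul_assoc[symmetric] cmul_mono_mono add.commute)
  qed
  define M where "M = (\<Union>\<nu>\<in>keys p. {\<mu>::nat^'n. mdeg \<mu> \<le> mdeg \<nu>})"
  have "finite M" by (simp add: M_def finite_mdeg_le)
  then have "sesqui p (cmul g f) = (\<Sum>\<mu>\<in>M. cnj (g \<mu>) * sesqui p (cmul (monomial_series \<mu>) f))"
    by (rule sesqui_cmul_expand) (auto simp: M_def)
  then show ?thesis using mono_eq_0 p by simp
qed

lemma perp_ideal_if_D_invariant:
  assumes "D_invariant L"
  shows "ideal (perp L) conv_series"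
proof -
  interpret Module.algebra complex_field "conv_series :: (complex, 'a cseries) module"
    by (rule algebra_conv_series)
  have mult: "cmul x a \<in> perp L" if "a \<in> perp L" "convergent_series x" for a x
    using that sesqui_cmul_D_invariant[OF assms] by (auto simp: perp_def convergent_cmul)
  then have mult': "cmul a x \<in> perp L" if "a \<in> perp L" "convergent_series x" for a x
    using that cmul_commute[of a x] by simp
  show ?thesis
  proof (rule idealI)
    show "subgroup (perp L) (add_monoid conv_series)"
    proof (rule group.subgroupI[OF a_group])
      show "perp L \<noteq> {}"
        using convergent_zero by (auto simp: perp_def sesqui_def intro!: exI[of _ "\<lambda>\<nu>. 0"])
      show "inv\<^bsub>add_monoid conv_series\<^esub> f \<in> perp L" if "f \<in> perp L" for f
      proof -
        have "convergent_series f" using that by (simp add: perp_def)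
        then have "\<ominus>\<^bsub>conv_series\<^esub> f = (\<lambda>\<nu>. - f \<nu>)"
          by (intro minus_equality) (auto intro: convergent_uminus)
        then have "inv\<^bsub>add_monoid conv_series\<^esub> f = (\<lambda>\<nu>. - f \<nu>)"
          by (simp add: a_inv_def)
        then show ?thesis
          using that convergent_uminus[of f] sesqui_scale_right[of _ "-1" f] by (simp add: perp_def)
      qed
    qed (auto simp: perp_def convergent_add sesqui_add_right)
  qed (auto simp: ring_axioms mult mult')
qed

section \<open>Least parts\<close>

text \<open>The degree \<open>m\<close> part of the sesquilinear form, with a series in both
  arguments: a semidefinite Hermitian form whose null vectors are the series vanishing in degree
  \<open>m\<close>. At the order of the first argument it computes the pairing with its least
  part.\<close>

definition hform :: "nat \<Rightarrow> 'n::finite cseries \<Rightarrow> 'n cseries \<Rightarrow> complex" where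
  "hform m g h = (\<Sum>\<nu> | mdeg \<nu> = m. of_nat (mfact \<nu>) * g \<nu> * cnj (h \<nu>))"

lemma lookup_least_part: "lookup (least_part c) \<nu> = (if mdeg \<nu> = series_ord c then c \<nu> else 0)"
  by transfer simp

lemma sesqui_least_part: "sesqui (least_part g) h = hform (series_ord g) g h"
  unfolding hform_def
  by (subst sesqui_superset[of "{\<nu>. mdeg \<nu> = series_ord g}"])
    (auto simp: finite_mdeg in_keys_iff lookup_least_part split: if_splits)

lemma peval_least_part: "peval (least_part c) v = hpart c (series_ord c) v"
  unfolding hpart_def
  by (subst peval_superset[of "{\<nu>. mdeg \<nu> = series_ord c}"])
    (auto simp: finite_mdeg in_keys_iff lookup_least_part split: if_splits)

lemma least_part_zero [simp]: "least_part (\<lambda>\<nu>. 0) = 0" "least_part 0 = 0"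
  by (rule poly_mapping_eqI; simp add: lookup_least_part)+

lemma series_ord_eqI:
  assumes "\<And>\<nu>. mdeg \<nu> < k \<Longrightarrow> c \<nu> = 0" "mdeg \<mu> = k" "c \<mu> \<noteq> 0"
  shows "series_ord c = k"
  unfolding series_ord_def
  by (rule Least_equality) (use assms not_less in blast)+

lemma series_ord_nonzero:
  assumes "c \<noteq> 0"
  obtains \<mu> where "mdeg \<mu> = series_ord c" "c \<mu> \<noteq> 0"
proof -
  obtain \<nu> where "c \<nu> \<noteq> 0" using assms by (auto simp: fun_eq_iff)
  then have "\<exists>k \<nu>. mdeg \<nu> = k \<and> c \<nu> \<noteq> 0" by blast
  from LeastI_ex[OF this] that show ?thesis unfolding series_ord_def by blast
qed

lemma series_ord_low:
  assumes "mdeg \<nu> < series_ord c"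
  shows "c \<nu> = 0"
  using not_less_Least[of "mdeg \<nu>" "\<lambda>k. \<exists>\<nu>. mdeg \<nu> = k \<and> c \<nu> \<noteq> 0"] assms
  unfolding series_ord_def by blast

lemma hform_add_left: "hform m (f + g) h = hform m f h + hform m g h"
  and hform_scale_left: "hform m (fun_scale a f) h = a * hform m f h"
  and hform_diff_right: "hform m f (g - h) = hform m f g - hform m f h"
  and hform_scale_right: "hform m f (fun_scale a g) = cnj a * hform m f g"
  by (simp_all add: hform_def sum.distrib sum_subtractf sum_distrib_left distrib_left distrib_right
      right_diff_distrib mult_ac)

lemma hform_self_eq_0D:
  fixes g :: "'n::finite cseries"
  assumes "hform m g g = 0" "mdeg \<nu> = m"
  shows "g \<nu> = 0"
proof -
  define r where "r = (\<Sum>\<nu>::nat^'n | mdeg \<nu> = m. real (mfact \<nu>) * (norm (g \<nu>))\<^sup>2)"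
  have "hform m g g = of_real r"
    unfolding hform_def r_def of_real_sum
    by (rule sum.cong[OF refl]) (simp only: of_real_mult of_real_of_nat_eq complex_norm_square mult.assoc)
  with assms(1) have "r = 0" by simp
  then have "\<forall>\<nu>\<in>{\<nu>. mdeg \<nu> = m}. real (mfact \<nu>) * (norm (g \<nu>))\<^sup>2 = 0"
    unfolding r_def by (subst (asm) sum_nonneg_eq_0_iff) (simp_all add: finite_mdeg)
  with assms(2) have "real (mfact \<nu>) * (norm (g \<nu>))\<^sup>2 = 0" by blast
  then show ?thesis using mfact_nonzero[of \<nu>] by simp
qed

text \<open>Gram--Schmidt for a semidefinite form. In the degenerate case \<open>hform m b' b' = 0\<close> the
  coefficient of \<open>b'\<close> is \<open>0\<close> because of division by zero, as it should be.\<close>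

lemma hform_projection:
  assumes "finite B"
  shows "\<exists>u\<in>fs.span B. \<forall>g\<in>fs.span B. hform m g (f - u) = 0"
  using assms
proof (induction B arbitrary: f)
  case empty
  show ?case unfolding fs.span_empty by (simp add: hform_def)
next
  case (insert b B)
  obtain u0 where u0: "u0 \<in> fs.span B" "\<And>g. g \<in> fs.span B \<Longrightarrow> hform m g (b - u0) = 0"
    using insert.IH[of b] by blast
  obtain u1 where u1: "u1 \<in> fs.span B" "\<And>g. g \<in> fs.span B \<Longrightarrow> hform m g (f - u1) = 0"
    using insert.IH[of f] by blast
  define b' where "b' = b - u0"
  \<comment> \<open>The form is conjugate linear in its second argument, whence the
    conjugate.\<close>
  define a where "a = cnj (hform m b' (f - u1) / hform m b' b')"
  have b': "hform m b' (f - u1) - cnj a * hform m b' b' = 0"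
  proof (cases "hform m b' b' = 0")
    case True
    then have "b' \<nu> = 0" if "mdeg \<nu> = m" for \<nu> using that by (rule hform_self_eq_0D)
    then have "hform m b' (f - u1) = 0" unfolding hform_def by (intro sum.neutral) auto
    with True show ?thesis by simp
  qed (simp add: a_def)
  define u where "u = u1 + fun_scale a b'"
  have fu: "f - u = (f - u1) - fun_scale a b'" by (simp add: u_def)
  show ?case
  proof (intro bexI[of _ u] ballI)
    fix g assume "g \<in> fs.span (insert b B)"
    then obtain k where k: "g - fun_scale k b \<in> fs.span B" using fs.span_breakdown_eq by blast
    \<comment> \<open>Trading \<open>b\<close> for \<open>b'\<close> splits \<open>g\<close> into an
      element of the old span and a multiple of the new orthogonal direction.\<close>
    define g0 where "g0 = (g - fun_scale k b) + fun_scale k u0"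
    have g0: "g0 \<in> fs.span B" unfolding g0_def using k u0(1) by (intro fs.span_add fs.span_scale)
    have "g = g0 + fun_scale k b'"
      by (auto simp: g0_def b'_def fun_eq_iff algebra_simps)
    moreover have "hform m g0 (f - u) = 0"
      using u1(2)[OF g0] u0(2)[OF g0] unfolding fu b'_def hform_diff_right hform_scale_right by simp
    moreover have "hform m b' (f - u) = 0"
      using b' unfolding fu hform_diff_right hform_scale_right by simp
    ultimately show "hform m g (f - u) = 0" by (simp add: hform_add_left hform_scale_left)
  next
    have "fs.span B \<subseteq> fs.span (insert b B)" by (rule fs.span_mono) blast
    with u0(1) u1(1) show "u \<in> fs.span (insert b B)"
      unfolding u_def b'_def
      by (intro fs.span_add fs.span_scale fs.span_diff) (auto intro: fs.span_base)
  qed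
qed

text \<open>The residue \<open>f - v\<close> is made orthogonal to the least parts degree by degree; a correction in
  degree \<open>m\<close> by an element of order at least \<open>m\<close> does not disturb the lower degrees. The
  orders of the nonzero elements of a finite-dimensional space are bounded.\<close>

lemma exists_orthogonal_residue:
  fixes B :: "'n::finite cseries set"
  assumes B: "finite B"
  shows "\<exists>v\<in>fs.span B. \<forall>g\<in>fs.span B. sesqui (least_part g) (f - v) = 0"
proof -
  define V where "V = (\<lambda>m. {v \<in> fs.span B. \<forall>\<nu>. mdeg \<nu> < m \<longrightarrow> v \<nu> = 0})"
  have sub: "fs.subspace (V m)" for m
    by (rule fs.subspaceI) (auto simp: V_def fs.span_zero fs.span_add fs.span_scale)
  have dec: "V (Suc m) \<subseteq> V m" for m by (auto simp: V_def)
  have "\<exists>N. \<forall>k\<ge>N. V k = V N"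
    by (rule fs.descending_subspaces_stabilize[of B V]) (use B sub dec in \<open>auto simp: V_def\<close>)
  then obtain N where N: "\<And>k. N \<le> k \<Longrightarrow> V k = V N" by blast
  \<comment> \<open>Such an element lies in all later members of the filtration, hence vanishes in
    every degree.\<close>
  have VN: "v = 0" if "v \<in> V N" for v
  proof
    fix \<nu> :: "nat^'n"
    have "v \<in> V (max N (Suc (mdeg \<nu>)))" using N[of "max N (Suc (mdeg \<nu>))"] that by simp
    then show "v \<nu> = 0 \<nu>" by (simp add: V_def)
  qed
  have "\<exists>v\<in>fs.span B. \<forall>g\<in>fs.span B. series_ord g < m \<longrightarrow> sesqui (least_part g) (f - v) = 0" for m
  proof (induction m)
    case 0
    show ?case by (intro bexI[OF _ fs.span_zero]) simp
  next
    case (Suc m)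
    then obtain v where v: "v \<in> fs.span B"
      "\<And>g. g \<in> fs.span B \<Longrightarrow> series_ord g < m \<Longrightarrow> sesqui (least_part g) (f - v) = 0" by blast
    \<comment> \<open>The projection is onto \<open>V m\<close> rather than onto the whole span:
      precisely there all elements of order \<open>m\<close> are to be found.\<close>
    obtain C where C: "C \<subseteq> V m" "fs.independent C" "V m \<subseteq> fs.span C"
      using fs.maximal_independent_subset by blast
    have "finite C" using fs.independent_span_bound[OF B C(2)] C(1) by (auto simp: V_def)
    then obtain u where u: "u \<in> fs.span C" "\<And>g. g \<in> fs.span C \<Longrightarrow> hform m g (f - v - u) = 0"
      using hform_projection[OF \<open>finite C\<close>, of m "f - v"] by blast
    have uV: "u \<in> V m" using u(1) fs.span_minimal[OF C(1) sub] by blast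
    show ?case
    proof (intro bexI[of _ "v + u"] ballI impI)
      show "v + u \<in> fs.span B" using v(1) uV by (auto simp: V_def intro: fs.span_add)
      fix g assume g: "g \<in> fs.span B" "series_ord g < Suc m"
      have fvu: "f - (v + u) = f - v - u" by (simp add: algebra_simps)
      show "sesqui (least_part g) (f - (v + u)) = 0"
      proof (cases "series_ord g = m")
        case True
        then have "g \<in> V m" using g(1) series_ord_low[of _ g] by (auto simp: V_def)
        with C(3) u(2) show ?thesis unfolding sesqui_least_part fvu True by blast
      next
        case False
        with g(2) have less: "series_ord g < m" by simp
        have "sesqui (least_part g) (f - (v + u)) = sesqui (least_part g) (f - v)"
          using uV less by (intro sesqui_cong)
            (auto simp: V_def in_keys_iff lookup_least_part split: if_splits)
        with v(2)[OF g(1) less] show ?thesis by simp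
      qed
    qed
  qed
  from this[of N] obtain v where v: "v \<in> fs.span B"
    "\<And>g. g \<in> fs.span B \<Longrightarrow> series_ord g < N \<Longrightarrow> sesqui (least_part g) (f - v) = 0" by blast
  have "sesqui (least_part g) (f - v) = 0" if g: "g \<in> fs.span B" for g
  proof (cases "series_ord g < N")
    case True
    then show ?thesis using v(2) g by blast
  next
    case False
    then have "g \<in> V N" using g series_ord_low[of _ g] by (auto simp: V_def)
    then have "g = 0" by (rule VN)
    then show ?thesis by simp
  qed
  with v(1) show ?thesis by blast
qed

lemma orthogonal_to_least_part_eq_0:
  assumes "sesqui (least_part c) c = 0"
  shows "c = 0"
proof (rule ccontr)
  assume "c \<noteq> 0"
  then obtain \<mu> where "mdeg \<mu> = series_ord c" "c \<mu> \<noteq> 0" by (rule series_ord_nonzero)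
  with hform_self_eq_0D[of "series_ord c" c \<mu>] assms show False by (simp add: sesqui_least_part)
qed

section \<open>Power series of germs\<close>

text \<open>Unlike the definite description \<open>germ_series\<close>, this relation asserts that
  an expansion exists; linearity of \<open>germ_series\<close> is available only through it.\<close>

definition has_series :: "(complex^'n::finite \<Rightarrow> complex) \<Rightarrow> 'n cseries \<Rightarrow> bool" where
  "has_series g c \<longleftrightarrow> convergent_series c \<and> (\<forall>\<^sub>F s in nhds 0. ((\<lambda>\<nu>. c \<nu> * mpow s \<nu>) has_sum g s) UNIV)"

lemma germ_series_has_series: "has_series g c \<Longrightarrow> germ_series g = c"
  unfolding has_series_def by (intro germ_series_eqI) auto

lemma has_series_add: "has_series f c \<Longrightarrow> has_series g d \<Longrightarrow> has_series (\<lambda>s. f s + g s) (c + d)"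
  unfolding has_series_def
  by (auto simp: plus_fun_def convergent_add distrib_right elim: eventually_elim2 intro: has_sum_add)

lemma has_series_scale: "has_series f c \<Longrightarrow> has_series (\<lambda>s. a * f s) (fun_scale a c)"
  unfolding has_series_def
  by (auto simp: fun_scale_def convergent_scale mult.assoc elim!: eventually_mono intro: has_sum_cmult_right)

lemma has_series_cong:
  assumes "\<forall>\<^sub>F s in nhds 0. f s = g s"
  shows "has_series f c \<longleftrightarrow> has_series g c"
proof -
  have "(\<forall>\<^sub>F s in nhds 0. ((\<lambda>\<nu>. c \<nu> * mpow s \<nu>) has_sum f s) UNIV) \<longleftrightarrow>
      (\<forall>\<^sub>F s in nhds 0. ((\<lambda>\<nu>. c \<nu> * mpow s \<nu>) has_sum g s) UNIV)"
    by (rule eventually_cong[OF assms]) simp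
  then show ?thesis unfolding has_series_def by simp
qed

lemma has_series_same_imp_eq:
  "has_series f c \<Longrightarrow> has_series g c \<Longrightarrow> \<forall>\<^sub>F s in nhds 0. f s = g s"
  unfolding has_series_def by (auto elim: eventually_elim2 intro: has_sum_unique)

lemma germ_series_cong:
  assumes "\<forall>\<^sub>F s in nhds 0. f s = g s"
  shows "germ_series f = germ_series g"
  using has_series_cong[OF assms] unfolding germ_series_def has_series_def by simp

lemma has_series_zeroD:
  assumes "has_series g c" "\<forall>\<^sub>F s in nhds 0. g s = 0"
  shows "c = 0"
proof
  fix \<nu>
  have "has_series (\<lambda>s. 0) c" using has_series_cong[OF assms(2)] assms(1) by simp
  then show "c \<nu> = 0 \<nu>" unfolding has_series_def using series_eq_0I[of c] by simp
qed

lemma tendsto_derivative_quotient: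
  fixes \<Theta> :: "complex^'n::finite \<Rightarrow> complex^'n"
  assumes "(\<Theta> has_derivative (*v) J) (at 0)" "\<Theta> 0 = 0"
  shows "((\<lambda>r. (1 / r) *\<^sub>R \<Theta> (r *\<^sub>R v)) \<longlongrightarrow> J *v v) (at_right 0)"
proof -
  have "((\<lambda>r. r *\<^sub>R v) has_derivative (\<lambda>r. r *\<^sub>R v)) (at_right 0)"
    by (rule bounded_linear_imp_has_derivative[OF bounded_linear_scaleR_left])
  from has_derivative_compose[OF this, of \<Theta> "(*v) J"] assms(1)
  have "((\<lambda>r. \<Theta> (r *\<^sub>R v)) has_derivative (\<lambda>r. J *v (r *\<^sub>R v))) (at_right 0)" by simp
  then have "((\<lambda>r. norm (\<Theta> (r *\<^sub>R v) - \<Theta> (0 *\<^sub>R v) - J *v ((r - 0) *\<^sub>R v)) / norm (r - 0)) \<longlongrightarrow> 0) (at_right 0)"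
    unfolding has_derivative_iff_norm by blast
  then have "((\<lambda>r. norm (\<Theta> (r *\<^sub>R v) - J *v (r *\<^sub>R v)) / norm r) \<longlongrightarrow> 0) (at_right 0)"
    using assms(2) by simp
  moreover have "\<forall>\<^sub>F r in at_right 0. norm ((1 / r) *\<^sub>R \<Theta> (r *\<^sub>R v) - J *v v) \<le>
      norm (\<Theta> (r *\<^sub>R v) - J *v (r *\<^sub>R v)) / norm r"
    using eventually_at_right_less[of "0::real"]
  proof eventually_elim
    case (elim r)
    have J: "J *v (r *\<^sub>R v) = r *\<^sub>R (J *v v)"
      by (simp add: vec_eq_iff matrix_vector_mult_def scaleR_sum_right)
    have "(1 / r) *\<^sub>R \<Theta> (r *\<^sub>R v) - J *v v = (1 / r) *\<^sub>R (\<Theta> (r *\<^sub>R v) - J *v (r *\<^sub>R v))"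
      unfolding J using elim by (simp add: scaleR_diff_right)
    then show ?case using elim by simp
  qed
  ultimately have "((\<lambda>r. (1 / r) *\<^sub>R \<Theta> (r *\<^sub>R v) - J *v v) \<longlongrightarrow> 0) (at_right 0)"
    by (rule Lim_null_comparison[rotated])
  then show ?thesis by (rule LIM_zero_cancel)
qed

text \<open>Along the curve \<open>\<Theta> (r v)\<close>, which has the tangent \<open>J v\<close>, the leading term of the outer function
  is read off by the limit lemma; comparing with the limit along \<open>r v\<close> for the composite shows
  that the orders agree and the least parts correspond.\<close>

lemma least_part_compose:
  fixes \<Theta> :: "complex^'n::finite \<Rightarrow> complex^'n"
  assumes der: "(\<Theta> has_derivative (*v) J) (at 0)" and \<Theta>0: "\<Theta> 0 = 0" and inv: "J ** K = mat 1"
    and g: "has_series g c" and h: "has_series h d" and eq: "\<forall>\<^sub>F s in nhds 0. h s = g (\<Theta> s)"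
  shows "least_part d = lin_subst J (least_part c)"
proof (cases "c = 0")
  \<comment> \<open>For \<open>c = 0\<close> the order carries no information, so this case is
    settled by showing that the composite vanishes near 0.\<close>
  case True
  have "isCont \<Theta> 0" using der by (rule has_derivative_continuous)
  then have lim: "filterlim \<Theta> (nhds 0) (nhds 0)"
    using tendsto_at_iff_tendsto_nhds[of \<Theta> 0] unfolding isCont_def \<Theta>0 by blast
  have "has_series (\<lambda>s. 0) c" unfolding True has_series_def
    by (auto simp: convergent_zero zero_fun_def)
  from has_series_same_imp_eq[OF g this] have "\<forall>\<^sub>F s in nhds 0. g s = 0" .
  then have "\<forall>\<^sub>F s in nhds 0. g (\<Theta> s) = 0" using lim unfolding filterlim_iff by blast
  with eq have "\<forall>\<^sub>F s in nhds 0. h s = 0" by eventually_elim simp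
  then have "d = 0" using h by (intro has_series_zeroD)
  with True show ?thesis by simp
next
  case False
  have gc: "convergent_series c" "\<forall>\<^sub>F s in nhds 0. ((\<lambda>\<nu>. c \<nu> * mpow s \<nu>) has_sum g s) UNIV"
    and hd: "convergent_series d" "\<forall>\<^sub>F s in nhds 0. ((\<lambda>\<nu>. d \<nu> * mpow s \<nu>) has_sum h s) UNIV"
    using g h unfolding has_series_def by blast+
  define k where "k = series_ord c"
  have lim_h: "((\<lambda>r. h (r *\<^sub>R v) / complex_of_real r ^ k) \<longlongrightarrow> hpart c k (J *v v)) (at_right 0)" for v
  proof -
    \<comment> \<open>The curve is written as r times a direction that tends to J v, the form
      required by the limit lemma.\<close>
    have "((\<lambda>r. g (r *\<^sub>R ((1 / r) *\<^sub>R \<Theta> (r *\<^sub>R v))) / complex_of_real r ^ k) \<longlongrightarrow> hpart c k (J *v v)) (at_right 0)"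
      by (rule tendsto_hpart_along_curve[OF gc(1) _ gc(2) tendsto_derivative_quotient[OF der \<Theta>0]])
        (simp add: series_ord_low k_def)
    moreover have "((\<lambda>r. r *\<^sub>R v) \<longlongrightarrow> 0 *\<^sub>R v) (at_right 0)"
      by (intro tendsto_scaleR tendsto_ident_at tendsto_const)
    then have "filterlim (\<lambda>r. r *\<^sub>R v) (nhds 0) (at_right 0)" by simp
    then have "\<forall>\<^sub>F r in at_right 0. h (r *\<^sub>R v) = g (\<Theta> (r *\<^sub>R v))"
      using eq unfolding filterlim_iff by blast
    then have "\<forall>\<^sub>F r in at_right 0. g (r *\<^sub>R ((1 / r) *\<^sub>R \<Theta> (r *\<^sub>R v))) / complex_of_real r ^ k
        = h (r *\<^sub>R v) / complex_of_real r ^ k"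
      using eventually_at_right_less[of "0::real"] by eventually_elim simp
    ultimately show ?thesis by (rule Lim_transform_eventually)
  qed
  have lim_d: "((\<lambda>r. h (r *\<^sub>R v) / complex_of_real r ^ j) \<longlongrightarrow> hpart d j v) (at_right 0)"
    if "\<And>\<nu>. mdeg \<nu> < j \<Longrightarrow> d \<nu> = 0" for j v
    using tendsto_hpart_along_curve[OF hd(1) that hd(2) tendsto_const] .
  have low: "d \<nu> = 0" if "mdeg \<nu> < k" for \<nu>
    using that
  proof (induction "mdeg \<nu>" arbitrary: \<nu> rule: less_induct)
    case less
    define j where "j = mdeg \<nu>"
    have "hpart d j v = 0" for v
    proof (rule tendsto_unique)
      show "((\<lambda>r. h (r *\<^sub>R v) / complex_of_real r ^ j) \<longlongrightarrow> hpart d j v) (at_right 0)"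
        by (rule lim_d) (use less in \<open>auto simp: j_def\<close>)
      \<comment> \<open>Dividing by r^j instead of r^k leaves a positive power of r beside a
        convergent quotient, so the limit is 0.\<close>
      have "((\<lambda>r. complex_of_real r ^ (k - j) * (h (r *\<^sub>R v) / complex_of_real r ^ k))
          \<longlongrightarrow> complex_of_real 0 ^ (k - j) * hpart c k (J *v v)) (at_right 0)"
        by (intro tendsto_mult lim_h tendsto_power tendsto_of_real tendsto_ident_at)
      moreover have "complex_of_real 0 ^ (k - j) = 0" using less.prems by (simp add: j_def zero_power)
      ultimately have "((\<lambda>r. complex_of_real r ^ (k - j) * (h (r *\<^sub>R v) / complex_of_real r ^ k)) \<longlongrightarrow> 0) (at_right 0)"
        by (simp only: mult_zero_left)
      moreover have "\<forall>\<^sub>F r in at_right 0. complex_of_real r ^ (k - j) * (h (r *\<^sub>R v) / complex_of_real r ^ k)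
          = h (r *\<^sub>R v) / complex_of_real r ^ j"
        using eventually_at_right_less[of "0::real"]
      proof eventually_elim
        case (elim r)
        have "complex_of_real r ^ k = complex_of_real r ^ (k - j) * complex_of_real r ^ j"
          using less.prems by (simp add: j_def power_add[symmetric])
        with elim show ?case by simp
      qed
      ultimately show "((\<lambda>r. h (r *\<^sub>R v) / complex_of_real r ^ j) \<longlongrightarrow> 0) (at_right 0)"
        by (rule Lim_transform_eventually)
    qed simp
    then show ?case by (rule hpart_eq_0D) (simp add: j_def)
  qed
  have part: "hpart d k v = hpart c k (J *v v)" for v
    by (rule tendsto_unique[OF _ lim_d lim_h]) (use low in auto)
  have "\<exists>\<mu>. mdeg \<mu> = k \<and> d \<mu> \<noteq> 0"
  proof (rule ccontr)
    assume "\<not> ?thesis"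
    then have "hpart d k v = 0" for v unfolding hpart_def by (intro sum.neutral) auto
    \<comment> \<open>Invertibility of the Jacobian enters here: its image is everything, so a
      vanishing part of \<open>d\<close> would force the leading part of \<open>c\<close> to
      vanish.\<close>
    then have "hpart c k (J *v (K *v v)) = 0" for v using part by simp
    then have "hpart c k v = 0" for v by (simp add: matrix_vector_mul_assoc inv)
    then have "c \<nu> = 0" if "mdeg \<nu> = k" for \<nu> using that by (rule hpart_eq_0D)
    with series_ord_nonzero[OF False] show False unfolding k_def by metis
  qed
  then have "series_ord d = k" using low series_ord_eqI by blast
  then show ?thesis
    by (intro peval_eqI) (simp add: peval_least_part part flip: k_def)
qed

section \<open>Local parametrisations\<close>

lemma holo_map_on_has_derivative:
  fixes F :: "complex^'n::finite \<Rightarrow> complex^'k::finite"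
  assumes F: "holo_map_on F S" and x: "x \<in> S"
  obtains D where "(F has_derivative D) (at x)" "\<And>c v. D (c *s v) = c *s D v"
proof -
  have "\<forall>i. \<exists>D. ((\<lambda>x. F x $ i) has_derivative D) (at x) \<and> (\<forall>c v. D (c *s v) = c * D v)"
    using F x unfolding holo_map_on_def holo_on_def by blast
  then obtain D where D: "\<And>i. ((\<lambda>x. F x $ i) has_derivative D i) (at x)" "\<And>i c v. D i (c *s v) = c * D i v"
    by metis
  have bl: "bounded_linear (axis i :: complex \<Rightarrow> complex^'k)" for i
    unfolding linear_conv_bounded_linear[symmetric]
    by (rule linearI) (auto simp: vec_eq_iff axis_def)
  have sum_axis: "(\<Sum>i\<in>UNIV. axis i (y $ i)) = y" for y :: "complex^'k"
    by (simp add: vec_eq_iff axis_def if_distrib cong: if_cong)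
  have "((\<lambda>x. \<Sum>i\<in>UNIV. axis i (F x $ i)) has_derivative (\<lambda>h. \<Sum>i\<in>UNIV. axis i (D i h))) (at x)"
    by (intro has_derivative_sum bounded_linear.has_derivative[OF bl] D(1))
  moreover have "(\<Sum>i\<in>UNIV. axis i (D i (c *s v))) = c *s (\<Sum>i\<in>UNIV. axis i (D i v) :: complex^'k)" for c v
    by (simp add: vec_eq_iff axis_def D(2) if_distrib cong: if_cong)
  ultimately show ?thesis using that unfolding sum_axis by blast
qed

lemma holo_on_compose:
  fixes F :: "complex^'n::finite \<Rightarrow> complex^'k::finite"
  assumes g: "holo_on g T" and F: "holo_map_on F S" and FT: "\<And>x. x \<in> S \<Longrightarrow> F x \<in> T"
  shows "holo_on (g \<circ> F) S"
  unfolding holo_on_def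
proof
  fix x assume x: "x \<in> S"
  obtain D where D: "(F has_derivative D) (at x)" "\<And>c v. D (c *s v) = c *s D v"
    using holo_map_on_has_derivative[OF F x] by blast
  obtain E where E: "(g has_derivative E) (at (F x))" "\<And>c v. E (c *s v) = c * E v"
    using g FT[OF x] unfolding holo_on_def by blast
  have "((g \<circ> F) has_derivative (\<lambda>h. E (D h))) (at x)"
    using has_derivative_compose[OF D(1) E(1)] by (simp add: o_def)
  then show "\<exists>D. ((g \<circ> F) has_derivative D) (at x) \<and> (\<forall>c v. D (c *s v) = c * D v)"
    by (intro exI[of _ "\<lambda>h. E (D h)"]) (simp add: D(2) E(2))
qed

lemma holo_on_cong:
  assumes "open S" "\<And>x. x \<in> S \<Longrightarrow> f x = g x" "holo_on f S"
  shows "holo_on g S"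
  unfolding holo_on_def
proof
  fix x assume x: "x \<in> S"
  then obtain D where D: "(f has_derivative D) (at x)" "\<forall>c v. D (c *s v) = c * D v"
    using assms(3) unfolding holo_on_def by blast
  have "(g has_derivative D) (at x)"
    by (rule has_derivative_transform_within_open[OF D(1) assms(1) x]) (rule assms(2))
  with D(2) show "\<exists>D. (g has_derivative D) (at x) \<and> (\<forall>c v. D (c *s v) = c * D v)" by blast
qed

lemma holo_map_on_subset: "holo_map_on F S \<Longrightarrow> T \<subseteq> S \<Longrightarrow> holo_map_on F T"
  unfolding holo_map_on_def holo_on_def by blast

lemma complex_linear_eq_matrix:
  assumes "linear D" "\<And>c v. D (c *s v) = c *s D (v::complex^'n::finite)"
  shows "D = (*v) (matrix D)"
proof
  fix v :: "complex^'n"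
  have "D v = D (\<Sum>i\<in>UNIV. (v $ i) *s axis i 1)" by (simp add: basis_expansion)
  also have "\<dots> = (\<Sum>i\<in>UNIV. (v $ i) *s D (axis i 1))"
    by (simp add: linear_sum[OF assms(1)] assms(2))
  also have "\<dots> = matrix D *v v"
    by (simp add: vec_eq_iff matrix_vector_mult_def matrix_def mult.commute)
  finally show "D v = matrix D *v v" .
qed

text \<open>The witnesses of \<open>local_parametrisation\<close> made explicit, since the local
  inverse \<open>inv_into U \<Phi>\<close> refers to the domain.\<close>

definition parametrises ::
    "('m::topological_space, 'n::finite) atlas \<Rightarrow> (complex^'n \<Rightarrow> 'm) \<Rightarrow> (complex^'n) set \<Rightarrow> 'm set \<Rightarrow> bool" where
  "parametrises A \<Phi> U V \<longleftrightarrow> open U \<and> 0 \<in> U \<and> open V \<and> bij_betw \<Phi> U V \<and> continuous_on U \<Phi> \<and>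
     (\<forall>(W, \<phi>)\<in>A. holo_map_on (\<phi> \<circ> \<Phi>) (U \<inter> \<Phi> -` W)) \<and>
     (\<forall>(W, \<phi>)\<in>A. holo_map_on (inv_into U \<Phi> \<circ> inv_into W \<phi>) (\<phi> ` (V \<inter> W)))"

lemma local_parametrisation_iff:
  "local_parametrisation A b \<Phi> \<longleftrightarrow> \<Phi> 0 = b \<and> (\<exists>U V. parametrises A \<Phi> U V)"
  unfolding local_parametrisation_def parametrises_def ..

lemma parametrises_inv:
  assumes "parametrises A \<Phi> U V"
  shows "s \<in> U \<Longrightarrow> \<Phi> s \<in> V" "s \<in> U \<Longrightarrow> inv_into U \<Phi> (\<Phi> s) = s"
    "y \<in> V \<Longrightarrow> inv_into U \<Phi> y \<in> U" "y \<in> V \<Longrightarrow> \<Phi> (inv_into U \<Phi> y) = y"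
  using assms unfolding parametrises_def bij_betw_def
  by (auto simp: inv_into_into f_inv_into_f)

lemma parametrises_tendsto:
  assumes "parametrises A \<Phi> U V"
  shows "filterlim \<Phi> (nhds (\<Phi> 0)) (nhds 0)"
proof -
  have "isCont \<Phi> 0" using assms continuous_on_eq_continuous_at unfolding parametrises_def by blast
  then show ?thesis using tendsto_at_iff_tendsto_nhds[of \<Phi> 0] unfolding isCont_def by blast
qed

text \<open>Near 0 the change of coordinates factors through the chart \<phi> into two maps that are
  holomorphic by assumption; the chart cancels because it is injective.\<close>

lemma parametrises_transition:
  assumes \<Phi>: "parametrises A \<Phi> U V" and \<Psi>: "parametrises A \<Psi> U' V'"
    and eq: "\<Phi> 0 = \<Psi> 0" and chart: "(W, \<phi>) \<in> A" "\<Phi> 0 \<in> W" "open W" "inj_on \<phi> W"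
  shows "\<exists>J. ((inv_into U' \<Psi> \<circ> \<Phi>) has_derivative (*v) J) (at 0)"
    and "\<forall>\<^sub>F s in nhds 0. s \<in> U \<and> \<Phi> s \<in> V'"
proof -
  define S where "S = U \<inter> \<Phi> -` (V' \<inter> W)"
  have U: "open U" "0 \<in> U" "continuous_on U \<Phi>" and V': "open V'" "\<Psi> 0 \<in> V'"
    using \<Phi> \<Psi> parametrises_inv(1)[OF \<Psi>] unfolding parametrises_def by auto
  have S: "open S" "0 \<in> S"
    using continuous_open_preimage[OF U(3,1) open_Int[OF V'(1) chart(3)]] U V' chart eq
    unfolding S_def by auto
  have "holo_map_on (\<phi> \<circ> \<Phi>) (U \<inter> \<Phi> -` W)" using \<Phi> chart(1) unfolding parametrises_def by blast
  then have in_chart: "holo_map_on (\<phi> \<circ> \<Phi>) S" by (rule holo_map_on_subset) (auto simp: S_def)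
  have out: "holo_map_on (inv_into U' \<Psi> \<circ> inv_into W \<phi>) (\<phi> ` (V' \<inter> W))"
    using \<Psi> chart(1) unfolding parametrises_def by blast
  have "holo_map_on (inv_into U' \<Psi> \<circ> \<Phi>) S"
    unfolding holo_map_on_def
  proof
    fix i
    have "holo_on ((\<lambda>y. (inv_into U' \<Psi> \<circ> inv_into W \<phi>) y $ i) \<circ> (\<phi> \<circ> \<Phi>)) S"
      using out in_chart by (intro holo_on_compose[where T = "\<phi> ` (V' \<inter> W)"]) (auto simp: holo_map_on_def S_def)
    then show "holo_on (\<lambda>s. (inv_into U' \<Psi> \<circ> \<Phi>) s $ i) S"
      by (rule holo_on_cong[OF S(1), rotated]) (use chart(4) in \<open>auto simp: S_def\<close>)
  qed
  from holo_map_on_has_derivative[OF this S(2)]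
  obtain D where D: "((inv_into U' \<Psi> \<circ> \<Phi>) has_derivative D) (at 0)" "\<And>c v. D (c *s v) = c *s D v"
    by blast
  have "D = (*v) (matrix D)"
    using has_derivative_linear[OF D(1)] D(2) by (rule complex_linear_eq_matrix)
  with D(1) show "\<exists>J. ((inv_into U' \<Psi> \<circ> \<Phi>) has_derivative (*v) J) (at 0)" by metis
  have "\<forall>\<^sub>F s in nhds 0. s \<in> S" using S by (rule eventually_nhds_in_open)
  then show "\<forall>\<^sub>F s in nhds 0. s \<in> U \<and> \<Phi> s \<in> V'" by eventually_elim (auto simp: S_def)
qed

text \<open>The two changes of coordinates are mutually inverse near 0, so the chain rule makes both
  products of their derivatives the identity.\<close>

lemma parametrises_transition_invertible:
  assumes \<Phi>: "parametrises A \<Phi> U V" and \<Psi>: "parametrises A \<Psi> U' V'"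
    and eq: "\<Phi> 0 = \<Psi> 0" and chart: "(W, \<phi>) \<in> A" "\<Phi> 0 \<in> W" "open W" "inj_on \<phi> W"
  obtains J K where "((inv_into U' \<Psi> \<circ> \<Phi>) has_derivative (*v) J) (at 0)" "J ** K = mat 1" "K ** J = mat 1"
proof -
  have chart': "\<Psi> 0 \<in> W" using chart eq by simp
  obtain J where J: "((inv_into U' \<Psi> \<circ> \<Phi>) has_derivative (*v) J) (at 0)"
    using parametrises_transition(1)[OF \<Phi> \<Psi> eq chart] by blast
  obtain K where K: "((inv_into U \<Phi> \<circ> \<Psi>) has_derivative (*v) K) (at 0)"
    using parametrises_transition(1)[OF \<Psi> \<Phi> eq[symmetric] chart(1) chart' chart(3,4)] by blast
  have id: "P ** Q = mat 1"
    if 1: "parametrises A \<Phi> U V" "parametrises A \<Psi> U' V'" "\<Phi> 0 = \<Psi> 0"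
      and ev: "\<forall>\<^sub>F s in nhds 0. s \<in> U \<and> \<Phi> s \<in> V'"
      and P: "((inv_into U \<Phi> \<circ> \<Psi>) has_derivative (*v) P) (at 0)"
      and Q: "((inv_into U' \<Psi> \<circ> \<Phi>) has_derivative (*v) Q) (at 0)"
    for \<Phi> \<Psi> :: "complex^'b \<Rightarrow> 'a" and U V U' V' P Q
  proof -
    have "(inv_into U' \<Psi> \<circ> \<Phi>) 0 = 0"
      using parametrises_inv(2)[OF 1(2), of 0] 1 unfolding parametrises_def by simp
    then have "((\<lambda>s. (inv_into U \<Phi> \<circ> \<Psi>) ((inv_into U' \<Psi> \<circ> \<Phi>) s)) has_derivative (\<lambda>h. P *v (Q *v h))) (at 0)"
      using has_derivative_compose[OF Q, of "inv_into U \<Phi> \<circ> \<Psi>" "(*v) P"] P by simp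
    moreover have "\<forall>\<^sub>F s in nhds 0. (inv_into U \<Phi> \<circ> \<Psi>) ((inv_into U' \<Psi> \<circ> \<Phi>) s) = s"
      using ev by eventually_elim (simp add: parametrises_inv[OF 1(1)] parametrises_inv[OF 1(2)])
    then obtain T where "open T" "0 \<in> T" "\<And>s. s \<in> T \<Longrightarrow> (inv_into U \<Phi> \<circ> \<Psi>) ((inv_into U' \<Psi> \<circ> \<Phi>) s) = s"
      unfolding eventually_nhds by blast
    ultimately have "((\<lambda>s. s) has_derivative (\<lambda>h. P *v (Q *v h))) (at 0)"
      by (rule has_derivative_transform_within_open)
    from has_derivative_unique[OF this has_derivative_ident]
    have "P *v (Q *v h) = h" for h by metis
    then show ?thesis by (simp add: matrix_eq matrix_vector_mul_assoc)
  qed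
  show ?thesis
    by (rule that[OF J])
      (rule id[OF \<Psi> \<Phi> eq[symmetric] parametrises_transition(2)[OF \<Psi> \<Phi> eq[symmetric] chart(1) chart' chart(3,4)] J K]
        id[OF \<Phi> \<Psi> eq parametrises_transition(2)[OF \<Phi> \<Psi> eq chart] K J])+
qed

text \<open>\<Theta> and the identity are two parametrisations of the space itself with its single
  identity chart, and \<Theta> is the transition between them.\<close>

lemma biholomorphic_germ_derivative:
  assumes "biholomorphic_germ \<Theta>"
  obtains K where "(\<Theta> has_derivative (*v) (jacobian_at_0 \<Theta>)) (at 0)" "\<Theta> 0 = 0"
    "jacobian_at_0 \<Theta> ** K = mat 1" "K ** jacobian_at_0 \<Theta> = mat 1"
proof -
  let ?A = "{(UNIV, id)} :: (complex^'a, 'a) atlas"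
  obtain U V where \<Theta>: "\<Theta> 0 = 0" "parametrises ?A \<Theta> U V"
    using assms unfolding biholomorphic_germ_def local_parametrisation_iff by blast
  have hol: "holo_map_on (\<lambda>x::complex^'a. x) UNIV"
    unfolding holo_map_on_def holo_on_def
  proof (intro allI ballI)
    fix i and x :: "complex^'a"
    have "((\<lambda>x. x $ i) has_derivative (\<lambda>h. h $ i)) (at x)"
      by (rule bounded_linear_imp_has_derivative[OF bounded_linear_vec_nth])
    then show "\<exists>D. ((\<lambda>x. x $ i) has_derivative D) (at x) \<and> (\<forall>c v. D (c *s v) = c * D v)"
      by (intro exI[of _ "\<lambda>h. h $ i"]) simp
  qed
  have inv_id: "inv_into UNIV id = (id :: complex^'a \<Rightarrow> complex^'a)" by (rule inv_id)
  have "parametrises ?A id UNIV UNIV"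
    unfolding parametrises_def using hol by (simp add: inv_id id_def o_def bij_betw_def)
  from parametrises_transition_invertible[OF \<Theta>(2) this, of UNIV id]
  obtain J K where J: "((inv_into UNIV id \<circ> \<Theta>) has_derivative (*v) J) (at 0)" "J ** K = mat 1" "K ** J = mat 1"
    using \<Theta>(1) by auto
  have der: "(\<Theta> has_derivative (*v) J) (at 0)" using J(1) by (simp add: inv_id)
  have "jacobian_at_0 \<Theta> = J"
    unfolding jacobian_at_0_def frechet_derivative_at[OF der, symmetric] by (rule matrix_of_matrix_vector_mul)
  with that der \<Theta>(1) J show ?thesis by blast
qed

lemma complex_atlas_chart:
  assumes "complex_atlas A"
  obtains W \<phi> where "(W, \<phi>) \<in> A" "b \<in> W" "open W" "inj_on \<phi> W" "continuous_on W \<phi>"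
proof -
  note atlas = assms[unfolded complex_atlas_def]
  have "b \<in> (\<Union>(W, \<phi>)\<in>A. W)" using atlas by simp
  then obtain W \<phi> where W: "(W, \<phi>) \<in> A" "b \<in> W" by auto
  obtain g where g: "homeomorphism W (\<phi> ` W) \<phi> g" "open W" "open (\<phi> ` W)"
    using bspec[OF conjunct1[OF atlas] W(1)] by auto
  then have "inj_on \<phi> W" by (metis homeomorphism_apply1 inj_on_inverseI)
  with W g that show ?thesis unfolding homeomorphism_def by blast
qed

text \<open>Factoring through a chart shows the composite holomorphic near 0, so its
  \<open>germ_series\<close> is a genuine expansion.\<close>

lemma holo_function_has_series:
  assumes A: "complex_atlas A" and f: "f \<in> holo_functions A" and \<Phi>: "parametrises A \<Phi> U V"
  shows "has_series (f \<circ> \<Phi>) (germ_series (f \<circ> \<Phi>))"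
proof -
  obtain W \<phi> where W: "(W, \<phi>) \<in> A" "\<Phi> 0 \<in> W" "open W" "inj_on \<phi> W" "continuous_on W \<phi>"
    by (rule complex_atlas_chart[OF A])
  define S where "S = U \<inter> \<Phi> -` W"
  have S: "open S" "0 \<in> S"
    using \<Phi> W unfolding S_def parametrises_def by (auto intro: continuous_open_preimage)
  have "holo_on (f \<circ> inv_into W \<phi>) (\<phi> ` W)" using f W(1) unfolding holo_functions_def by blast
  moreover have "holo_map_on (\<phi> \<circ> \<Phi>) S" using \<Phi> W(1) unfolding S_def parametrises_def by blast
  ultimately have "holo_on ((f \<circ> inv_into W \<phi>) \<circ> (\<phi> \<circ> \<Phi>)) S"
    by (rule holo_on_compose) (auto simp: S_def)
  then have "holo_on (f \<circ> \<Phi>) S"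
    by (rule holo_on_cong[OF S(1), rotated]) (use W(4) in \<open>auto simp: S_def\<close>)
  from holo_on_has_series[OF this S] obtain c where "has_series (f \<circ> \<Phi>) c"
    unfolding has_series_def by blast
  then show ?thesis using germ_series_has_series by metis
qed

text \<open>Continuity of the local inverse at the centre is extracted from its differentiability in
  a chart combined with continuity of the chart.\<close>

lemma parametrises_inv_tendsto:
  assumes A: "complex_atlas A" and \<Phi>: "parametrises A \<Phi> U V"
  shows "filterlim (inv_into U \<Phi>) (nhds 0) (nhds (\<Phi> 0))"
    and "\<forall>\<^sub>F x in nhds (\<Phi> 0). x \<in> V"
proof -
  obtain W \<phi> where W: "(W, \<phi>) \<in> A" "\<Phi> 0 \<in> W" "open W" "inj_on \<phi> W" "continuous_on W \<phi>"
    by (rule complex_atlas_chart[OF A])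
  have V: "open V" "\<Phi> 0 \<in> V" "0 \<in> U"
    using \<Phi> parametrises_inv(1)[OF \<Phi>] unfolding parametrises_def by auto
  show ev: "\<forall>\<^sub>F x in nhds (\<Phi> 0). x \<in> V" using V(1,2) by (rule eventually_nhds_in_open)
  have "holo_map_on (inv_into U \<Phi> \<circ> inv_into W \<phi>) (\<phi> ` (V \<inter> W))"
    using \<Phi> W(1) unfolding parametrises_def by blast
  moreover have "\<phi> (\<Phi> 0) \<in> \<phi> ` (V \<inter> W)" using V(2) W(2) by blast
  ultimately obtain D where "((inv_into U \<Phi> \<circ> inv_into W \<phi>) has_derivative D) (at (\<phi> (\<Phi> 0)))"
    by (rule holo_map_on_has_derivative)
  then have "isCont (inv_into U \<Phi> \<circ> inv_into W \<phi>) (\<phi> (\<Phi> 0))" by (rule has_derivative_continuous)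
  then have 1: "filterlim (inv_into U \<Phi> \<circ> inv_into W \<phi>) (nhds 0) (nhds (\<phi> (\<Phi> 0)))"
    using tendsto_at_iff_tendsto_nhds[of "inv_into U \<Phi> \<circ> inv_into W \<phi>" "\<phi> (\<Phi> 0)"]
      W parametrises_inv(2)[OF \<Phi> V(3)] unfolding isCont_def by simp
  have "isCont \<phi> (\<Phi> 0)" using W continuous_on_eq_continuous_at by blast
  then have 2: "filterlim \<phi> (nhds (\<phi> (\<Phi> 0))) (nhds (\<Phi> 0))"
    using tendsto_at_iff_tendsto_nhds[of \<phi> "\<Phi> 0"] unfolding isCont_def by blast
  have "\<forall>\<^sub>F x in nhds (\<Phi> 0). x \<in> W" using W(3,2) by (rule eventually_nhds_in_open)
  then have "\<forall>\<^sub>F x in nhds (\<Phi> 0). (inv_into U \<Phi> \<circ> inv_into W \<phi>) (\<phi> x) = inv_into U \<Phi> x"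
    by eventually_elim (simp add: W(4))
  from filterlim_cong[OF refl refl this] filterlim_compose[OF 1 2]
  show "filterlim (inv_into U \<Phi>) (nhds 0) (nhds (\<Phi> 0))" by simp
qed

section \<open>Germs\<close>

lemma germ_at_eq_iff: "germ_at b f = germ_at b g \<longleftrightarrow> (\<forall>\<^sub>F x in nhds b. f x = g x)"
proof
  assume "germ_at b f = germ_at b g"
  moreover have "f \<in> germ_at b f" by (simp add: germ_at_def)
  ultimately show "\<forall>\<^sub>F x in nhds b. f x = g x" by (simp add: germ_at_def)
next
  assume eq: "\<forall>\<^sub>F x in nhds b. f x = g x"
  have "(\<forall>\<^sub>F x in nhds b. k x = f x) \<longleftrightarrow> (\<forall>\<^sub>F x in nhds b. k x = g x)" for k
    by (rule eventually_cong[OF eq]) simp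
  then show "germ_at b f = germ_at b g" by (simp add: germ_at_def)
qed

lemma germ_algebra_add: "germ_at b f \<oplus>\<^bsub>germ_algebra b\<^esub> germ_at b g = germ_at b (f + g)"
proof -
  have "(\<exists>g'\<in>germ_at b f. \<exists>h\<in>germ_at b g. \<forall>\<^sub>F x in nhds b. k x = g' x + h x) \<longleftrightarrow>
      (\<forall>\<^sub>F x in nhds b. k x = f x + g x)" for k
  proof
    assume "\<exists>g'\<in>germ_at b f. \<exists>h\<in>germ_at b g. \<forall>\<^sub>F x in nhds b. k x = g' x + h x"
    then obtain g' h where "\<forall>\<^sub>F x in nhds b. g' x = f x" "\<forall>\<^sub>F x in nhds b. h x = g x"
      "\<forall>\<^sub>F x in nhds b. k x = g' x + h x"
      by (auto simp: germ_at_def)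
    then show "\<forall>\<^sub>F x in nhds b. k x = f x + g x" by eventually_elim simp
  next
    have "f \<in> germ_at b f" "g \<in> germ_at b g" by (simp_all add: germ_at_def)
    moreover assume "\<forall>\<^sub>F x in nhds b. k x = f x + g x"
    ultimately show "\<exists>g'\<in>germ_at b f. \<exists>h\<in>germ_at b g. \<forall>\<^sub>F x in nhds b. k x = g' x + h x" by blast
  qed
  then show ?thesis by (simp add: germ_algebra_def germ_at_def plus_fun_def)
qed

lemma germ_algebra_smult: "(a::complex) \<odot>\<^bsub>germ_algebra b\<^esub> germ_at b f = germ_at b (fun_scale a f)"
proof -
  have "(\<exists>g'\<in>germ_at b f. \<forall>\<^sub>F x in nhds b. k x = a * g' x) \<longleftrightarrow> (\<forall>\<^sub>F x in nhds b. k x = a * f x)" for k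
  proof
    assume "\<exists>g'\<in>germ_at b f. \<forall>\<^sub>F x in nhds b. k x = a * g' x"
    then obtain g' where "\<forall>\<^sub>F x in nhds b. g' x = f x" "\<forall>\<^sub>F x in nhds b. k x = a * g' x"
      by (auto simp: germ_at_def)
    then show "\<forall>\<^sub>F x in nhds b. k x = a * f x" by eventually_elim simp
  qed (auto simp: germ_at_def intro!: exI[of _ f])
  then show ?thesis by (simp add: germ_algebra_def germ_at_def)
qed

lemma germ_space_simps:
  "carrier (germ_space b Z) = germ_at b ` Z"
  "germ_at b f \<oplus>\<^bsub>germ_space b Z\<^esub> germ_at b g = germ_at b (f + g)"
  "a \<odot>\<^bsub>germ_space b Z\<^esub> germ_at b f = germ_at b (fun_scale a f)"
  "\<zero>\<^bsub>germ_space b Z\<^esub> = germ_at b 0"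
  using germ_algebra_add[of b f g] germ_algebra_smult[of b a f]
  by (simp_all add: germ_space_def germ_algebra_def zero_fun_def)

text \<open>Representatives agree near the centre, hence by continuity of \<Phi> their pullbacks
  agree near 0; the choice made in \<open>pull_germ\<close> is harmless.\<close>

lemma pull_germ_eq:
  assumes \<Phi>: "parametrises A \<Phi> U V"
  shows "pull_germ \<Phi> (germ_at (\<Phi> 0) f) = germ_series (f \<circ> \<Phi>)"
  unfolding pull_germ_def
proof (rule germ_series_cong)
  have "(SOME g. g \<in> germ_at (\<Phi> 0) f) \<in> germ_at (\<Phi> 0) f"
    by (rule someI[of _ f]) (simp add: germ_at_def)
  then have "\<forall>\<^sub>F x in nhds (\<Phi> 0). (SOME g. g \<in> germ_at (\<Phi> 0) f) x = f x"
    by (simp add: germ_at_def)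
  then show "\<forall>\<^sub>F s in nhds 0. ((SOME g. g \<in> germ_at (\<Phi> 0) f) \<circ> \<Phi>) s = (f \<circ> \<Phi>) s"
    using parametrises_tendsto[OF \<Phi>] unfolding filterlim_iff o_def by blast
qed

text \<open>Equal series mean equality near 0, which is carried back to the manifold along the
  continuous local inverse.\<close>

lemma germ_series_eq_imp_germ_eq:
  assumes A: "complex_atlas A" and \<Phi>: "parametrises A \<Phi> U V"
    and f: "f \<in> holo_functions A" and g: "g \<in> holo_functions A"
    and eq: "germ_series (f \<circ> \<Phi>) = germ_series (g \<circ> \<Phi>)"
  shows "germ_at (\<Phi> 0) f = germ_at (\<Phi> 0) g"
  unfolding germ_at_eq_iff
proof -
  have "\<forall>\<^sub>F s in nhds 0. (f \<circ> \<Phi>) s = (g \<circ> \<Phi>) s"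
    using has_series_same_imp_eq[OF holo_function_has_series[OF A f \<Phi>, unfolded eq]
        holo_function_has_series[OF A g \<Phi>]] .
  then have "\<forall>\<^sub>F x in nhds (\<Phi> 0). (f \<circ> \<Phi>) (inv_into U \<Phi> x) = (g \<circ> \<Phi>) (inv_into U \<Phi> x)"
    using parametrises_inv_tendsto(1)[OF A \<Phi>] unfolding filterlim_iff by blast
  with parametrises_inv_tendsto(2)[OF A \<Phi>] show "\<forall>\<^sub>F x in nhds (\<Phi> 0). f x = g x"
    by eventually_elim (simp add: parametrises_inv[OF \<Phi>])
qed

section \<open>The algebra structure on the space of germs\<close>

lemma series_space_eq_image: "series_space \<Phi> Z = (\<lambda>f. germ_series (f \<circ> \<Phi>)) ` Z"
  unfolding series_space_def by blast

text \<open>Least parts of corresponding generators correspond under the substitution, and a linear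
  map commutes with taking spans.\<close>

lemma least_space_compose:
  fixes \<Phi> \<Psi> :: "complex^'n::finite \<Rightarrow> 'm::{t2_space, second_countable_topology}"
  assumes A: "complex_atlas A" and Z: "Z \<subseteq> holo_functions A"
    and \<Phi>: "parametrises A \<Phi> U V" and \<Psi>: "parametrises A \<Psi> U' V'"
    and der: "(\<Theta> has_derivative (*v) J) (at 0)" "\<Theta> 0 = 0" "J ** K = mat 1"
    and eq: "\<forall>\<^sub>F s in nhds 0. \<Phi> s = \<Psi> (\<Theta> s)"
  shows "least_space \<Phi> Z = lin_subst J ` least_space \<Psi> Z"
proof -
  interpret lin: Modules.module_hom poly_scale poly_scale "lin_subst J"
    by unfold_locales (simp_all add: lin_subst_add lin_subst_scale)
  have "least_part (germ_series (f \<circ> \<Phi>)) = lin_subst J (least_part (germ_series (f \<circ> \<Psi>)))" if "f \<in> Z" for f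
  proof (rule least_part_compose[OF der])
    show "has_series (f \<circ> \<Psi>) (germ_series (f \<circ> \<Psi>))" "has_series (f \<circ> \<Phi>) (germ_series (f \<circ> \<Phi>))"
      using holo_function_has_series[OF A] \<Phi> \<Psi> Z that by blast+
    show "\<forall>\<^sub>F s in nhds 0. (f \<circ> \<Phi>) s = (f \<circ> \<Psi>) (\<Theta> s)"
      using eq by eventually_elim simp
  qed
  then have "least_part ` series_space \<Phi> Z = lin_subst J ` least_part ` series_space \<Psi> Z"
    unfolding series_space_eq_image image_image by (rule image_cong[OF refl])
  then show ?thesis unfolding least_space_def by (simp only: lin.span_image)
qed

lemma D_invariant_lin_subst:
  assumes L: "D_invariant L" "ps.subspace L"
  shows "D_invariant (lin_subst J ` L)"
proof -
  interpret lin: Modules.module_hom poly_scale poly_scale "lin_subst J"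
    by unfold_locales (simp_all add: lin_subst_add lin_subst_scale)
  have sub: "ps.subspace (lin_subst J ` L)" using L(2) by (rule lin.subspace_image)
  show ?thesis unfolding D_invariant_def
  proof (intro allI ballI)
    fix i q assume "q \<in> lin_subst J ` L"
    then obtain p where "p \<in> L" "q = lin_subst J p" by blast
    moreover have "lin_subst J (poly_deriv l p) \<in> lin_subst J ` L" for l
      using L(1) \<open>p \<in> L\<close> unfolding D_invariant_def by blast
    ultimately show "poly_deriv i q \<in> lin_subst J ` L"
      unfolding poly_deriv_lin_subst by (simp add: ps.subspace_sum[OF sub] ps.subspace_scale[OF sub] poly_deriv_lin_subst)
  qed
qed

lemma perp_span: "f \<in> perp (ps.span X) \<longleftrightarrow> convergent_series f \<and> (\<forall>p\<in>X. sesqui p f = 0)"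
proof
  assume "convergent_series f \<and> (\<forall>p\<in>X. sesqui p f = 0)"
  moreover have "sesqui p f = 0" if "p \<in> ps.span X" "\<forall>p\<in>X. sesqui p f = 0" for p
    using that(1)
  proof (induction rule: ps.span_induct)
    case base
    then show ?case
      by (rule ps.subspaceI) (simp_all add: sesqui_add_left sesqui_scale_left)
  qed (use that(2) in blast)
  ultimately show "f \<in> perp (ps.span X)" by (simp add: perp_def)
qed (auto simp: perp_def ps.span_base)

context
  fixes A :: "('m::{t2_space, second_countable_topology}, 'n::finite) atlas"
    and Z :: "('m \<Rightarrow> complex) set" and \<Phi> :: "complex^'n \<Rightarrow> 'm" and U V
  assumes A: "complex_atlas A" and Z: "Z \<subseteq> holo_functions A" and fin: "fin_dim_subspace Z"
    and \<Phi>: "parametrises A \<Phi> U V"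
begin

lemma space_subspace: "fs.subspace Z"
  using fin unfolding fin_dim_subspace_def by blast

lemma space_add: "f \<in> Z \<Longrightarrow> g \<in> Z \<Longrightarrow> f + g \<in> Z"
  and space_scale: "f \<in> Z \<Longrightarrow> fun_scale a f \<in> Z"
  and space_diff: "f \<in> Z \<Longrightarrow> g \<in> Z \<Longrightarrow> f - g \<in> Z"
  and space_zero: "0 \<in> Z"
  using fs.subspace_add fs.subspace_scale fs.subspace_diff fs.subspace_0 space_subspace by blast+

lemma space_has_series: "f \<in> Z \<Longrightarrow> has_series (f \<circ> \<Phi>) (germ_series (f \<circ> \<Phi>))"
  using holo_function_has_series[OF A _ \<Phi>] Z by blast

lemma series_add: "f \<in> Z \<Longrightarrow> g \<in> Z \<Longrightarrow> germ_series ((f + g) \<circ> \<Phi>) = germ_series (f \<circ> \<Phi>) + germ_series (g \<circ> \<Phi>)"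
  using germ_series_has_series[OF has_series_add[OF space_has_series space_has_series]]
  by (simp add: plus_fun_def o_def)

lemma series_scale: "f \<in> Z \<Longrightarrow> germ_series (fun_scale a f \<circ> \<Phi>) = fun_scale a (germ_series (f \<circ> \<Phi>))"
  using germ_series_has_series[OF has_series_scale[OF space_has_series]]
  by (simp add: fun_scale_def o_def)

lemma series_diff:
  assumes "f \<in> Z" "g \<in> Z"
  shows "germ_series ((f - g) \<circ> \<Phi>) = germ_series (f \<circ> \<Phi>) - germ_series (g \<circ> \<Phi>)"
  using series_add[OF space_diff[OF assms] assms(2)] by simp

lemma series_convergent: "f \<in> Z \<Longrightarrow> convergent_series (germ_series (f \<circ> \<Phi>))"
  using space_has_series unfolding has_series_def by blast

lemma in_perp_ideal_iff:
  "c \<in> perp_ideal \<Phi> Z \<longleftrightarrow> convergent_series c \<and> (\<forall>f\<in>Z. sesqui (least_part (germ_series (f \<circ> \<Phi>))) c = 0)"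
  unfolding least_space_def perp_span series_space_def by blast

lemma series_in_perp_ideal_imp_0: "f \<in> Z \<Longrightarrow> germ_series (f \<circ> \<Phi>) \<in> perp_ideal \<Phi> Z \<Longrightarrow> germ_series (f \<circ> \<Phi>) = 0"
  unfolding in_perp_ideal_iff by (intro orthogonal_to_least_part_eq_0) blast

text \<open>The surjectivity statement. The series of elements of \<open>Z\<close> form the span of
  finitely many of them, so an orthogonal residue exists.\<close>

lemma exists_series_mod_perp_ideal:
  assumes c: "convergent_series c"
  shows "\<exists>f\<in>Z. c - germ_series (f \<circ> \<Phi>) \<in> perp_ideal \<Phi> Z"
proof -
  let ?T = "\<lambda>f. germ_series (f \<circ> \<Phi>)"
  obtain B where B: "finite B" "B \<subseteq> Z" "fs.span B = Z"
    using fin unfolding fin_dim_subspace_def by blast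
  have "fs.subspace (?T ` Z)"
  proof (rule fs.subspaceI)
    have "?T 0 = 0" using series_scale[OF space_zero, of 0] by (simp add: fun_scale_def zero_fun_def)
    then show "0 \<in> ?T ` Z" using space_zero by (metis imageI)
    fix x y a assume "x \<in> ?T ` Z" "y \<in> ?T ` Z"
    then obtain f g where "f \<in> Z" "x = ?T f" "g \<in> Z" "y = ?T g" by blast
    then show "x + y \<in> ?T ` Z"
      using series_add[of f g] space_add[of f g] by (intro image_eqI[of _ _ "f + g"]) simp_all
  next
    fix x a assume "x \<in> ?T ` Z"
    then obtain f where "f \<in> Z" "x = ?T f" by blast
    then show "fun_scale a x \<in> ?T ` Z"
      using series_scale[of f a] space_scale[of f a] by (intro image_eqI[of _ _ "fun_scale a f"]) simp_all
  qed
  then have sub: "fs.span (?T ` B) \<subseteq> ?T ` Z" using B(2) by (intro fs.span_minimal) auto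
  have sup: "?T f \<in> fs.span (?T ` B)" if "f \<in> Z" for f
  proof -
    have "f \<in> fs.span B" using that B(3) by simp
    \<comment> \<open>Membership in \<open>Z\<close> is carried along because passing to series is
      known to be linear only on \<open>Z\<close>, where expansions exist.\<close>
    then have "f \<in> Z \<and> ?T f \<in> fs.span (?T ` B)"
    proof (induction rule: fs.span_induct)
      case base
      then show ?case
      proof (rule fs.subspaceI)
        have "?T 0 = 0" using series_scale[OF space_zero, of 0] by (simp add: fun_scale_def zero_fun_def)
        then show "0 \<in> {f. f \<in> Z \<and> ?T f \<in> fs.span (?T ` B)}" using space_zero fs.span_zero by auto
        fix x y assume "x \<in> {f. f \<in> Z \<and> ?T f \<in> fs.span (?T ` B)}" "y \<in> {f. f \<in> Z \<and> ?T f \<in> fs.span (?T ` B)}"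
        then have xy: "x \<in> Z" "y \<in> Z" "?T x \<in> fs.span (?T ` B)" "?T y \<in> fs.span (?T ` B)" by blast+
        show "x + y \<in> {f. f \<in> Z \<and> ?T f \<in> fs.span (?T ` B)}"
          unfolding mem_Collect_eq series_add[OF xy(1,2)] using space_add fs.span_add xy by blast
      next
        fix c x assume "x \<in> {f. f \<in> Z \<and> ?T f \<in> fs.span (?T ` B)}"
        then have x: "x \<in> Z" "?T x \<in> fs.span (?T ` B)" by blast+
        show "fun_scale c x \<in> {f. f \<in> Z \<and> ?T f \<in> fs.span (?T ` B)}"
          unfolding mem_Collect_eq series_scale[OF x(1)] using space_scale fs.span_scale x by blast
      qed
    next
      case (step x)
      then show ?case using B(2) fs.span_base[of "?T x" "?T ` B"] by blast
    qed
    then show ?thesis ..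
  qed
  obtain v where v: "v \<in> fs.span (?T ` B)"
    "\<And>g. g \<in> fs.span (?T ` B) \<Longrightarrow> sesqui (least_part g) (c - v) = 0"
    using exists_orthogonal_residue[OF finite_imageI[OF B(1)], of ?T c] by blast
  obtain f where f: "f \<in> Z" "v = ?T f" using v(1) sub by blast
  have "convergent_series (c - v)"
    using convergent_lincomb[OF c series_convergent[OF f(1)], of 1 "-1"] by (simp add: f(2) fun_diff_def)
  then have "c - v \<in> perp_ideal \<Phi> Z" unfolding in_perp_ideal_iff using v(2) sup by blast
  with f show ?thesis by blast
qed

lemma germ_to_quotient_eq:
  "germ_to_quotient \<Phi> Z (germ_at (\<Phi> 0) f) = perp_ideal \<Phi> Z +>\<^bsub>conv_series\<^esub> germ_series (f \<circ> \<Phi>)"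
  unfolding germ_to_quotient_def pull_germ_eq[OF \<Phi>] ..

lemma germ_algebra_structure:
  assumes D: "D_invariant (least_space \<Phi> Z)"
  shows "ideal (perp_ideal \<Phi> Z) conv_series"
    and "artinian_algebra (perp_quotient \<Phi> Z)"
    and "germ_to_quotient \<Phi> Z \<in> linear_iso (germ_space (\<Phi> 0) Z) (perp_quotient \<Phi> Z)"
    and "artinian_algebra (transport_algebra (germ_space (\<Phi> 0) Z) (perp_quotient \<Phi> Z) (germ_to_quotient \<Phi> Z))"
    and "germ_to_quotient \<Phi> Z \<in>
      algebra_iso (transport_algebra (germ_space (\<Phi> 0) Z) (perp_quotient \<Phi> Z) (germ_to_quotient \<Phi> Z)) (perp_quotient \<Phi> Z)"
proof -
  let ?I = "perp_ideal \<Phi> Z" and ?Q = "perp_quotient \<Phi> Z" and ?h = "germ_to_quotient \<Phi> Z"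
  let ?G = "germ_space (\<Phi> 0) Z" and ?g = "germ_at (\<Phi> 0)" and ?T = "\<lambda>f. germ_series (f \<circ> \<Phi>)"
  let ?W = "transport_algebra ?G ?Q ?h"
  show I: "ideal ?I conv_series" using D by (rule perp_ideal_if_D_invariant)
  note alg = algebra_conv_series I
  have Q: "Module.algebra complex_field ?Q" by (rule algebra_quot_algebra[OF alg])
  obtain B where "finite B" "B \<subseteq> Z" "fs.span B = Z"
    using fin unfolding fin_dim_subspace_def by blast
  note B = this(1,3)
  have T: "?T f \<in> carrier conv_series" if "f \<in> Z" for f
    using series_convergent[OF that] by simp
  have h_add: "?h (?g (f + g)) = ?h (?g f) \<oplus>\<^bsub>?Q\<^esub> ?h (?g g)" if fg: "f \<in> Z" "g \<in> Z" for f g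
    unfolding germ_to_quotient_eq series_add[OF fg] quot_algebra_add[OF alg T[OF fg(1)] T[OF fg(2)]]
    by (simp only: conv_series_simps plus_fun_def)
  have h_scale: "?h (?g (fun_scale a f)) = a \<odot>\<^bsub>?Q\<^esub> ?h (?g f)" if f: "f \<in> Z" for a f
    unfolding germ_to_quotient_eq series_scale[OF f] quot_algebra_smult[OF alg T[OF f]]
    by (simp only: conv_series_simps fun_scale_def)
  have h_surj: "(\<lambda>f. ?h (?g f)) ` Z = carrier ?Q"
  proof (intro equalityI subsetI)
    fix X assume "X \<in> carrier ?Q"
    then obtain c where c: "convergent_series c" "X = ?I +>\<^bsub>conv_series\<^esub> c"
      unfolding carrier_quot_algebra[OF alg] by auto
    obtain f where f: "f \<in> Z" "c - ?T f \<in> ?I" using exists_series_mod_perp_ideal[OF c(1)] by blast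
    then have "X = ?h (?g f)"
      using coset_eq_iff[OF alg, of c "?T f"] c
      by (simp add: germ_to_quotient_eq conv_series_minus series_convergent)
    with f show "X \<in> (\<lambda>f. ?h (?g f)) ` Z" by blast
  qed (auto simp: germ_to_quotient_eq carrier_quot_algebra[OF alg] series_convergent)
  have h_inj: "inj_on ?h (?g ` Z)"
  proof (rule inj_onI, clarify)
    fix f g assume fg: "f \<in> Z" "g \<in> Z" "?h (?g f) = ?h (?g g)"
    then have "?T f - ?T g \<in> ?I"
      using coset_eq_iff[OF alg, of "?T f" "?T g"]
      by (simp add: germ_to_quotient_eq conv_series_minus series_convergent)
    \<comment> \<open>This difference is itself the series of an element of \<open>Z\<close>, so it
      is orthogonal to its own least part.\<close>
    then have "?T (f - g) \<in> ?I" using fg by (simp add: series_diff)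
    then have "?T (f - g) = 0" using series_in_perp_ideal_imp_0 space_diff fg by blast
    then have "?T f = ?T g" using fg by (simp add: series_diff)
    then show "?g f = ?g g" using germ_series_eq_imp_germ_eq[OF A \<Phi>] Z fg by blast
  qed
  show iso: "?h \<in> linear_iso ?G ?Q"
    unfolding linear_iso_def
  proof (intro CollectI conjI ballI allI)
    show "bij_betw ?h (carrier ?G) (carrier ?Q)"
      using h_inj h_surj by (simp add: bij_betw_def germ_space_simps image_image)
  qed (auto simp: germ_space_simps h_add h_scale)
  \<comment> \<open>The quotient is a linear image of \<open>Z\<close>, whose finite dimension
    bounds chains of ideals.\<close>
  show "artinian_algebra ?Q"
    by (rule artinian_algebra_linear_image[OF Q B(1), of "\<lambda>f. ?h (?g f)"])
      (auto simp: B(2) h_surj h_add h_scale)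
  have "?T 0 = 0" using series_scale[OF space_zero, of 0] by (simp add: fun_scale_def zero_fun_def)
  then have zero: "?h \<zero>\<^bsub>?G\<^esub> = \<zero>\<^bsub>?Q\<^esub>"
    by (simp add: germ_space_simps germ_to_quotient_eq quot_algebra_zero[OF alg] zero_fun_def)
  have add_closed: "x \<oplus>\<^bsub>?G\<^esub> y \<in> carrier ?G" if "x \<in> carrier ?G" "y \<in> carrier ?G" for x y
    using that by (auto simp: germ_space_simps space_add)
  have smult_closed: "a \<odot>\<^bsub>?G\<^esub> x \<in> carrier ?G" if "x \<in> carrier ?G" for x a
    using that by (auto simp: germ_space_simps space_scale)
  have zero_closed: "\<zero>\<^bsub>?G\<^esub> \<in> carrier ?G" by (simp add: germ_space_simps space_zero)
  note W = transport_algebra_iso[OF Q iso add_closed smult_closed zero_closed zero]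
  show "?h \<in> algebra_iso ?W ?Q" by (rule W(2))
  show "artinian_algebra ?W"
    by (rule artinian_algebra_linear_image[OF W(1) B(1), where T = ?g])
      (auto simp: B(2) transport_algebra_def germ_space_simps)
qed

end

section \<open>Change of parametrisation\<close>

lemma adj_subst_eq:
  assumes "convergent_series f"
  shows "adj_subst J f = adj_series J f"
  unfolding adj_subst_def
proof (rule the_equality)
  show "adj_series J f \<in> carrier conv_series \<and> (\<forall>p. sesqui (lin_subst J p) f = sesqui p (adj_series J f))"
    using assms by (simp add: convergent_adj_series sesqui_adj_series)
  \<comment> \<open>Testing against monomials recovers every coefficient, so the adjoint relation
    has no other solution.\<close>
  show "h = adj_series J f" if "h \<in> carrier conv_series \<and> (\<forall>p. sesqui (lin_subst J p) f = sesqui p h)" for h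
    using that by (intro sesqui_eqI) (simp add: sesqui_adj_series)
qed

lemma adj_subst_algebra_iso:
  assumes "J ** K = mat 1" "K ** J = mat 1"
  shows "adj_subst J \<in> algebra_iso conv_series conv_series"
proof (rule algebra_isoI)
  have "bij_betw (adj_subst J) (Collect convergent_series) (Collect convergent_series)"
    by (rule bij_betw_byWitness[of _ "adj_subst K"])
      (auto simp: adj_subst_eq convergent_adj_series adj_series_adj_series assms adj_series_mat_one)
  then show "adj_subst J \<in> linear_iso conv_series conv_series"
    unfolding linear_iso_def
    by (auto simp: adj_subst_eq convergent_add convergent_scale adj_series_add adj_series_scale)
qed (auto simp: adj_subst_eq convergent_cmul convergent_monomial_series adj_series_mult adj_series_one)

text \<open>By adjointness, f is orthogonal to the substituted space exactly if its image is
  orthogonal to \<open>L\<close>; the adjoint for the inverse matrix \<open>K\<close> supplies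
  preimages.\<close>

lemma adj_subst_perp:
  assumes "J ** K = mat 1"
  shows "adj_subst J ` perp (lin_subst J ` L) = perp L"
proof (intro equalityI subsetI)
  fix h assume h: "h \<in> perp L"
  have "adj_series J (adj_series K h) = h" by (simp add: adj_series_adj_series assms adj_series_mat_one)
  moreover from this have "adj_series K h \<in> perp (lin_subst J ` L)"
    using h by (auto simp: perp_def convergent_adj_series sesqui_adj_series[of _ J, symmetric])
  ultimately show "h \<in> adj_subst J ` perp (lin_subst J ` L)"
    by (intro image_eqI[of _ _ "adj_series K h"]) (auto simp: adj_subst_eq perp_def)
qed (auto simp: perp_def adj_subst_eq convergent_adj_series sesqui_adj_series)

text \<open>Independence of the choice of parametrisation: the transition map presents one least
  space as a linear substitution of the other, and such substitutions preserve
  \<open>D\<close>-invariance of subspaces.\<close>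

lemma D_invariant_least_space:
  fixes \<Phi> \<Psi> :: "complex^'n::finite \<Rightarrow> 'm::{t2_space, second_countable_topology}"
  assumes A: "complex_atlas A" and Z: "Z \<subseteq> holo_functions A"
    and \<Phi>: "parametrises A \<Phi> U V" and \<Psi>: "parametrises A \<Psi> U' V'" and eq: "\<Phi> 0 = \<Psi> 0"
    and D: "D_invariant (least_space \<Psi> Z)"
  shows "D_invariant (least_space \<Phi> Z)"
proof -
  obtain W \<phi> where W: "(W, \<phi>) \<in> A" "\<Phi> 0 \<in> W" "open W" "inj_on \<phi> W" "continuous_on W \<phi>"
    by (rule complex_atlas_chart[OF A])
  obtain J K where J: "((inv_into U' \<Psi> \<circ> \<Phi>) has_derivative (*v) J) (at 0)" "J ** K = mat 1"
    using parametrises_transition_invertible[OF \<Phi> \<Psi> eq W(1-4)] by blast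
  have "(inv_into U' \<Psi> \<circ> \<Phi>) 0 = 0"
    using parametrises_inv(2)[OF \<Psi>, of 0] eq \<Psi> unfolding parametrises_def by simp
  moreover have "\<forall>\<^sub>F s in nhds 0. \<Phi> s = \<Psi> ((inv_into U' \<Psi> \<circ> \<Phi>) s)"
    using parametrises_transition(2)[OF \<Phi> \<Psi> eq W(1-4)]
    by eventually_elim (simp add: parametrises_inv[OF \<Psi>])
  ultimately have "least_space \<Phi> Z = lin_subst J ` least_space \<Psi> Z"
    using least_space_compose[OF A Z \<Phi> \<Psi> J(1) _ J(2)] by blast
  then show ?thesis
    using D_invariant_lin_subst[OF D] by (simp add: least_space_def ps.subspace_span)
qed

theorem theorem8p3:
  fixes A :: "('m::{t2_space, second_countable_topology}, 'n::finite) atlas"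
    and Z :: "('m \<Rightarrow> complex) set"
    and b :: 'm
  assumes "complex_atlas A"
    and "Z \<subseteq> holo_functions A"
    and "fin_dim_subspace Z"
    and "b \<in> inv_points A Z"
  shows
    "(\<forall>\<Phi>. local_parametrisation A b \<Phi> \<longrightarrow>
        ideal (perp_ideal \<Phi> Z) conv_series \<and>
        artinian_algebra (perp_quotient \<Phi> Z) \<and>
        germ_to_quotient \<Phi> Z \<in> linear_iso (germ_space b Z) (perp_quotient \<Phi> Z) \<and>
        (let Zb = transport_algebra (germ_space b Z) (perp_quotient \<Phi> Z) (germ_to_quotient \<Phi> Z)
         in artinian_algebra Zb \<and> germ_to_quotient \<Phi> Z \<in> algebra_iso Zb (perp_quotient \<Phi> Z)))
     \<and>
     (\<forall>\<Phi> \<Psi> \<Theta>. local_parametrisation A b \<Phi> \<and> local_parametrisation A b \<Psi> \<and>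
        biholomorphic_germ \<Theta> \<and> (\<forall>\<^sub>F s in nhds 0. \<Phi> s = \<Psi> (\<Theta> s)) \<longrightarrow>
        adj_subst (jacobian_at_0 \<Theta>) \<in> algebra_iso conv_series conv_series \<and>
        adj_subst (jacobian_at_0 \<Theta>) ` perp_ideal \<Phi> Z = perp_ideal \<Psi> Z \<and>
        (\<exists>F \<in> algebra_iso (perp_quotient \<Phi> Z) (perp_quotient \<Psi> Z).
           \<forall>f \<in> carrier conv_series.
             F (perp_ideal \<Phi> Z +>\<^bsub>conv_series\<^esub> f) =
             perp_ideal \<Psi> Z +>\<^bsub>conv_series\<^esub> adj_subst (jacobian_at_0 \<Theta>) f))"
proof -
  obtain \<Phi>0 U0 V0 where \<Phi>0: "\<Phi>0 0 = b" "parametrises A \<Phi>0 U0 V0" "D_invariant (least_space \<Phi>0 Z)"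
    using assms(4) unfolding inv_points_def local_parametrisation_iff by blast
  have D: "D_invariant (least_space \<Phi> Z)" if "\<Phi> 0 = b" "parametrises A \<Phi> U V" for \<Phi> U V
    using D_invariant_least_space[OF assms(1,2) that(2) \<Phi>0(2) _ \<Phi>0(3)] that(1) \<Phi>0(1) by simp
  show ?thesis
  proof (rule conjI; intro allI impI)
    fix \<Phi> assume "local_parametrisation A b \<Phi>"
    then obtain U V where p: "\<Phi> 0 = b" "parametrises A \<Phi> U V"
      unfolding local_parametrisation_iff by blast
    from germ_algebra_structure[OF assms(1-3) p(2) D[OF p]]
    show "ideal (perp_ideal \<Phi> Z) conv_series \<and>
        artinian_algebra (perp_quotient \<Phi> Z) \<and>
        germ_to_quotient \<Phi> Z \<in> linear_iso (germ_space b Z) (perp_quotient \<Phi> Z) \<and>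
        (let Zb = transport_algebra (germ_space b Z) (perp_quotient \<Phi> Z) (germ_to_quotient \<Phi> Z)
         in artinian_algebra Zb \<and> germ_to_quotient \<Phi> Z \<in> algebra_iso Zb (perp_quotient \<Phi> Z))"
      unfolding p(1) Let_def by blast
  next
    fix \<Phi> \<Psi> :: "complex^'n \<Rightarrow> 'm" and \<Theta>
    assume *: "local_parametrisation A b \<Phi> \<and> local_parametrisation A b \<Psi> \<and>
        biholomorphic_germ \<Theta> \<and> (\<forall>\<^sub>F s in nhds 0. \<Phi> s = \<Psi> (\<Theta> s))"
    obtain U V U' V' where p: "\<Phi> 0 = b" "parametrises A \<Phi> U V" and q: "\<Psi> 0 = b" "parametrises A \<Psi> U' V'"
      using * unfolding local_parametrisation_iff by blast
    let ?J = "jacobian_at_0 \<Theta>"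
    obtain K where \<Theta>: "(\<Theta> has_derivative (*v) ?J) (at 0)" "\<Theta> 0 = 0" "?J ** K = mat 1" "K ** ?J = mat 1"
      using * biholomorphic_germ_derivative by blast
    have iso: "adj_subst ?J \<in> algebra_iso conv_series conv_series"
      using \<Theta>(3,4) by (rule adj_subst_algebra_iso)
    \<comment> \<open>With \<Phi> equal to \<Psi> after \<Theta>, polynomials travel from the
      variables of \<Psi> to those of \<Phi>, so the adjoint on series runs from \<Phi> to
      \<Psi>.\<close>
    have least: "least_space \<Phi> Z = lin_subst ?J ` least_space \<Psi> Z"
      using least_space_compose[OF assms(1,2) p(2) q(2) \<Theta>(1-3)] * by blast
    have img: "adj_subst ?J ` perp_ideal \<Phi> Z = perp_ideal \<Psi> Z"
      unfolding least using \<Theta>(3) by (rule adj_subst_perp)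
    have "ideal (perp_ideal \<Phi> Z) conv_series" "ideal (perp_ideal \<Psi> Z) conv_series"
      using perp_ideal_if_D_invariant D[OF p] D[OF q] by blast+
    from iso img algebra_iso_quotient[OF algebra_conv_series algebra_conv_series this iso img]
    show "adj_subst ?J \<in> algebra_iso conv_series conv_series \<and>
        adj_subst ?J ` perp_ideal \<Phi> Z = perp_ideal \<Psi> Z \<and>
        (\<exists>F \<in> algebra_iso (perp_quotient \<Phi> Z) (perp_quotient \<Psi> Z).
           \<forall>f \<in> carrier conv_series.
             F (perp_ideal \<Phi> Z +>\<^bsub>conv_series\<^esub> f) =
             perp_ideal \<Psi> Z +>\<^bsub>conv_series\<^esub> adj_subst ?J f)"
      by blast
  qed
qed

end
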